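(* Let $k$ be a commutative ring, let $R$ be a $k$-algebra, and let $\mathsf{A}$ be a $k$-linear cocomplete abelian category. Then the functor $$\Psi:\mathsf{A}_R \to \mathsf{B}_k(\mathsf{Mod}\,R,\mathsf{A})$$ induced by the assignment $\Psi(\mathcal{F}) = -\otimes_R \mathcal{F}$ (sending a morphism $\phi:\mathcal F\to\mathcal G$ of $\mathsf A_R$ to the natural transformation $-\otimes_R\phi$) is an equivalence of categories.
   Context: $\mathsf{Mod}\,R$ is the category of right $R$-modules. Rings and algebras are associative and unital, not necessarily commutative unless stated. An additive category is cocomplete if it has arbitrary direct sums. An additive category is $k$-linear if all its Hom-sets are $k$-modules and composition is $k$-bilinear. For $a\in k$ and an object $X$, write $a_X:=a\cdot\mathrm{id}_X$. On $\mathsf{Mod}\,R$ the $k$-linear structure is $a_M(m)=m\cdot\gamma(a)$, where $\gamma:k\to R$ is the structure map. A functor $F$ between $k$-linear categories is $k$-linear if the maps $\mathrm{Hom}(X,Y)\to \mathrm{Hom}(FX,FY)$ are $k$-linear for all $X,Y$. $\mathsf{B}_k(\mathsf{C},\mathsf{A})$ is the full subcategory of the category of functors $\mathsf{C}\to\mathsf{A}$ consisting of the $k$-linear right exact functors that commute with direct limits. $\mathsf{A}_R$ is the category of left $R$-modules in $\mathsf{A}$: its objects are pairs $(\mathcal{F},\rho)$ with $\mathcal{F}$ an object of $\mathsf{A}$ and $\rho:R\to\mathrm{End}_{\mathsf{A}}(\mathcal{F})$ a $k$-algebra homomorphism. A morphism $(\mathcal{F},\rho)\to(\mathcal{G},\rho')$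 is an $\alpha\in\mathrm{Hom}_{\mathsf{A}}(\mathcal{F},\mathcal{G})$ with $\rho'(r)\circ\alpha=\alpha\circ\rho(r)$ for all $r\in R$. For $(\mathcal{F},\rho)\in\mathsf{A}_R$ and $\mathcal{N}\in\mathsf{A}$, $\mathrm{Hom}_{\mathsf{A}}(\mathcal{F},\mathcal{N})$ is a right $R$-module via $\alpha\cdot r:=\alpha\circ\rho(r)$, giving a functor $\mathrm{Hom}_{\mathsf{A}}(\mathcal{F},-):\mathsf{A}\to\mathsf{Mod}\,R$. This functor has a left adjoint (a known fact, due to cocompleteness); a left adjoint is fixed and denoted $-\otimes_R\mathcal{F}:\mathsf{Mod}\,R\to\mathsf{A}$. For a morphism $\phi:\mathcal{F}\to\mathcal{G}$ in $\mathsf{A}_R$ and $M\in\mathsf{Mod}\,R$, $M\otimes\phi:M\otimes_R\mathcal{F}\to M\otimes_R\mathcal{G}$ is the morphism corresponding, via the Yoneda lemma and the adjunctions, to the maps $\mathrm{Hom}_R(M,\mathrm{Hom}_{\mathsf{A}}(\mathcal{G},\mathcal{N}))\to\mathrm{Hom}_R(M,\mathrm{Hom}_{\mathsf{A}}(\mathcal{F},\mathcal{N}))$, $\psi\mapsto(m\mapsto\psi(m)\circ\phi)$, natural in $\mathcal{N}$; these give the natural transformation $-\otimes_R\phi$. *)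

theory Defs
  imports "HOL-Algebra.Module" "HOL-Library.FuncSet"
begin

unbundle cardinal_syntax

section \<open>Categories and functors\<close>

record ('o, 'a) category =
  Ob :: "'o set"
  Arr :: "'a set"
  Dom :: "'a \<Rightarrow> 'o"
  Cod :: "'a \<Rightarrow> 'o"
  Id :: "'o \<Rightarrow> 'a"
  Comp :: "'a \<Rightarrow> 'a \<Rightarrow> 'a"  (infixr "\<cdot>\<index>" 72)

definition Hom :: "('o, 'a, 'z) category_scheme \<Rightarrow> 'o \<Rightarrow> 'o \<Rightarrow> 'a set" where
  "Hom C X Y = {f \<in> Arr C. Dom C f = X \<and> Cod C f = Y}"

locale category =
  fixes C :: "('o, 'a, 'z) category_scheme" (structure)
  assumes Dom_Cod: "f \<in> Arr C \<Longrightarrow> Dom C f \<in> Ob C \<and> Cod C f \<in> Ob C"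
    and Id_Hom: "X \<in> Ob C \<Longrightarrow> Id C X \<in> Hom C X X"
    and Comp_Hom: "\<lbrakk>f \<in> Hom C X Y; g \<in> Hom C Y Z\<rbrakk> \<Longrightarrow> g \<cdot> f \<in> Hom C X Z"
    and Comp_Id_right: "f \<in> Hom C X Y \<Longrightarrow> f \<cdot> Id C X = f"
    and Comp_Id_left: "f \<in> Hom C X Y \<Longrightarrow> Id C Y \<cdot> f = f"
    and Comp_assoc: "\<lbrakk>f \<in> Hom C W X; g \<in> Hom C X Y; h \<in> Hom C Y Z\<rbrakk>
      \<Longrightarrow> (h \<cdot> g) \<cdot> f = h \<cdot> (g \<cdot> f)"

definition is_iso :: "('o, 'a, 'z) category_scheme \<Rightarrow> 'a \<Rightarrow> bool" where
  "is_iso C f \<longleftrightarrow> f \<in> Arr C \<and>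
     (\<exists>g \<in> Hom C (Cod C f) (Dom C f).
        g \<cdot>\<^bsub>C\<^esub> f = Id C (Dom C f) \<and> f \<cdot>\<^bsub>C\<^esub> g = Id C (Cod C f))"

definition is_mono :: "('o, 'a, 'z) category_scheme \<Rightarrow> 'a \<Rightarrow> bool" where
  "is_mono C f \<longleftrightarrow> f \<in> Arr C \<and>
     (\<forall>X \<in> Ob C. \<forall>u \<in> Hom C X (Dom C f). \<forall>v \<in> Hom C X (Dom C f).
        f \<cdot>\<^bsub>C\<^esub> u = f \<cdot>\<^bsub>C\<^esub> v \<longrightarrow> u = v)"

definition is_epi :: "('o, 'a, 'z) category_scheme \<Rightarrow> 'a \<Rightarrow> bool" where
  "is_epi C f \<longleftrightarrow> f \<in> Arr C \<and>
     (\<forall>X \<in> Ob C. \<forall>u \<in> Hom C (Cod C f) X. \<forall>v \<in> Hom C (Cod C f) X.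
        u \<cdot>\<^bsub>C\<^esub> f = v \<cdot>\<^bsub>C\<^esub> f \<longrightarrow> u = v)"

record ('o, 'a, 'p, 'b) cfunctor =
  FOb :: "'o \<Rightarrow> 'p"
  FArr :: "'a \<Rightarrow> 'b"

text \<open>The values of a functor off \<^term>\<open>Ob C\<close> and \<^term>\<open>Arr C\<close> are unconstrained, as are the
  multiplicative fields that a module inherits from the record of rings.  Objects that differ only
  in such values are distinct in HOL, but isomorphic in the categories below.  Arrows, in contrast,
  are normalised with \<^const>\<open>undefined\<close>, so that Hom-sets contain no duplicates.\<close>

definition is_functor ::
  "('o, 'a, 'z) category_scheme \<Rightarrow> ('p, 'b, 'y) category_scheme \<Rightarrow> ('o, 'a, 'p, 'b) cfunctor \<Rightarrow> bool"
where
  "is_functor C D F \<longleftrightarrow>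
     (\<forall>X \<in> Ob C. FOb F X \<in> Ob D) \<and>
     (\<forall>X Y. \<forall>f \<in> Hom C X Y. FArr F f \<in> Hom D (FOb F X) (FOb F Y)) \<and>
     (\<forall>X \<in> Ob C. FArr F (Id C X) = Id D (FOb F X)) \<and>
     (\<forall>X Y Z. \<forall>f \<in> Hom C X Y. \<forall>g \<in> Hom C Y Z.
        FArr F (g \<cdot>\<^bsub>C\<^esub> f) = FArr F g \<cdot>\<^bsub>D\<^esub> FArr F f)"

definition id_functor :: "('o, 'a, 'o, 'a) cfunctor" where
  "id_functor = \<lparr>FOb = (\<lambda>X. X), FArr = (\<lambda>f. f)\<rparr>"

definition comp_functor ::
  "('p, 'b, 'q, 'c) cfunctor \<Rightarrow> ('o, 'a, 'p, 'b) cfunctor \<Rightarrow> ('o, 'a, 'q, 'c) cfunctor" where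
  "comp_functor G F = \<lparr>FOb = FOb G \<circ> FOb F, FArr = FArr G \<circ> FArr F\<rparr>"

definition nat_transf ::
  "('o, 'a, 'z) category_scheme \<Rightarrow> ('p, 'b, 'y) category_scheme
     \<Rightarrow> ('o, 'a, 'p, 'b) cfunctor \<Rightarrow> ('o, 'a, 'p, 'b) cfunctor \<Rightarrow> ('o \<Rightarrow> 'b) \<Rightarrow> bool" where
  "nat_transf C D F G \<eta> \<longleftrightarrow>
     \<eta> \<in> extensional (Ob C) \<and>
     (\<forall>X \<in> Ob C. \<eta> X \<in> Hom D (FOb F X) (FOb G X)) \<and>
     (\<forall>X Y. \<forall>f \<in> Hom C X Y. \<eta> Y \<cdot>\<^bsub>D\<^esub> FArr F f = FArr G f \<cdot>\<^bsub>D\<^esub> \<eta> X)"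

definition nat_isomorphic ::
  "('o, 'a, 'z) category_scheme \<Rightarrow> ('p, 'b, 'y) category_scheme
     \<Rightarrow> ('o, 'a, 'p, 'b) cfunctor \<Rightarrow> ('o, 'a, 'p, 'b) cfunctor \<Rightarrow> bool" where
  "nat_isomorphic C D F G \<longleftrightarrow>
     (\<exists>\<eta>. nat_transf C D F G \<eta> \<and> (\<forall>X \<in> Ob C. is_iso D (\<eta> X)))"

definition equivalence_of_categories ::
  "('o, 'a, 'z) category_scheme \<Rightarrow> ('p, 'b, 'y) category_scheme \<Rightarrow> ('o, 'a, 'p, 'b) cfunctor \<Rightarrow> bool"
where
  "equivalence_of_categories C D F \<longleftrightarrow>
     category C \<and> category D \<and> is_functor C D F \<and>
     (\<exists>G. is_functor D C G \<and>
        nat_isomorphic C C id_functor (comp_functor G F) \<and>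
        nat_isomorphic D D (comp_functor F G) id_functor)"

definition functor_category ::
  "('o, 'a, 'z) category_scheme \<Rightarrow> ('p, 'b, 'y) category_scheme
     \<Rightarrow> (('o, 'a, 'p, 'b) cfunctor,
         ('o, 'a, 'p, 'b) cfunctor \<times> ('o \<Rightarrow> 'b) \<times> ('o, 'a, 'p, 'b) cfunctor) category" where
  "functor_category C D = \<lparr>
     Ob = {F. is_functor C D F},
     Arr = {(F, \<eta>, G). is_functor C D F \<and> is_functor C D G \<and> nat_transf C D F G \<eta>},
     Dom = (\<lambda>(F, \<eta>, G). F),
     Cod = (\<lambda>(F, \<eta>, G). G),
     Id = (\<lambda>F. (F, (\<lambda>X\<in>Ob C. Id D (FOb F X)), F)),
     Comp = (\<lambda>(G', \<theta>, H) (F, \<eta>, G). (F, (\<lambda>X\<in>Ob C. \<theta> X \<cdot>\<^bsub>D\<^esub> \<eta> X), H))\<rparr>"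

definition full_subcategory :: "('o, 'a) category \<Rightarrow> 'o set \<Rightarrow> ('o, 'a) category" where
  "full_subcategory C S =
     C\<lparr>Ob := Ob C \<inter> S, Arr := {f \<in> Arr C. Dom C f \<in> S \<and> Cod C f \<in> S}\<rparr>"


section \<open>Linear and abelian categories\<close>

record ('o, 'a, 'k) lcategory = "('o, 'a) category" +
  HomMod :: "'o \<Rightarrow> 'o \<Rightarrow> ('k, 'a) module"

locale linear_category = cring k + category C
  for k :: "('k, 'l) ring_scheme" and C :: "('o, 'a, 'k) lcategory" +
  assumes HomMod_carrier: "\<lbrakk>X \<in> Ob C; Y \<in> Ob C\<rbrakk> \<Longrightarrow> carrier (HomMod C X Y) = Hom C X Y"
    and HomMod_module: "\<lbrakk>X \<in> Ob C; Y \<in> Ob C\<rbrakk> \<Longrightarrow> module k (HomMod C X Y)"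
    and Comp_add_right: "\<lbrakk>f \<in> Hom C X Y; f' \<in> Hom C X Y; g \<in> Hom C Y Z\<rbrakk>
      \<Longrightarrow> g \<cdot>\<^bsub>C\<^esub> (f \<oplus>\<^bsub>HomMod C X Y\<^esub> f') = g \<cdot>\<^bsub>C\<^esub> f \<oplus>\<^bsub>HomMod C X Z\<^esub> g \<cdot>\<^bsub>C\<^esub> f'"
    and Comp_add_left: "\<lbrakk>f \<in> Hom C X Y; g \<in> Hom C Y Z; g' \<in> Hom C Y Z\<rbrakk>
      \<Longrightarrow> (g \<oplus>\<^bsub>HomMod C Y Z\<^esub> g') \<cdot>\<^bsub>C\<^esub> f = g \<cdot>\<^bsub>C\<^esub> f \<oplus>\<^bsub>HomMod C X Z\<^esub> g' \<cdot>\<^bsub>C\<^esub> f"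
    and Comp_smult_right: "\<lbrakk>a \<in> carrier k; f \<in> Hom C X Y; g \<in> Hom C Y Z\<rbrakk>
      \<Longrightarrow> g \<cdot>\<^bsub>C\<^esub> (a \<odot>\<^bsub>HomMod C X Y\<^esub> f) = a \<odot>\<^bsub>HomMod C X Z\<^esub> (g \<cdot>\<^bsub>C\<^esub> f)"
    and Comp_smult_left: "\<lbrakk>a \<in> carrier k; f \<in> Hom C X Y; g \<in> Hom C Y Z\<rbrakk>
      \<Longrightarrow> (a \<odot>\<^bsub>HomMod C Y Z\<^esub> g) \<cdot>\<^bsub>C\<^esub> f = a \<odot>\<^bsub>HomMod C X Z\<^esub> (g \<cdot>\<^bsub>C\<^esub> f)"

definition linear_functor ::
  "('k, 'l) ring_scheme \<Rightarrow> ('o, 'a, 'k) lcategory \<Rightarrow> ('p, 'b, 'k) lcategory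
     \<Rightarrow> ('o, 'a, 'p, 'b) cfunctor \<Rightarrow> bool" where
  "linear_functor k C D F \<longleftrightarrow>
     (\<forall>X Y. \<forall>f \<in> Hom C X Y. \<forall>g \<in> Hom C X Y.
        FArr F (f \<oplus>\<^bsub>HomMod C X Y\<^esub> g) = FArr F f \<oplus>\<^bsub>HomMod D (FOb F X) (FOb F Y)\<^esub> FArr F g) \<and>
     (\<forall>X Y. \<forall>a \<in> carrier k. \<forall>f \<in> Hom C X Y.
        FArr F (a \<odot>\<^bsub>HomMod C X Y\<^esub> f) = a \<odot>\<^bsub>HomMod D (FOb F X) (FOb F Y)\<^esub> FArr F f)"

definition zero_arr :: "('o, 'a, 'k) lcategory \<Rightarrow> 'o \<Rightarrow> 'o \<Rightarrow> 'a" where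
  "zero_arr C X Y = \<zero>\<^bsub>HomMod C X Y\<^esub>"

definition is_zero_object :: "('o, 'a, 'z) category_scheme \<Rightarrow> 'o \<Rightarrow> bool" where
  "is_zero_object C Z \<longleftrightarrow> Z \<in> Ob C \<and>
     (\<forall>X \<in> Ob C. (\<exists>!f. f \<in> Hom C Z X) \<and> (\<exists>!f. f \<in> Hom C X Z))"

definition is_biproduct ::
  "('o, 'a, 'k) lcategory \<Rightarrow> 'o \<Rightarrow> 'o \<Rightarrow> 'o \<Rightarrow> 'a \<Rightarrow> 'a \<Rightarrow> 'a \<Rightarrow> 'a \<Rightarrow> bool" where
  "is_biproduct C X Y P i j p q \<longleftrightarrow>
     i \<in> Hom C X P \<and> j \<in> Hom C Y P \<and> p \<in> Hom C P X \<and> q \<in> Hom C P Y \<and>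
     p \<cdot>\<^bsub>C\<^esub> i = Id C X \<and> q \<cdot>\<^bsub>C\<^esub> j = Id C Y \<and>
     q \<cdot>\<^bsub>C\<^esub> i = zero_arr C X Y \<and> p \<cdot>\<^bsub>C\<^esub> j = zero_arr C Y X \<and>
     (i \<cdot>\<^bsub>C\<^esub> p) \<oplus>\<^bsub>HomMod C P P\<^esub> (j \<cdot>\<^bsub>C\<^esub> q) = Id C P"

definition is_kernel :: "('o, 'a, 'k) lcategory \<Rightarrow> 'a \<Rightarrow> 'a \<Rightarrow> bool" where
  "is_kernel C f i \<longleftrightarrow> f \<in> Arr C \<and> i \<in> Arr C \<and> Cod C i = Dom C f \<and>
     f \<cdot>\<^bsub>C\<^esub> i = zero_arr C (Dom C i) (Cod C f) \<and>
     (\<forall>h \<in> Arr C. Cod C h = Dom C f \<and> f \<cdot>\<^bsub>C\<^esub> h = zero_arr C (Dom C h) (Cod C f)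
        \<longrightarrow> (\<exists>!u. u \<in> Hom C (Dom C h) (Dom C i) \<and> i \<cdot>\<^bsub>C\<^esub> u = h))"

definition is_cokernel :: "('o, 'a, 'k) lcategory \<Rightarrow> 'a \<Rightarrow> 'a \<Rightarrow> bool" where
  "is_cokernel C f c \<longleftrightarrow> f \<in> Arr C \<and> c \<in> Arr C \<and> Dom C c = Cod C f \<and>
     c \<cdot>\<^bsub>C\<^esub> f = zero_arr C (Dom C f) (Cod C c) \<and>
     (\<forall>h \<in> Arr C. Dom C h = Cod C f \<and> h \<cdot>\<^bsub>C\<^esub> f = zero_arr C (Dom C f) (Cod C h)
        \<longrightarrow> (\<exists>!u. u \<in> Hom C (Cod C c) (Cod C h) \<and> u \<cdot>\<^bsub>C\<^esub> c = h))"

locale abelian_category = linear_category +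
  assumes ex_zero_object: "\<exists>Z. is_zero_object C Z"
    and ex_biproduct: "\<lbrakk>X \<in> Ob C; Y \<in> Ob C\<rbrakk> \<Longrightarrow> \<exists>P i j p q. is_biproduct C X Y P i j p q"
    and ex_kernel: "f \<in> Arr C \<Longrightarrow> \<exists>i. is_kernel C f i"
    and ex_cokernel: "f \<in> Arr C \<Longrightarrow> \<exists>c. is_cokernel C f c"
    and mono_is_kernel: "is_mono C f \<Longrightarrow> \<exists>g. is_kernel C g f"
    and epi_is_cokernel: "is_epi C f \<Longrightarrow> \<exists>g. is_cokernel C g f"

text \<open>Exactness at the middle object: the image of \<^term>\<open>f\<close>, that is, the kernel of its cokernel,
  is the kernel of \<^term>\<open>g\<close>.\<close>

definition exact :: "('o, 'a, 'k) lcategory \<Rightarrow> 'a \<Rightarrow> 'a \<Rightarrow> bool" where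
  "exact C f g \<longleftrightarrow> f \<in> Arr C \<and> g \<in> Arr C \<and> Cod C f = Dom C g \<and>
     (\<exists>c i. is_cokernel C f c \<and> is_kernel C c i \<and> is_kernel C g i)"

text \<open>The exact sequences \<open>X \<rightarrow> Y \<rightarrow> Z \<rightarrow> 0\<close>, with maps \<^term>\<open>f\<close> and \<^term>\<open>g\<close>.\<close>

definition right_exact_seq :: "('o, 'a, 'k) lcategory \<Rightarrow> 'a \<Rightarrow> 'a \<Rightarrow> bool" where
  "right_exact_seq C f g \<longleftrightarrow>
     exact C f g \<and> (\<exists>O'. is_zero_object C O' \<and> exact C g (zero_arr C (Cod C g) O'))"

definition right_exact_functor ::
  "('o, 'a, 'k) lcategory \<Rightarrow> ('p, 'b, 'k) lcategory \<Rightarrow> ('o, 'a, 'p, 'b) cfunctor \<Rightarrow> bool" where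
  "right_exact_functor C D F \<longleftrightarrow>
     (\<forall>f g. right_exact_seq C f g \<longrightarrow> right_exact_seq D (FArr F f) (FArr F g))"


section \<open>Small colimits\<close>

text \<open>The type \<^typ>\<open>'u\<close> plays the role of the universe: a set of elements of \<^typ>\<open>'u\<close> is small
  if it has fewer elements than \<^typ>\<open>'u\<close>.  The cardinality of \<^typ>\<open>'u\<close> is assumed to be infinite
  and regular wherever this is used; if it is strongly inaccessible, one obtains a Grothendieck
  universe.\<close>

definition small :: "'u set \<Rightarrow> bool" where
  "small S \<longleftrightarrow> |S| <o |UNIV :: 'u set|"

definition is_coproduct ::
  "('o, 'a, 'z) category_scheme \<Rightarrow> 'i set \<Rightarrow> ('i \<Rightarrow> 'o) \<Rightarrow> 'o \<Rightarrow> ('i \<Rightarrow> 'a) \<Rightarrow> bool" where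
  "is_coproduct C I X S \<iota> \<longleftrightarrow> S \<in> Ob C \<and> (\<forall>i\<in>I. \<iota> i \<in> Hom C (X i) S) \<and>
     (\<forall>Y \<in> Ob C. \<forall>f. (\<forall>i\<in>I. f i \<in> Hom C (X i) Y)
        \<longrightarrow> (\<exists>!h. h \<in> Hom C S Y \<and> (\<forall>i\<in>I. h \<cdot>\<^bsub>C\<^esub> \<iota> i = f i)))"

definition cocomplete :: "'u itself \<Rightarrow> ('o, 'a, 'z) category_scheme \<Rightarrow> bool" where
  "cocomplete _ C \<longleftrightarrow>
     (\<forall>(I :: 'u set) X. small I \<and> (\<forall>i\<in>I. X i \<in> Ob C) \<longrightarrow> (\<exists>S \<iota>. is_coproduct C I X S \<iota>))"

definition directed_set :: "'i set \<Rightarrow> 'i rel \<Rightarrow> bool" where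
  "directed_set I ord \<longleftrightarrow> I \<noteq> {} \<and> preorder_on I ord \<and>
     (\<forall>i\<in>I. \<forall>j\<in>I. \<exists>l\<in>I. (i, l) \<in> ord \<and> (j, l) \<in> ord)"

definition direct_system ::
  "('o, 'a, 'z) category_scheme \<Rightarrow> 'i set \<Rightarrow> 'i rel \<Rightarrow> ('i \<Rightarrow> 'o) \<Rightarrow> ('i \<Rightarrow> 'i \<Rightarrow> 'a) \<Rightarrow> bool" where
  "direct_system C I ord X \<phi> \<longleftrightarrow> directed_set I ord \<and>
     (\<forall>i\<in>I. X i \<in> Ob C \<and> \<phi> i i = Id C (X i)) \<and>
     (\<forall>i j. (i, j) \<in> ord \<longrightarrow> \<phi> i j \<in> Hom C (X i) (X j)) \<and>
     (\<forall>i j l. (i, j) \<in> ord \<and> (j, l) \<in> ord \<longrightarrow> \<phi> j l \<cdot>\<^bsub>C\<^esub> \<phi> i j = \<phi> i l)"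

definition is_cocone ::
  "('o, 'a, 'z) category_scheme \<Rightarrow> 'i set \<Rightarrow> 'i rel \<Rightarrow> ('i \<Rightarrow> 'o) \<Rightarrow> ('i \<Rightarrow> 'i \<Rightarrow> 'a)
     \<Rightarrow> 'o \<Rightarrow> ('i \<Rightarrow> 'a) \<Rightarrow> bool" where
  "is_cocone C I ord X \<phi> L \<mu> \<longleftrightarrow> L \<in> Ob C \<and> (\<forall>i\<in>I. \<mu> i \<in> Hom C (X i) L) \<and>
     (\<forall>i j. (i, j) \<in> ord \<longrightarrow> \<mu> j \<cdot>\<^bsub>C\<^esub> \<phi> i j = \<mu> i)"

definition is_direct_limit ::
  "('o, 'a, 'z) category_scheme \<Rightarrow> 'i set \<Rightarrow> 'i rel \<Rightarrow> ('i \<Rightarrow> 'o) \<Rightarrow> ('i \<Rightarrow> 'i \<Rightarrow> 'a)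
     \<Rightarrow> 'o \<Rightarrow> ('i \<Rightarrow> 'a) \<Rightarrow> bool" where
  "is_direct_limit C I ord X \<phi> L \<mu> \<longleftrightarrow> is_cocone C I ord X \<phi> L \<mu> \<and>
     (\<forall>Y \<nu>. is_cocone C I ord X \<phi> Y \<nu>
        \<longrightarrow> (\<exists>!h. h \<in> Hom C L Y \<and> (\<forall>i\<in>I. h \<cdot>\<^bsub>C\<^esub> \<mu> i = \<nu> i)))"

definition commutes_with_direct_limits ::
  "'u itself \<Rightarrow> ('o, 'a, 'z) category_scheme \<Rightarrow> ('p, 'b, 'y) category_scheme
     \<Rightarrow> ('o, 'a, 'p, 'b) cfunctor \<Rightarrow> bool" where
  "commutes_with_direct_limits _ C D F \<longleftrightarrow>
     (\<forall>(I :: 'u set) ord X \<phi> L \<mu>.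
        small I \<and> direct_system C I ord X \<phi> \<and> is_direct_limit C I ord X \<phi> L \<mu> \<longrightarrow>
        is_direct_limit D I ord (FOb F \<circ> X) (\<lambda>i j. FArr F (\<phi> i j)) (FOb F L) (FArr F \<circ> \<mu>))"


section \<open>Algebras and right modules\<close>

text \<open>The algebras of \<^theory>\<open>HOL-Algebra.Module\<close> are commutative and its modules are modules over
  commutative rings, so both notions are introduced here for noncommutative rings.\<close>

locale assoc_algebra = k: cring k + R: ring R
  for k :: "('k, 'l) ring_scheme" and R :: "('r, 's) ring_scheme" and \<gamma> :: "'k \<Rightarrow> 'r" +
  assumes structure_map: "\<gamma> \<in> ring_hom k R"
    and structure_map_central:
      "\<lbrakk>a \<in> carrier k; r \<in> carrier R\<rbrakk> \<Longrightarrow> \<gamma> a \<otimes>\<^bsub>R\<^esub> r = r \<otimes>\<^bsub>R\<^esub> \<gamma> a"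

record ('m, 'r) rmodule = "'m ring" +
  ract :: "'m \<Rightarrow> 'r \<Rightarrow> 'm"  (infixl "\<triangleleft>\<index>" 70)

locale right_module = R: ring R + M: abelian_group M
  for R :: "('r, 's) ring_scheme" and M :: "('m, 'r) rmodule" +
  assumes ract_closed: "\<lbrakk>x \<in> carrier M; r \<in> carrier R\<rbrakk> \<Longrightarrow> x \<triangleleft>\<^bsub>M\<^esub> r \<in> carrier M"
    and ract_add_left: "\<lbrakk>x \<in> carrier M; y \<in> carrier M; r \<in> carrier R\<rbrakk>
      \<Longrightarrow> (x \<oplus>\<^bsub>M\<^esub> y) \<triangleleft>\<^bsub>M\<^esub> r = x \<triangleleft>\<^bsub>M\<^esub> r \<oplus>\<^bsub>M\<^esub> y \<triangleleft>\<^bsub>M\<^esub> r"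
    and ract_add_right: "\<lbrakk>x \<in> carrier M; r \<in> carrier R; s \<in> carrier R\<rbrakk>
      \<Longrightarrow> x \<triangleleft>\<^bsub>M\<^esub> (r \<oplus>\<^bsub>R\<^esub> s) = x \<triangleleft>\<^bsub>M\<^esub> r \<oplus>\<^bsub>M\<^esub> x \<triangleleft>\<^bsub>M\<^esub> s"
    and ract_mult: "\<lbrakk>x \<in> carrier M; r \<in> carrier R; s \<in> carrier R\<rbrakk>
      \<Longrightarrow> x \<triangleleft>\<^bsub>M\<^esub> (r \<otimes>\<^bsub>R\<^esub> s) = (x \<triangleleft>\<^bsub>M\<^esub> r) \<triangleleft>\<^bsub>M\<^esub> s"
    and ract_one: "x \<in> carrier M \<Longrightarrow> x \<triangleleft>\<^bsub>M\<^esub> \<one>\<^bsub>R\<^esub> = x"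

definition lin_maps ::
  "('r, 's) ring_scheme \<Rightarrow> ('m, 'r) rmodule \<Rightarrow> ('n, 'r) rmodule \<Rightarrow> ('m \<Rightarrow> 'n) set" where
  "lin_maps R M N = {f \<in> carrier M \<rightarrow>\<^sub>E carrier N.
     (\<forall>x\<in>carrier M. \<forall>y\<in>carrier M. f (x \<oplus>\<^bsub>M\<^esub> y) = f x \<oplus>\<^bsub>N\<^esub> f y) \<and>
     (\<forall>x\<in>carrier M. \<forall>r\<in>carrier R. f (x \<triangleleft>\<^bsub>M\<^esub> r) = f x \<triangleleft>\<^bsub>N\<^esub> r)}"

type_synonym ('u, 'r) rmod_arr = "('u, 'r) rmodule \<times> ('u \<Rightarrow> 'u) \<times> ('u, 'r) rmodule"

text \<open>The category of small right \<^term>\<open>R\<close>-modules, with carriers in the universe \<^typ>\<open>'u\<close>.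
  Linear maps add pointwise, and \<open>a \<in> k\<close> acts on them through the structure map, by
  \<open>(a \<cdot> f)(x) = f(x) \<gamma>(a)\<close>.  The fields \<^const>\<open>mult\<close> and \<^const>\<open>one\<close> of the Hom-modules carry
  no information.\<close>

definition Mod_cat ::
  "('r, 's) ring_scheme \<Rightarrow> ('k \<Rightarrow> 'r) \<Rightarrow> (('u, 'r) rmodule, ('u, 'r) rmod_arr, 'k) lcategory" where
  "Mod_cat R \<gamma> = \<lparr>
     Ob = {M. right_module R M \<and> small (carrier M)},
     Arr = {(M, f, N). right_module R M \<and> small (carrier M) \<and>
                       right_module R N \<and> small (carrier N) \<and> f \<in> lin_maps R M N},
     Dom = (\<lambda>(M, f, N). M),
     Cod = (\<lambda>(M, f, N). N),
     Id = (\<lambda>M. (M, (\<lambda>x\<in>carrier M. x), M)),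
     Comp = (\<lambda>(N', g, P) (M, f, N). (M, compose (carrier M) g f, P)),
     HomMod = (\<lambda>M N. \<lparr>
       carrier = {M} \<times> lin_maps R M N \<times> {N},
       mult = undefined,
       one = undefined,
       zero = (M, (\<lambda>x\<in>carrier M. \<zero>\<^bsub>N\<^esub>), N),
       add = (\<lambda>(M', f, N') (M'', g, N''). (M, (\<lambda>x\<in>carrier M. f x \<oplus>\<^bsub>N\<^esub> g x), N)),
       smult = (\<lambda>a (M', f, N'). (M, (\<lambda>x\<in>carrier M. f x \<triangleleft>\<^bsub>N\<^esub> \<gamma> a), N))\<rparr>)\<rparr>"

definition B_cat ::
  "('k, 'l) ring_scheme \<Rightarrow> ('r, 's) ring_scheme \<Rightarrow> ('k \<Rightarrow> 'r) \<Rightarrow> ('o, 'a, 'k) lcategory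
     \<Rightarrow> ((('u, 'r) rmodule, ('u, 'r) rmod_arr, 'o, 'a) cfunctor,
         (('u, 'r) rmodule, ('u, 'r) rmod_arr, 'o, 'a) cfunctor \<times>
         (('u, 'r) rmodule \<Rightarrow> 'a) \<times>
         (('u, 'r) rmodule, ('u, 'r) rmod_arr, 'o, 'a) cfunctor) category" where
  "B_cat k R \<gamma> A = full_subcategory (functor_category (Mod_cat R \<gamma>) A)
     {F. linear_functor k (Mod_cat R \<gamma>) A F \<and>
         right_exact_functor (Mod_cat R \<gamma>) A F \<and>
         commutes_with_direct_limits TYPE('u) (Mod_cat R \<gamma>) A F}"


section \<open>Left modules in a linear category and their tensor functors\<close>

definition End_ring :: "('o, 'a, 'k) lcategory \<Rightarrow> 'o \<Rightarrow> 'a ring" where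
  "End_ring A X = \<lparr>carrier = Hom A X X, mult = Comp A, one = Id A X,
     zero = zero_arr A X X, add = add (HomMod A X X)\<rparr>"

type_synonym ('o, 'a, 'r) lmod = "'o \<times> ('r \<Rightarrow> 'a)"

definition lmods_in ::
  "('k, 'l) ring_scheme \<Rightarrow> ('r, 's) ring_scheme \<Rightarrow> ('k \<Rightarrow> 'r) \<Rightarrow> ('o, 'a, 'k) lcategory
     \<Rightarrow> ('o, 'a, 'r) lmod set" where
  "lmods_in k R \<gamma> A = {(X, \<rho>). X \<in> Ob A \<and>
     \<rho> \<in> extensional (carrier R) \<inter> ring_hom R (End_ring A X) \<and>
     (\<forall>a\<in>carrier k. \<rho> (\<gamma> a) = a \<odot>\<^bsub>HomMod A X X\<^esub> Id A X)}"

definition lmod_cat ::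
  "('k, 'l) ring_scheme \<Rightarrow> ('r, 's) ring_scheme \<Rightarrow> ('k \<Rightarrow> 'r) \<Rightarrow> ('o, 'a, 'k) lcategory
     \<Rightarrow> (('o, 'a, 'r) lmod, ('o, 'a, 'r) lmod \<times> 'a \<times> ('o, 'a, 'r) lmod) category" where
  "lmod_cat k R \<gamma> A = \<lparr>
     Ob = lmods_in k R \<gamma> A,
     Arr = {(F, \<alpha>, G). F \<in> lmods_in k R \<gamma> A \<and> G \<in> lmods_in k R \<gamma> A \<and>
       \<alpha> \<in> Hom A (fst F) (fst G) \<and> (\<forall>r\<in>carrier R. snd G r \<cdot>\<^bsub>A\<^esub> \<alpha> = \<alpha> \<cdot>\<^bsub>A\<^esub> snd F r)},
     Dom = (\<lambda>(F, \<alpha>, G). F),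
     Cod = (\<lambda>(F, \<alpha>, G). G),
     Id = (\<lambda>F. (F, Id A (fst F), F)),
     Comp = (\<lambda>(G', \<beta>, H) (F, \<alpha>, G). (F, \<beta> \<cdot>\<^bsub>A\<^esub> \<alpha>, H))\<rparr>"

definition Hom_rmodule ::
  "('o, 'a, 'k) lcategory \<Rightarrow> ('o, 'a, 'r) lmod \<Rightarrow> 'o \<Rightarrow> ('a, 'r) rmodule" where
  "Hom_rmodule A F N = \<lparr>carrier = Hom A (fst F) N, mult = undefined, one = undefined,
     zero = zero_arr A (fst F) N, add = add (HomMod A (fst F) N),
     ract = (\<lambda>\<alpha> r. \<alpha> \<cdot>\<^bsub>A\<^esub> snd F r)\<rparr>"

text \<open>\<^term>\<open>L\<close> is left adjoint to \<open>Hom(F, -)\<close>: the maps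
  \<open>\<theta> M N : Hom\<^sub>A(L M, N) \<rightarrow> Hom\<^sub>R(M, Hom\<^sub>A(F, N))\<close> are bijections, natural in \<open>M\<close> and \<open>N\<close>.  The
  modules \<open>Hom\<^sub>A(F, N)\<close> live on the type of arrows of \<^term>\<open>A\<close> and need not be small, hence the
  adjunction is stated with \<^const>\<open>lin_maps\<close> rather than with the Hom-sets of
  \<^const>\<open>Mod_cat\<close>.\<close>

definition is_tensor_adjunction ::
  "('r, 's) ring_scheme \<Rightarrow> ('k \<Rightarrow> 'r) \<Rightarrow> ('o, 'a, 'k) lcategory \<Rightarrow> ('o, 'a, 'r) lmod
     \<Rightarrow> (('u, 'r) rmodule, ('u, 'r) rmod_arr, 'o, 'a) cfunctor
     \<Rightarrow> (('u, 'r) rmodule \<Rightarrow> 'o \<Rightarrow> 'a \<Rightarrow> 'u \<Rightarrow> 'a) \<Rightarrow> bool" where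
  "is_tensor_adjunction R \<gamma> A F L \<theta> \<longleftrightarrow>
     is_functor (Mod_cat R \<gamma>) A L \<and>
     (\<forall>M \<in> Ob (Mod_cat R \<gamma>). \<forall>N \<in> Ob A.
        bij_betw (\<theta> M N) (Hom A (FOb L M) N) (lin_maps R M (Hom_rmodule A F N))) \<and>
     (\<forall>M M' f. (M', f, M) \<in> Arr (Mod_cat R \<gamma>) \<longrightarrow>
        (\<forall>N N'. \<forall>g \<in> Hom A N N'. \<forall>h \<in> Hom A (FOb L M) N.
           \<theta> M' N' (g \<cdot>\<^bsub>A\<^esub> h \<cdot>\<^bsub>A\<^esub> FArr L (M', f, M)) =
             (\<lambda>x\<in>carrier M'. g \<cdot>\<^bsub>A\<^esub> \<theta> M N h (f x))))"

definition tensor_adjunction ::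
  "('r, 's) ring_scheme \<Rightarrow> ('k \<Rightarrow> 'r) \<Rightarrow> ('o, 'a, 'k) lcategory \<Rightarrow> ('o, 'a, 'r) lmod
     \<Rightarrow> (('u, 'r) rmodule, ('u, 'r) rmod_arr, 'o, 'a) cfunctor \<times>
        (('u, 'r) rmodule \<Rightarrow> 'o \<Rightarrow> 'a \<Rightarrow> 'u \<Rightarrow> 'a)" where
  "tensor_adjunction R \<gamma> A F = (SOME (L, \<theta>). is_tensor_adjunction R \<gamma> A F L \<theta>)"

definition tensor_functor ::
  "('r, 's) ring_scheme \<Rightarrow> ('k \<Rightarrow> 'r) \<Rightarrow> ('o, 'a, 'k) lcategory \<Rightarrow> ('o, 'a, 'r) lmod
     \<Rightarrow> (('u, 'r) rmodule, ('u, 'r) rmod_arr, 'o, 'a) cfunctor" where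
  "tensor_functor R \<gamma> A F = fst (tensor_adjunction R \<gamma> A F)"

definition tensor_transpose ::
  "('r, 's) ring_scheme \<Rightarrow> ('k \<Rightarrow> 'r) \<Rightarrow> ('o, 'a, 'k) lcategory \<Rightarrow> ('o, 'a, 'r) lmod
     \<Rightarrow> ('u, 'r) rmodule \<Rightarrow> 'o \<Rightarrow> 'a \<Rightarrow> 'u \<Rightarrow> 'a" where
  "tensor_transpose R \<gamma> A F = snd (tensor_adjunction R \<gamma> A F)"

text \<open>The arrow \<open>M \<otimes> \<phi> : M \<otimes> F \<rightarrow> M \<otimes> G\<close> is determined by the Yoneda lemma: under the
  adjunctions, precomposition with it corresponds to \<open>\<psi> \<mapsto> (x \<mapsto> \<psi>(x) \<circ> \<phi>)\<close>.\<close>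

definition tensor_arr ::
  "('r, 's) ring_scheme \<Rightarrow> ('k \<Rightarrow> 'r) \<Rightarrow> ('o, 'a, 'k) lcategory
     \<Rightarrow> ('o, 'a, 'r) lmod \<Rightarrow> 'a \<Rightarrow> ('o, 'a, 'r) lmod \<Rightarrow> ('u, 'r) rmodule \<Rightarrow> 'a" where
  "tensor_arr R \<gamma> A F \<phi> G M =
     (THE u. u \<in> Hom A (FOb (tensor_functor R \<gamma> A F) M) (FOb (tensor_functor R \<gamma> A G) M) \<and>
        (\<forall>N \<in> Ob A. \<forall>h \<in> Hom A (FOb (tensor_functor R \<gamma> A G) M) N.
           tensor_transpose R \<gamma> A F M N (h \<cdot>\<^bsub>A\<^esub> u) =
             (\<lambda>x\<in>carrier M. tensor_transpose R \<gamma> A G M N h x \<cdot>\<^bsub>A\<^esub> \<phi>)))"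

definition Psi ::
  "('r, 's) ring_scheme \<Rightarrow> ('k \<Rightarrow> 'r) \<Rightarrow> ('o, 'a, 'k) lcategory
     \<Rightarrow> (('o, 'a, 'r) lmod, ('o, 'a, 'r) lmod \<times> 'a \<times> ('o, 'a, 'r) lmod,
         (('u, 'r) rmodule, ('u, 'r) rmod_arr, 'o, 'a) cfunctor,
         (('u, 'r) rmodule, ('u, 'r) rmod_arr, 'o, 'a) cfunctor \<times>
         (('u, 'r) rmodule \<Rightarrow> 'a) \<times>
         (('u, 'r) rmodule, ('u, 'r) rmod_arr, 'o, 'a) cfunctor) cfunctor" where
  "Psi R \<gamma> A = \<lparr>
     FOb = tensor_functor R \<gamma> A,
     FArr = (\<lambda>(F, \<phi>, G). (tensor_functor R \<gamma> A F,
       (\<lambda>M\<in>Ob (Mod_cat R \<gamma>). tensor_arr R \<gamma> A F \<phi> G M), tensor_functor R \<gamma> A G))\<rparr>"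

end

theory Submission
  imports Defs
begin
text \<open>
  The idea is to replace adjunctions by universal elements.  Call a functor \<open>L\<close> from right modules
  to \<open>A\<close>, together with arrows \<open>e M x : F \<rightarrow> L M\<close> that are natural in \<open>M\<close> and \<open>R\<close>-linear in the
  element \<open>x\<close> of \<open>M\<close>, universal for the left module \<open>F\<close> if every linear map
  \<open>g : M \<rightarrow> Hom(F, N)\<close> has the form \<open>g x = h \<circ> e M x\<close> for a unique arrow \<open>h : L M \<rightarrow> N\<close>
  (\<open>tensor_universal\<close>).  This is the same as a left adjoint of \<open>Hom(F, -)\<close>, with \<open>e M x = x \<otimes> -\<close>.
  Three facts about universal functors give the equivalence.

  First, they exist, being quotients of coproducts of copies of \<open>F\<close> (\<open>ex_tensor_universal\<close>), and
  they are \<open>k\<close>-linear, right exact and commute with direct limits, since the functor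
  \<open>M \<mapsto> Hom(L M, N) = Hom(M, Hom(F, N))\<close> turns cokernels and direct limits of modules into kernels
  and inverse limits (\<open>tensor_universal_right_exact\<close>, \<open>tensor_universal_direct_limits\<close>).  The module
  \<open>Hom(F, N)\<close> may lie outside the universe of small modules, in which cokernels and direct limits
  are defined; so these are described by elements, and maps from a direct limit into a large module
  factor through a small submodule, namely the union of the images of the members of the system.
  This is where regularity of the universe enters (\<open>Mod_right_exact_seqD\<close>, \<open>ex_factor\<close>).

  Second, every \<open>k\<close>-linear right exact functor \<open>T\<close> that commutes with direct limits is universal.
  Let \<open>B\<close> be the free module on one generator \<open>b\<close>.  The endomorphisms of \<open>B\<close> make \<open>T B\<close> a left
  \<open>R\<close>-module, and the map \<open>B \<rightarrow> M\<close> with \<open>b \<mapsto> x\<close> induces the arrow \<open>e M x : T B \<rightarrow> T M\<close>.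
  Universality is proved for all submodules of \<open>M\<close>, starting from \<open>0\<close>, by adjoining one generator at
  a time and passing to unions of chains (\<open>submodule_induct\<close>, by Zorn's lemma): the submodule
  generated by \<open>U\<close> and \<open>x\<close> is a quotient of \<open>U \<times> B\<close>, where \<open>T\<close> preserves the product by additivity
  and the quotient by right exactness, and a union of a chain is a direct limit.  The uniqueness of
  \<open>h\<close> is established for all modules (\<open>jointly_epi_all\<close>) before its existence (\<open>extends_all\<close>),
  because the factorisation through a quotient is checked on the kernel.

  Third, the arrow \<open>e B b : F \<rightarrow> L B\<close> is invertible (\<open>generator_iso\<close>).  Every element \<open>x\<close> of \<open>M\<close> is
  the image of \<open>b\<close> under a map \<open>B \<rightarrow> M\<close>, so a natural transformation between universal functors is
  determined by its component at \<open>B\<close>; transported along these isomorphisms, this component is a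
  homomorphism of left modules, and every homomorphism arises in this way.

  So \<open>\<Psi>\<close> is fully faithful by the third fact, and essentially surjective by the second and the
  uniqueness of universal arrows.
\<close>

section \<open>Equivalences of categories\<close>

context category
begin

lemma HomD:
  assumes "f \<in> Hom C X Y"
  shows "f \<in> Arr C" "Dom C f = X" "Cod C f = Y" "X \<in> Ob C" "Y \<in> Ob C"
  using assms Dom_Cod[of f] by (auto simp: Hom_def)

lemma Comp_Arr [simp]:
  assumes "f \<in> Arr C" "g \<in> Arr C" "Cod C f = Dom C g"
  shows "g \<cdot> f \<in> Arr C" "Dom C (g \<cdot> f) = Dom C f" "Cod C (g \<cdot> f) = Cod C g"
  using Comp_Hom[of f "Dom C f" "Dom C g" g "Cod C g"] assms by (auto simp: Hom_def)

lemma Id_Arr [simp]: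
  assumes "X \<in> Ob C"
  shows "Id C X \<in> Arr C" "Dom C (Id C X) = X" "Cod C (Id C X) = X"
  using Id_Hom[OF assms] by (auto simp: Hom_def)

lemma Comp_Id_Arr [simp]:
  "f \<in> Arr C \<Longrightarrow> Dom C f = X \<Longrightarrow> f \<cdot> Id C X = f"
  "f \<in> Arr C \<Longrightarrow> Cod C f = X \<Longrightarrow> Id C X \<cdot> f = f"
  using Comp_Id_right Comp_Id_left by (auto simp: Hom_def)

lemma Comp_assoc_Arr [simp]:
  assumes "f \<in> Arr C" "g \<in> Arr C" "h \<in> Arr C" "Cod C f = Dom C g" "Cod C g = Dom C h"
  shows "(h \<cdot> g) \<cdot> f = h \<cdot> (g \<cdot> f)"
  using Comp_assoc[of f "Dom C f" "Dom C g" g "Dom C h" h "Cod C h"] assms by (auto simp: Hom_def)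

lemma Dom_Cod_Ob [simp]: "f \<in> Arr C \<Longrightarrow> Dom C f \<in> Ob C" "f \<in> Arr C \<Longrightarrow> Cod C f \<in> Ob C"
  using Dom_Cod by auto

lemma isoE:
  assumes "is_iso C f" "f \<in> Hom C X Y"
  obtains g where "g \<in> Hom C Y X" "g \<cdot> f = Id C X" "f \<cdot> g = Id C Y"
  using assms by (auto simp: is_iso_def Hom_def)

lemma isoI:
  assumes "f \<in> Hom C X Y" "g \<in> Hom C Y X" "g \<cdot> f = Id C X" "f \<cdot> g = Id C Y"
  shows "is_iso C f"
  using assms by (auto simp: is_iso_def Hom_def)

end

lemma is_functorD:
  assumes "is_functor C D F"
  shows "X \<in> Ob C \<Longrightarrow> FOb F X \<in> Ob D"
    and "f \<in> Hom C X Y \<Longrightarrow> FArr F f \<in> Hom D (FOb F X) (FOb F Y)"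
    and "X \<in> Ob C \<Longrightarrow> FArr F (Id C X) = Id D (FOb F X)"
    and "\<lbrakk>f \<in> Hom C X Y; g \<in> Hom C Y Z\<rbrakk> \<Longrightarrow> FArr F (g \<cdot>\<^bsub>C\<^esub> f) = FArr F g \<cdot>\<^bsub>D\<^esub> FArr F f"
  using assms unfolding is_functor_def by blast+

text \<open>A quasi-inverse is obtained by choosing, for every object \<open>Y\<close>, a preimage of \<open>Y\<close> up to an
  isomorphism \<open>\<epsilon> Y\<close>, and transporting arrows along these isomorphisms; faithfulness reduces all
  identities between arrows of \<open>C\<close> to identities between their images.\<close>

theorem equivalence_if_fully_faithful_and_essentially_surjective:
  assumes "category C" and "category D" and F: "is_functor C D F"
    and ff: "\<And>X Y. \<lbrakk>X \<in> Ob C; Y \<in> Ob C\<rbrakk>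
      \<Longrightarrow> bij_betw (FArr F) (Hom C X Y) (Hom D (FOb F X) (FOb F Y))"
    and es: "\<And>Y. Y \<in> Ob D \<Longrightarrow> \<exists>X\<in>Ob C. \<exists>f\<in>Hom D (FOb F X) Y. is_iso D f"
  shows "equivalence_of_categories C D F"
proof -
  interpret C: category C by fact
  interpret D: category D by fact
  note F_simps = is_functorD[OF F]
  have "\<forall>Y\<in>Ob D. \<exists>X e e'. X \<in> Ob C \<and> e \<in> Hom D (FOb F X) Y \<and> e' \<in> Hom D Y (FOb F X) \<and>
      e' \<cdot>\<^bsub>D\<^esub> e = Id D (FOb F X) \<and> e \<cdot>\<^bsub>D\<^esub> e' = Id D Y"
    using es by (meson D.isoE)
  then obtain G0 \<epsilon> \<epsilon>' where G0: "\<And>Y. Y \<in> Ob D \<Longrightarrow> G0 Y \<in> Ob C"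
    and \<epsilon>: "\<And>Y. Y \<in> Ob D \<Longrightarrow> \<epsilon> Y \<in> Hom D (FOb F (G0 Y)) Y"
    and \<epsilon>': "\<And>Y. Y \<in> Ob D \<Longrightarrow> \<epsilon>' Y \<in> Hom D Y (FOb F (G0 Y))"
    and inv: "\<And>Y. Y \<in> Ob D \<Longrightarrow> \<epsilon>' Y \<cdot>\<^bsub>D\<^esub> \<epsilon> Y = Id D (FOb F (G0 Y))"
      "\<And>Y. Y \<in> Ob D \<Longrightarrow> \<epsilon> Y \<cdot>\<^bsub>D\<^esub> \<epsilon>' Y = Id D Y"
    by metis
  note \<epsilon>_Arr [simp] = D.HomD(1-3)[OF \<epsilon>] D.HomD(1-3)[OF \<epsilon>'] inv
  have cancel [simp]: "\<epsilon>' Y \<cdot>\<^bsub>D\<^esub> (\<epsilon> Y \<cdot>\<^bsub>D\<^esub> f) = f"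
    if "Y \<in> Ob D" "f \<in> Arr D" "Cod D f = FOb F (G0 Y)" for Y f
    using that by (simp flip: D.Comp_assoc_Arr)
  have cancel' [simp]: "\<epsilon> Y \<cdot>\<^bsub>D\<^esub> (\<epsilon>' Y \<cdot>\<^bsub>D\<^esub> f) = f"
    if "Y \<in> Ob D" "f \<in> Arr D" "Cod D f = Y" for Y f
    using that by (simp flip: D.Comp_assoc_Arr)
  have FArr_simps [simp]: "FArr F f \<in> Arr D" "Dom D (FArr F f) = FOb F (Dom C f)"
    "Cod D (FArr F f) = FOb F (Cod C f)" if "f \<in> Arr C" for f
    using F_simps(2)[of f "Dom C f" "Cod C f"] that by (auto simp: Hom_def)
  have F_Comp [simp]: "FArr F (g \<cdot>\<^bsub>C\<^esub> f) = FArr F g \<cdot>\<^bsub>D\<^esub> FArr F f"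
    if "f \<in> Arr C" "g \<in> Arr C" "Cod C f = Dom C g" for f g
    using F_simps(4)[of f "Dom C f" "Dom C g" g "Cod C g"] that by (auto simp: Hom_def)
  have F_Ob [simp]: "X \<in> Ob C \<Longrightarrow> FOb F X \<in> Ob D" "Y \<in> Ob D \<Longrightarrow> G0 Y \<in> Ob C" for X Y
    using F_simps(1) G0 by auto
  have F_Id [simp]: "X \<in> Ob C \<Longrightarrow> FArr F (Id C X) = Id D (FOb F X)" for X
    using F_simps(3) .
  define lift where "lift X Y = inv_into (Hom C X Y) (FArr F)" for X Y
  have lift: "lift X Y h \<in> Hom C X Y" "FArr F (lift X Y h) = h"
    if "X \<in> Ob C" "Y \<in> Ob C" "h \<in> Arr D" "Dom D h = FOb F X" "Cod D h = FOb F Y" for X Y h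
  proof -
    have "h \<in> FArr F ` Hom C X Y"
      using ff[OF that(1,2)] that by (auto simp: bij_betw_def Hom_def)
    then show "lift X Y h \<in> Hom C X Y" "FArr F (lift X Y h) = h"
      unfolding lift_def by (auto intro: inv_into_into f_inv_into_f)
  qed
  have lift_simps [simp]: "lift X Y h \<in> Arr C" "Dom C (lift X Y h) = X" "Cod C (lift X Y h) = Y"
      "FArr F (lift X Y h) = h"
    if "X \<in> Ob C" "Y \<in> Ob C" "h \<in> Arr D" "Dom D h = FOb F X" "Cod D h = FOb F Y" for X Y h
    using lift[OF that] by (auto simp: Hom_def)
  have eqI: "u = v" if "u \<in> Arr C" "v \<in> Arr C" "Dom C u = Dom C v" "Cod C u = Cod C v"
      "FArr F u = FArr F v" for u v
  proof -
    have "inj_on (FArr F) (Hom C (Dom C v) (Cod C v))"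
      using ff that by (auto simp: bij_betw_def)
    then show ?thesis using that by (auto simp: Hom_def dest: inj_onD)
  qed
  define G where "G = \<lparr>FOb = G0,
    FArr = (\<lambda>f. lift (G0 (Dom D f)) (G0 (Cod D f)) (\<epsilon>' (Cod D f) \<cdot>\<^bsub>D\<^esub> (f \<cdot>\<^bsub>D\<^esub> \<epsilon> (Dom D f))))\<rparr>"
  have FOb_G [simp]: "FOb G = G0" by (simp add: G_def)
  have G_Arr [simp]: "FArr G f \<in> Arr C" "Dom C (FArr G f) = G0 (Dom D f)"
     "Cod C (FArr G f) = G0 (Cod D f)"
     "FArr F (FArr G f) = \<epsilon>' (Cod D f) \<cdot>\<^bsub>D\<^esub> (f \<cdot>\<^bsub>D\<^esub> \<epsilon> (Dom D f))" if "f \<in> Arr D" for f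
    using that unfolding G_def by auto
  have G: "is_functor D C G"
    unfolding is_functor_def
  proof (intro conjI allI ballI)
    fix X assume "X \<in> Ob D" then show "FArr G (Id D X) = Id C (FOb G X)"
      by (intro eqI) auto
  next
    fix X Y Z f g assume "f \<in> Hom D X Y" "g \<in> Hom D Y Z"
    then have "f \<in> Arr D" "g \<in> Arr D" "Cod D f = Dom D g" by (auto simp: Hom_def)
    then show "FArr G (g \<cdot>\<^bsub>D\<^esub> f) = FArr G g \<cdot>\<^bsub>C\<^esub> FArr G f"
      by (intro eqI) auto
  qed (auto simp: Hom_def)
  have counit: "nat_isomorphic D D (comp_functor F G) id_functor"
    unfolding nat_isomorphic_def nat_transf_def
  proof (intro exI conjI ballI allI)
    show "restrict \<epsilon> (Ob D) \<in> extensional (Ob D)" by simp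
    fix X assume X: "X \<in> Ob D"
    then show "restrict \<epsilon> (Ob D) X \<in> Hom D (FOb (comp_functor F G) X) (FOb id_functor X)"
      using \<epsilon>[of X] by (simp add: comp_functor_def id_functor_def)
    show "is_iso D (restrict \<epsilon> (Ob D) X)"
      using D.isoI[OF \<epsilon>[OF X] \<epsilon>'[OF X]] X by simp
  next
    fix X Y f assume "f \<in> Hom D X Y"
    from D.HomD[OF this] show "restrict \<epsilon> (Ob D) Y \<cdot>\<^bsub>D\<^esub> FArr (comp_functor F G) f =
        FArr id_functor f \<cdot>\<^bsub>D\<^esub> restrict \<epsilon> (Ob D) X"
      by (simp add: comp_functor_def id_functor_def)
  qed
  define \<eta> where "\<eta> = (\<lambda>X\<in>Ob C. lift X (G0 (FOb F X)) (\<epsilon>' (FOb F X)))"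
  have \<eta> [simp]: "\<eta> X \<in> Arr C" "Dom C (\<eta> X) = X" "Cod C (\<eta> X) = G0 (FOb F X)"
      "FArr F (\<eta> X) = \<epsilon>' (FOb F X)" if "X \<in> Ob C" for X
    using that by (auto simp: \<eta>_def)
  have unit: "nat_isomorphic C C id_functor (comp_functor G F)"
    unfolding nat_isomorphic_def nat_transf_def
  proof (intro exI conjI ballI allI)
    show "\<eta> \<in> extensional (Ob C)" by (simp add: \<eta>_def)
    fix X assume X: "X \<in> Ob C"
    then show "\<eta> X \<in> Hom C (FOb id_functor X) (FOb (comp_functor G F) X)"
      by (simp add: Hom_def comp_functor_def id_functor_def)
    let ?\<theta> = "lift (G0 (FOb F X)) X (\<epsilon> (FOb F X))"
    have "\<eta> X \<in> Hom C X (G0 (FOb F X))" "?\<theta> \<in> Hom C (G0 (FOb F X)) X"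
      using X by (auto simp: Hom_def)
    moreover have "?\<theta> \<cdot>\<^bsub>C\<^esub> \<eta> X = Id C X" "\<eta> X \<cdot>\<^bsub>C\<^esub> ?\<theta> = Id C (G0 (FOb F X))"
      using X by (auto intro!: eqI)
    ultimately show "is_iso C (\<eta> X)" by (rule C.isoI)
  next
    fix X Y f assume "f \<in> Hom C X Y"
    note f = C.HomD[OF this]
    have "\<eta> Y \<cdot>\<^bsub>C\<^esub> f = FArr G (FArr F f) \<cdot>\<^bsub>C\<^esub> \<eta> X"
      using f by (auto intro!: eqI)
    then show "\<eta> Y \<cdot>\<^bsub>C\<^esub> FArr id_functor f = FArr (comp_functor G F) f \<cdot>\<^bsub>C\<^esub> \<eta> X"
      by (simp add: comp_functor_def id_functor_def)
  qed
  show ?thesis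
    unfolding equivalence_of_categories_def using assms(1-3) G unit counit by blast
qed

lemma category_full_subcategory:
  assumes "category C"
  shows "category (full_subcategory C S)"
proof -
  interpret category C by fact
  show ?thesis
    by unfold_locales (auto simp: full_subcategory_def Hom_def)
qed

lemma category_functor_category:
  assumes "category C" and "category D"
  shows "category (functor_category C D)"
proof -
  interpret C: category C by fact
  interpret D: category D by fact
  have nt: "\<eta> X \<in> Arr D" "Dom D (\<eta> X) = FOb F X" "Cod D (\<eta> X) = FOb G X"
    if "nat_transf C D F G \<eta>" "X \<in> Ob C" for F G \<eta> X
    using that by (auto simp: nat_transf_def Hom_def)
  have nat: "\<eta> Y \<cdot>\<^bsub>D\<^esub> FArr F f = FArr G f \<cdot>\<^bsub>D\<^esub> \<eta> X"
    if "nat_transf C D F G \<eta>" "f \<in> Hom C X Y" for F G \<eta> X Y f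
    using that by (auto simp: nat_transf_def)
  have ext: "\<eta> \<in> extensional (Ob C)" if "nat_transf C D F G \<eta>" for F G \<eta>
    using that by (auto simp: nat_transf_def)
  have id: "nat_transf C D F F (\<lambda>X\<in>Ob C. Id D (FOb F X))" if F: "is_functor C D F" for F
    unfolding nat_transf_def
  proof (intro conjI ballI allI)
    fix X Y f assume f: "f \<in> Hom C X Y"
    then show "(\<lambda>X\<in>Ob C. Id D (FOb F X)) Y \<cdot>\<^bsub>D\<^esub> FArr F f
        = FArr F f \<cdot>\<^bsub>D\<^esub> (\<lambda>X\<in>Ob C. Id D (FOb F X)) X"
      using C.HomD(4,5)[OF f] D.HomD(1-3)[OF is_functorD(2)[OF F f]] by simp
  qed (use is_functorD(1)[OF F] in \<open>auto intro: D.Id_Hom\<close>)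
  have comp: "nat_transf C D F H (\<lambda>X\<in>Ob C. \<theta> X \<cdot>\<^bsub>D\<^esub> \<eta> X)"
    if F: "is_functor C D F" "is_functor C D G" "is_functor C D H"
      and \<eta>: "nat_transf C D F G \<eta>" and \<theta>: "nat_transf C D G H \<theta>" for F G H \<eta> \<theta>
    unfolding nat_transf_def
  proof (intro conjI ballI allI)
    fix X assume "X \<in> Ob C"
    then show "(\<lambda>X\<in>Ob C. \<theta> X \<cdot>\<^bsub>D\<^esub> \<eta> X) X \<in> Hom D (FOb F X) (FOb H X)"
      using nt[OF \<eta>, of X] nt[OF \<theta>, of X] by (auto simp: Hom_def)
  next
    fix X Y f assume f: "f \<in> Hom C X Y"
    note o = C.HomD(4,5)[OF f]
    note a = D.HomD(1-3)[OF is_functorD(2)[OF F(1) f]] D.HomD(1-3)[OF is_functorD(2)[OF F(2) f]]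
      D.HomD(1-3)[OF is_functorD(2)[OF F(3) f]]
      nt[OF \<eta> o(1)] nt[OF \<eta> o(2)] nt[OF \<theta> o(1)] nt[OF \<theta> o(2)]
    have "\<theta> Y \<cdot>\<^bsub>D\<^esub> (\<eta> Y \<cdot>\<^bsub>D\<^esub> FArr F f) = (\<theta> Y \<cdot>\<^bsub>D\<^esub> FArr G f) \<cdot>\<^bsub>D\<^esub> \<eta> X"
      using a by (simp add: nat[OF \<eta> f])
    also have "\<dots> = FArr H f \<cdot>\<^bsub>D\<^esub> (\<theta> X \<cdot>\<^bsub>D\<^esub> \<eta> X)"
      using a by (simp add: nat[OF \<theta> f])
    finally show "(\<lambda>X\<in>Ob C. \<theta> X \<cdot>\<^bsub>D\<^esub> \<eta> X) Y \<cdot>\<^bsub>D\<^esub> FArr F f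
        = FArr H f \<cdot>\<^bsub>D\<^esub> (\<lambda>X\<in>Ob C. \<theta> X \<cdot>\<^bsub>D\<^esub> \<eta> X) X"
      using a o by simp
  qed auto
  show ?thesis
  proof
    fix F assume "F \<in> Ob (functor_category C D)"
    then show "Id (functor_category C D) F \<in> Hom (functor_category C D) F F"
      using id by (simp add: functor_category_def Hom_def)
  next
    fix f g F G H
    assume "f \<in> Hom (functor_category C D) F G" "g \<in> Hom (functor_category C D) G H"
    then show "g \<cdot>\<^bsub>functor_category C D\<^esub> f \<in> Hom (functor_category C D) F H"
      using comp by (auto simp: functor_category_def Hom_def)
  next
    fix f F G assume "f \<in> Hom (functor_category C D) F G"
    then show "f \<cdot>\<^bsub>functor_category C D\<^esub> Id (functor_category C D) F = f"
      and "Id (functor_category C D) G \<cdot>\<^bsub>functor_category C D\<^esub> f = f"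
      using nt by (auto simp: functor_category_def Hom_def intro!: extensionalityI[OF _ ext])
  next
    fix f g h E F G H
    assume "f \<in> Hom (functor_category C D) E F" "g \<in> Hom (functor_category C D) F G"
      "h \<in> Hom (functor_category C D) G H"
    then show "(h \<cdot>\<^bsub>functor_category C D\<^esub> g) \<cdot>\<^bsub>functor_category C D\<^esub> f
        = h \<cdot>\<^bsub>functor_category C D\<^esub> (g \<cdot>\<^bsub>functor_category C D\<^esub> f)"
      using nt by (auto simp: functor_category_def Hom_def fun_eq_iff)
  qed (auto simp: functor_category_def)
qed

section \<open>Cokernels and right exactness in linear categories\<close>

lemma is_cokernel_factor:
  assumes "is_cokernel C f c" "h \<in> Hom C (Cod C f) Z" "h \<cdot>\<^bsub>C\<^esub> f = zero_arr C (Dom C f) Z"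
  shows "\<exists>!u. u \<in> Hom C (Cod C c) Z \<and> u \<cdot>\<^bsub>C\<^esub> c = h"
proof -
  have h: "h \<in> Arr C" "Dom C h = Cod C f" "Cod C h = Z" using assms(2) by (simp_all add: Hom_def)
  then show ?thesis using assms(1,3) unfolding is_cokernel_def by blast
qed

lemma is_kernel_factor:
  assumes "is_kernel C f i" "h \<in> Hom C Z (Dom C f)" "f \<cdot>\<^bsub>C\<^esub> h = zero_arr C Z (Cod C f)"
  shows "\<exists>!u. u \<in> Hom C Z (Dom C i) \<and> i \<cdot>\<^bsub>C\<^esub> u = h"
proof -
  have h: "h \<in> Arr C" "Cod C h = Dom C f" "Dom C h = Z" using assms(2) by (simp_all add: Hom_def)
  then show ?thesis using assms(1,3) unfolding is_kernel_def by blast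
qed

context linear_category
begin

lemma hom_abelian_group:
  assumes "X \<in> Ob C" "Y \<in> Ob C"
  shows "abelian_group (HomMod C X Y)"
  using HomMod_module[OF assms] by (simp add: module_def)

lemma zero_Hom [simp, intro]:
  assumes "X \<in> Ob C" "Y \<in> Ob C"
  shows "zero_arr C X Y \<in> Hom C X Y"
proof -
  interpret abelian_group "HomMod C X Y" using hom_abelian_group[OF assms] .
  show ?thesis using zero_closed HomMod_carrier[OF assms] by (simp add: zero_arr_def)
qed

lemma zero_Arr [simp]:
  assumes "X \<in> Ob C" "Y \<in> Ob C"
  shows "zero_arr C X Y \<in> Arr C" "Dom C (zero_arr C X Y) = X" "Cod C (zero_arr C X Y) = Y"
  using HomD[OF zero_Hom[OF assms]] by auto

lemma add_Hom [simp, intro]: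
  assumes "f \<in> Hom C X Y" "g \<in> Hom C X Y"
  shows "f \<oplus>\<^bsub>HomMod C X Y\<^esub> g \<in> Hom C X Y"
proof -
  note o = HomD(4,5)[OF assms(1)]
  interpret abelian_group "HomMod C X Y" using hom_abelian_group[OF o] .
  show ?thesis using a_closed assms HomMod_carrier[OF o] by simp
qed

lemma add_zero_arr:
  assumes "f \<in> Hom C X Y"
  shows "f \<oplus>\<^bsub>HomMod C X Y\<^esub> zero_arr C X Y = f" "zero_arr C X Y \<oplus>\<^bsub>HomMod C X Y\<^esub> f = f"
proof -
  note o = HomD(4,5)[OF assms(1)]
  interpret abelian_group "HomMod C X Y" using hom_abelian_group[OF o] .
  show "f \<oplus>\<^bsub>HomMod C X Y\<^esub> zero_arr C X Y = f" "zero_arr C X Y \<oplus>\<^bsub>HomMod C X Y\<^esub> f = f"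
    using assms HomMod_carrier[OF o] by (simp_all add: zero_arr_def)
qed

lemma double_eq_zero_arr:
  assumes "f \<in> Hom C X Y" "f \<oplus>\<^bsub>HomMod C X Y\<^esub> f = f"
  shows "f = zero_arr C X Y"
proof -
  note o = HomD(4,5)[OF assms(1)]
  interpret abelian_group "HomMod C X Y" using hom_abelian_group[OF o] .
  show ?thesis
    using assms HomMod_carrier[OF o] add.l_cancel_one[of f f] by (simp add: zero_arr_def)
qed

lemma comp_zero_arr:
  assumes "f \<in> Hom C Y Z" "X \<in> Ob C"
  shows "f \<cdot>\<^bsub>C\<^esub> zero_arr C X Y = zero_arr C X Z"
proof -
  note o = HomD[OF assms(1)]
  have z: "zero_arr C X Y \<in> Hom C X Y" using o assms by simp
  have "f \<cdot>\<^bsub>C\<^esub> zero_arr C X Y \<oplus>\<^bsub>HomMod C X Z\<^esub> f \<cdot>\<^bsub>C\<^esub> zero_arr C X Y = f \<cdot>\<^bsub>C\<^esub> zero_arr C X Y"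
    using Comp_add_right[OF z z assms(1)] add_zero_arr[OF z] by simp
  then show ?thesis using double_eq_zero_arr Comp_Hom[OF z assms(1)] by blast
qed

lemma zero_arr_comp:
  assumes "f \<in> Hom C X Y" "Z \<in> Ob C"
  shows "zero_arr C Y Z \<cdot>\<^bsub>C\<^esub> f = zero_arr C X Z"
proof -
  note o = HomD[OF assms(1)]
  have z: "zero_arr C Y Z \<in> Hom C Y Z" using o assms by simp
  have "zero_arr C Y Z \<cdot>\<^bsub>C\<^esub> f \<oplus>\<^bsub>HomMod C X Z\<^esub> zero_arr C Y Z \<cdot>\<^bsub>C\<^esub> f = zero_arr C Y Z \<cdot>\<^bsub>C\<^esub> f"
    using Comp_add_left[OF assms(1) z z] add_zero_arr[OF z] by simp
  then show ?thesis using double_eq_zero_arr Comp_Hom[OF assms(1) z] by blast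
qed

lemma zero_arr_comp_Arr [simp]:
  "\<lbrakk>f \<in> Arr C; Cod C f = Y; Z \<in> Ob C\<rbrakk> \<Longrightarrow> zero_arr C Y Z \<cdot>\<^bsub>C\<^esub> f = zero_arr C (Dom C f) Z"
  "\<lbrakk>f \<in> Arr C; Dom C f = Y; X \<in> Ob C\<rbrakk> \<Longrightarrow> f \<cdot>\<^bsub>C\<^esub> zero_arr C X Y = zero_arr C X (Cod C f)"
  using zero_arr_comp comp_zero_arr by (auto simp: Hom_def)

text \<open>Passing to the difference of two parallel arrows turns equalities of composites into vanishing
  composites, so that a cokernel of the difference is a coequalizer.\<close>

lemma ex_difference:
  assumes a: "a \<in> Hom C X Y" and b: "b \<in> Hom C X Y"
  shows "\<exists>d\<in>Hom C X Y.
    (\<forall>Z. \<forall>h\<in>Hom C Y Z. h \<cdot>\<^bsub>C\<^esub> d = zero_arr C X Z \<longleftrightarrow> h \<cdot>\<^bsub>C\<^esub> a = h \<cdot>\<^bsub>C\<^esub> b) \<and>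
    (\<forall>W. \<forall>h\<in>Hom C W X. d \<cdot>\<^bsub>C\<^esub> h = zero_arr C W Y \<longleftrightarrow> a \<cdot>\<^bsub>C\<^esub> h = b \<cdot>\<^bsub>C\<^esub> h)"
proof -
  note o = HomD(4,5)[OF a]
  interpret XY: abelian_group "HomMod C X Y" using hom_abelian_group[OF o] .
  define d where "d = a \<ominus>\<^bsub>HomMod C X Y\<^esub> b"
  have d: "d \<in> Hom C X Y"
    using XY.minus_closed[of a b] a b HomMod_carrier[OF o] by (simp add: d_def)
  have a_eq: "d \<oplus>\<^bsub>HomMod C X Y\<^esub> b = a"
    using a b unfolding HomMod_carrier[OF o, symmetric] d_def
    by (simp add: XY.minus_eq XY.a_assoc XY.l_neg)
  have zero_iff: "u = zero_arr C W Z \<longleftrightarrow> w = v"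
    if uv: "u \<in> Hom C W Z" "v \<in> Hom C W Z" and w: "w = u \<oplus>\<^bsub>HomMod C W Z\<^esub> v" for u v w W Z
  proof -
    note o' = HomD(4,5)[OF uv(1)]
    interpret abelian_group "HomMod C W Z" using hom_abelian_group[OF o'] .
    show ?thesis
      using uv w HomMod_carrier[OF o'] add.r_cancel_one[of v u] by (auto simp: zero_arr_def)
  qed
  show ?thesis
  proof (intro bexI[OF _ d] conjI allI ballI)
    show "h \<cdot>\<^bsub>C\<^esub> d = zero_arr C X Z \<longleftrightarrow> h \<cdot>\<^bsub>C\<^esub> a = h \<cdot>\<^bsub>C\<^esub> b" if h: "h \<in> Hom C Y Z" for Z h
      by (rule zero_iff[OF Comp_Hom[OF d h] Comp_Hom[OF b h]]) (use Comp_add_right[OF d b h] a_eq in simp)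
    show "d \<cdot>\<^bsub>C\<^esub> h = zero_arr C W Y \<longleftrightarrow> a \<cdot>\<^bsub>C\<^esub> h = b \<cdot>\<^bsub>C\<^esub> h" if h: "h \<in> Hom C W X" for W h
      by (rule zero_iff[OF Comp_Hom[OF h d] Comp_Hom[OF h b]]) (use Comp_add_left[OF h d b] a_eq in simp)
  qed
qed

text \<open>In an exact sequence \<open>X \<rightarrow> Y \<rightarrow> Z \<rightarrow> 0\<close> the second arrow is epi, because the kernel of
  \<open>Z \<rightarrow> 0\<close> is an isomorphism.\<close>

lemma right_exact_seq_cancel:
  assumes "right_exact_seq C f g" "h \<in> Arr C" "Dom C h = Cod C g"
    "h \<cdot>\<^bsub>C\<^esub> g = zero_arr C (Dom C g) (Cod C h)"
  shows "h = zero_arr C (Cod C g) (Cod C h)"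
proof -
  obtain O' c i where Z: "is_zero_object C O'" and c: "is_cokernel C g c"
    and i: "is_kernel C c i" "is_kernel C (zero_arr C (Cod C g) O') i"
    using assms(1) by (auto simp: right_exact_seq_def exact_def)
  have g: "g \<in> Arr C" using c by (simp add: is_cokernel_def)
  have O': "O' \<in> Ob C" using Z by (simp add: is_zero_object_def)
  have "Id C (Cod C g) \<in> Hom C (Cod C g) (Dom C (zero_arr C (Cod C g) O'))"
    "zero_arr C (Cod C g) O' \<cdot>\<^bsub>C\<^esub> Id C (Cod C g)
      = zero_arr C (Cod C g) (Cod C (zero_arr C (Cod C g) O'))"
    using g O' by (simp_all add: Hom_def)
  then obtain u where u: "u \<in> Hom C (Cod C g) (Dom C i)" "i \<cdot>\<^bsub>C\<^esub> u = Id C (Cod C g)"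
    using is_kernel_factor[OF i(2)] by blast
  note u_Arr = HomD[OF u(1)]
  have c_Arr: "c \<in> Arr C" "Dom C c = Cod C g" and i_Arr: "i \<in> Arr C" "Cod C i = Cod C g"
    and ci: "c \<cdot>\<^bsub>C\<^esub> i = zero_arr C (Dom C i) (Cod C c)"
    using c i(1) by (auto simp: is_kernel_def is_cokernel_def)
  have "c = (c \<cdot>\<^bsub>C\<^esub> i) \<cdot>\<^bsub>C\<^esub> u" using u c_Arr i_Arr u_Arr by simp
  also have "\<dots> = zero_arr C (Cod C g) (Cod C c)"
    using ci u_Arr c_Arr by simp
  finally have c0: "c = zero_arr C (Cod C g) (Cod C c)" .
  have "h \<in> Hom C (Cod C g) (Cod C h)" using assms by (simp add: Hom_def)
  then obtain w where w: "w \<in> Hom C (Cod C c) (Cod C h)" "w \<cdot>\<^bsub>C\<^esub> c = h"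
    using is_cokernel_factor[OF c _ assms(4)] by blast
  have "h = w \<cdot>\<^bsub>C\<^esub> zero_arr C (Cod C g) (Cod C c)" using w c0 by simp
  also have "\<dots> = zero_arr C (Cod C g) (Cod C h)"
    using HomD[OF w(1)] g by simp
  finally show ?thesis .
qed

lemma is_cokernel_cancel:
  assumes c: "is_cokernel C f c" and u: "u \<in> Hom C (Cod C c) Z" and v: "v \<in> Hom C (Cod C c) Z"
    and eq: "u \<cdot>\<^bsub>C\<^esub> c = v \<cdot>\<^bsub>C\<^esub> c"
  shows "u = v"
proof -
  have c_Arr: "c \<in> Arr C" "Dom C c = Cod C f" "f \<in> Arr C"
    "c \<cdot>\<^bsub>C\<^esub> f = zero_arr C (Dom C f) (Cod C c)"
    using c by (auto simp: is_cokernel_def)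
  note u_Arr = HomD[OF u] and v_Arr = HomD[OF v]
  have "(u \<cdot>\<^bsub>C\<^esub> c) \<cdot>\<^bsub>C\<^esub> f = zero_arr C (Dom C f) Z" using c_Arr u_Arr by simp
  then have "\<exists>!w. w \<in> Hom C (Cod C c) Z \<and> w \<cdot>\<^bsub>C\<^esub> c = u \<cdot>\<^bsub>C\<^esub> c"
    using is_cokernel_factor[OF c, of "u \<cdot>\<^bsub>C\<^esub> c" Z] c_Arr u_Arr by (simp add: Hom_def)
  then show ?thesis using u v eq by auto
qed

end

context abelian_category
begin

lemma ex_coequalizer:
  assumes a: "a \<in> Hom C X Y" and b: "b \<in> Hom C X Y"
  shows "\<exists>Q c. c \<in> Hom C Y Q \<and> c \<cdot>\<^bsub>C\<^esub> a = c \<cdot>\<^bsub>C\<^esub> b \<and>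
    (\<forall>Z. \<forall>h\<in>Hom C Y Z. h \<cdot>\<^bsub>C\<^esub> a = h \<cdot>\<^bsub>C\<^esub> b \<longrightarrow> (\<exists>!u. u \<in> Hom C Q Z \<and> u \<cdot>\<^bsub>C\<^esub> c = h))"
proof -
  obtain d where d: "d \<in> Hom C X Y"
    and d_iff: "\<And>Z h. h \<in> Hom C Y Z \<Longrightarrow> h \<cdot>\<^bsub>C\<^esub> d = zero_arr C X Z \<longleftrightarrow> h \<cdot>\<^bsub>C\<^esub> a = h \<cdot>\<^bsub>C\<^esub> b"
    using ex_difference[OF a b] by metis
  obtain c where c: "is_cokernel C d c"
    using ex_cokernel HomD(1)[OF d] by blast
  have c_Hom: "c \<in> Hom C Y (Cod C c)" and cd: "c \<cdot>\<^bsub>C\<^esub> d = zero_arr C X (Cod C c)"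
    using c HomD[OF d] by (auto simp: is_cokernel_def Hom_def)
  show ?thesis
  proof (intro exI conjI allI ballI impI)
    show "c \<in> Hom C Y (Cod C c)" by fact
    show "c \<cdot>\<^bsub>C\<^esub> a = c \<cdot>\<^bsub>C\<^esub> b" using d_iff[OF c_Hom] cd by simp
    fix Z h assume h: "h \<in> Hom C Y Z" "h \<cdot>\<^bsub>C\<^esub> a = h \<cdot>\<^bsub>C\<^esub> b"
    then have "h \<in> Hom C (Cod C d) Z" "h \<cdot>\<^bsub>C\<^esub> d = zero_arr C (Dom C d) Z"
      using d_iff[of h Z] HomD[OF d] by auto
    then show "\<exists>!u. u \<in> Hom C (Cod C c) Z \<and> u \<cdot>\<^bsub>C\<^esub> c = h"
      using is_cokernel_factor[OF c] by blast
  qed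
qed

text \<open>The image of \<open>f\<close> being the kernel of \<open>g\<close>, the epi \<open>g\<close> is a cokernel of its kernel, which
  is the image of \<open>f\<close>, hence a cokernel of \<open>f\<close>.\<close>

lemma right_exact_seq_iff_is_cokernel: "right_exact_seq C f g \<longleftrightarrow> is_cokernel C f g"
proof
  assume re: "right_exact_seq C f g"
  then obtain c i where f: "f \<in> Arr C" and g: "g \<in> Arr C" "Dom C g = Cod C f"
    and c: "is_cokernel C f c" and i: "is_kernel C c i" "is_kernel C g i"
    unfolding right_exact_seq_def exact_def by auto
  have c_Arr: "c \<in> Arr C" "Dom C c = Cod C f" "c \<cdot>\<^bsub>C\<^esub> f = zero_arr C (Dom C f) (Cod C c)"
    using c by (auto simp: is_cokernel_def)
  have i_Arr: "i \<in> Arr C" "Cod C i = Cod C f" "c \<cdot>\<^bsub>C\<^esub> i = zero_arr C (Dom C i) (Cod C c)"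
      "g \<cdot>\<^bsub>C\<^esub> i = zero_arr C (Dom C i) (Cod C g)"
    using i c_Arr g by (auto simp: is_kernel_def)
  have g_cancel: "u = v" if u: "u \<in> Hom C (Cod C g) X" and v: "v \<in> Hom C (Cod C g) X"
    and eq: "u \<cdot>\<^bsub>C\<^esub> g = v \<cdot>\<^bsub>C\<^esub> g" for u v X
  proof -
    obtain d where d: "d \<in> Hom C (Cod C g) X"
      and d_iff: "\<And>W h. h \<in> Hom C W (Cod C g) \<Longrightarrow>
        d \<cdot>\<^bsub>C\<^esub> h = zero_arr C W X \<longleftrightarrow> u \<cdot>\<^bsub>C\<^esub> h = v \<cdot>\<^bsub>C\<^esub> h"
      using ex_difference[OF u v] by metis
    have "g \<in> Hom C (Dom C g) (Cod C g)" using g by (simp add: Hom_def)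
    then have "d \<cdot>\<^bsub>C\<^esub> g = zero_arr C (Dom C g) X" using d_iff eq by simp
    then have "d = zero_arr C (Cod C g) X"
      using right_exact_seq_cancel[OF re, of d] HomD[OF d] by simp
    then have "d \<cdot>\<^bsub>C\<^esub> Id C (Cod C g) = zero_arr C (Cod C g) X"
      using Comp_Id_right[OF d] by simp
    then show "u = v"
      using d_iff[OF Id_Hom[OF HomD(4)[OF d]]] Comp_Id_right[OF u] Comp_Id_right[OF v] by simp
  qed
  then have "is_epi C g" using g unfolding is_epi_def by blast
  then obtain j where j: "is_cokernel C j g" using epi_is_cokernel by blast
  have j_Arr: "j \<in> Arr C" "Cod C j = Cod C f" "g \<cdot>\<^bsub>C\<^esub> j = zero_arr C (Dom C j) (Cod C g)"
    using j g by (auto simp: is_cokernel_def)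
  \<comment> \<open>\<open>c\<close> and \<open>g\<close> have the same kernel, so \<open>f\<close> is killed by \<open>g\<close> and \<open>c\<close> factors through \<open>g\<close>.\<close>
  have "f \<in> Hom C (Dom C f) (Dom C c)" using f c_Arr by (simp add: Hom_def)
  then obtain w where w: "w \<in> Hom C (Dom C f) (Dom C i)" "i \<cdot>\<^bsub>C\<^esub> w = f"
    using is_kernel_factor[OF i(1) _ c_Arr(3)] by blast
  note w_Arr = HomD[OF w(1)]
  have "g \<cdot>\<^bsub>C\<^esub> f = (g \<cdot>\<^bsub>C\<^esub> i) \<cdot>\<^bsub>C\<^esub> w" using w w_Arr i_Arr(1,2) g by simp
  then have gf: "g \<cdot>\<^bsub>C\<^esub> f = zero_arr C (Dom C f) (Cod C g)" using i_Arr g w_Arr by simp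
  have "j \<in> Hom C (Dom C j) (Dom C g)" using j_Arr g by (simp add: Hom_def)
  then obtain v where v: "v \<in> Hom C (Dom C j) (Dom C i)" "i \<cdot>\<^bsub>C\<^esub> v = j"
    using is_kernel_factor[OF i(2) _ j_Arr(3)] by blast
  note v_Arr = HomD[OF v(1)]
  have "c \<cdot>\<^bsub>C\<^esub> j = (c \<cdot>\<^bsub>C\<^esub> i) \<cdot>\<^bsub>C\<^esub> v" using v v_Arr i_Arr(1,2) c_Arr by simp
  then have "c \<cdot>\<^bsub>C\<^esub> j = zero_arr C (Dom C j) (Cod C c)" using i_Arr c_Arr v_Arr by simp
  moreover have "c \<in> Hom C (Cod C j) (Cod C c)" using c_Arr j_Arr by (simp add: Hom_def)
  ultimately obtain y where y: "y \<in> Hom C (Cod C g) (Cod C c)" "y \<cdot>\<^bsub>C\<^esub> g = c"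
    using is_cokernel_factor[OF j] by blast
  note y_Arr = HomD[OF y(1)]
  show "is_cokernel C f g"
    unfolding is_cokernel_def
  proof (intro conjI ballI impI)
    fix h assume h: "h \<in> Arr C" "Dom C h = Cod C f \<and> h \<cdot>\<^bsub>C\<^esub> f = zero_arr C (Dom C f) (Cod C h)"
    then have "h \<in> Hom C (Cod C f) (Cod C h)" by (simp add: Hom_def)
    then obtain u where u: "u \<in> Hom C (Cod C c) (Cod C h)" "u \<cdot>\<^bsub>C\<^esub> c = h"
      using is_cokernel_factor[OF c] h by blast
    note u_Arr = HomD[OF u(1)]
    have "u \<cdot>\<^bsub>C\<^esub> y \<in> Hom C (Cod C g) (Cod C h)" using y_Arr u_Arr by (auto simp: Hom_def)
    moreover have "(u \<cdot>\<^bsub>C\<^esub> y) \<cdot>\<^bsub>C\<^esub> g = h" using y_Arr u_Arr u y g by simp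
    ultimately show "\<exists>!u. u \<in> Hom C (Cod C g) (Cod C h) \<and> u \<cdot>\<^bsub>C\<^esub> g = h"
      using g_cancel by blast
  qed (use f g gf in simp_all)
next
  assume c: "is_cokernel C f g"
  then have f: "f \<in> Arr C" and g: "g \<in> Arr C" "Dom C g = Cod C f"
    by (auto simp: is_cokernel_def)
  obtain i where "is_kernel C g i" using ex_kernel g(1) by blast
  then have ex1: "exact C f g" using c f g unfolding exact_def by metis
  obtain O' where O': "is_zero_object C O'" using ex_zero_object by blast
  have O'_Ob: "O' \<in> Ob C" using O' by (simp add: is_zero_object_def)
  let ?z = "zero_arr C (Cod C g) O'" and ?I = "Id C (Cod C g)"
  have "is_cokernel C g ?z"
    unfolding is_cokernel_def
  proof (intro conjI ballI impI)
    fix h assume h: "h \<in> Arr C" "Dom C h = Cod C g \<and> h \<cdot>\<^bsub>C\<^esub> g = zero_arr C (Dom C g) (Cod C h)"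
    have "h = zero_arr C (Cod C g) (Cod C h)"
    proof (rule is_cokernel_cancel[OF c])
      show "h \<in> Hom C (Cod C g) (Cod C h)" using h by (simp add: Hom_def)
      show "zero_arr C (Cod C g) (Cod C h) \<in> Hom C (Cod C g) (Cod C h)" using g h(1) by simp
      show "h \<cdot>\<^bsub>C\<^esub> g = zero_arr C (Cod C g) (Cod C h) \<cdot>\<^bsub>C\<^esub> g" using g h by simp
    qed
    moreover have "u \<cdot>\<^bsub>C\<^esub> ?z = zero_arr C (Cod C g) (Cod C h)" if "u \<in> Hom C O' (Cod C h)" for u
      using HomD[OF that] g by simp
    moreover have "\<exists>!u. u \<in> Hom C O' (Cod C h)"
      using O' h(1) by (simp add: is_zero_object_def)
    moreover have "Cod C ?z = O'" using g O'_Ob by simp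
    ultimately show "\<exists>!u. u \<in> Hom C (Cod C ?z) (Cod C h) \<and> u \<cdot>\<^bsub>C\<^esub> ?z = h"
      by metis
  qed (use g O'_Ob in simp_all)
  moreover have "is_kernel C ?z ?I"
    unfolding is_kernel_def
  proof (intro conjI ballI impI)
    fix h assume h: "h \<in> Arr C"
      "Cod C h = Dom C ?z \<and> ?z \<cdot>\<^bsub>C\<^esub> h = zero_arr C (Dom C h) (Cod C ?z)"
    then have "Cod C h = Cod C g" using g O'_Ob by simp
    then show "\<exists>!u. u \<in> Hom C (Dom C h) (Dom C ?I) \<and> ?I \<cdot>\<^bsub>C\<^esub> u = h"
      using g h(1) by (intro ex1I[of _ h]) (auto simp: Hom_def)
  qed (use g O'_Ob in simp_all)
  moreover have "?z \<in> Arr C" "Cod C g = Dom C ?z" using g O'_Ob by simp_all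
  ultimately have "exact C g ?z"
    using g unfolding exact_def by blast
  then show "right_exact_seq C f g"
    using ex1 O' unfolding right_exact_seq_def by blast
qed

end

section \<open>Right modules and linear maps\<close>

lemma right_moduleI:
  fixes M :: "('m, 'r) rmodule"
  assumes "ring R" "abelian_group M"
    and "\<And>x r. \<lbrakk>x \<in> carrier M; r \<in> carrier R\<rbrakk> \<Longrightarrow> x \<triangleleft>\<^bsub>M\<^esub> r \<in> carrier M"
    and "\<And>x y r. \<lbrakk>x \<in> carrier M; y \<in> carrier M; r \<in> carrier R\<rbrakk>
      \<Longrightarrow> (x \<oplus>\<^bsub>M\<^esub> y) \<triangleleft>\<^bsub>M\<^esub> r = x \<triangleleft>\<^bsub>M\<^esub> r \<oplus>\<^bsub>M\<^esub> y \<triangleleft>\<^bsub>M\<^esub> r"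
    and "\<And>x r s. \<lbrakk>x \<in> carrier M; r \<in> carrier R; s \<in> carrier R\<rbrakk>
      \<Longrightarrow> x \<triangleleft>\<^bsub>M\<^esub> (r \<oplus>\<^bsub>R\<^esub> s) = x \<triangleleft>\<^bsub>M\<^esub> r \<oplus>\<^bsub>M\<^esub> x \<triangleleft>\<^bsub>M\<^esub> s"
    and "\<And>x r s. \<lbrakk>x \<in> carrier M; r \<in> carrier R; s \<in> carrier R\<rbrakk>
      \<Longrightarrow> x \<triangleleft>\<^bsub>M\<^esub> (r \<otimes>\<^bsub>R\<^esub> s) = (x \<triangleleft>\<^bsub>M\<^esub> r) \<triangleleft>\<^bsub>M\<^esub> s"
    and "\<And>x. x \<in> carrier M \<Longrightarrow> x \<triangleleft>\<^bsub>M\<^esub> \<one>\<^bsub>R\<^esub> = x"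
  shows "right_module R M"
  using assms by (simp add: right_module_def right_module_axioms_def)

lemma lin_mapsI:
  assumes "f \<in> extensional (carrier M)" "\<And>x. x \<in> carrier M \<Longrightarrow> f x \<in> carrier N"
    and "\<And>x y. \<lbrakk>x \<in> carrier M; y \<in> carrier M\<rbrakk> \<Longrightarrow> f (x \<oplus>\<^bsub>M\<^esub> y) = f x \<oplus>\<^bsub>N\<^esub> f y"
    and "\<And>x r. \<lbrakk>x \<in> carrier M; r \<in> carrier R\<rbrakk> \<Longrightarrow> f (x \<triangleleft>\<^bsub>M\<^esub> r) = f x \<triangleleft>\<^bsub>N\<^esub> r"
  shows "f \<in> lin_maps R M N"
  using assms by (auto simp: lin_maps_def PiE_iff)

lemma lin_mapsD:
  assumes "f \<in> lin_maps R M N"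
  shows "f \<in> extensional (carrier M)" "x \<in> carrier M \<Longrightarrow> f x \<in> carrier N"
    and "\<lbrakk>x \<in> carrier M; y \<in> carrier M\<rbrakk> \<Longrightarrow> f (x \<oplus>\<^bsub>M\<^esub> y) = f x \<oplus>\<^bsub>N\<^esub> f y"
    and "\<lbrakk>x \<in> carrier M; r \<in> carrier R\<rbrakk> \<Longrightarrow> f (x \<triangleleft>\<^bsub>M\<^esub> r) = f x \<triangleleft>\<^bsub>N\<^esub> r"
  using assms by (auto simp: lin_maps_def PiE_iff)

lemma lin_maps_eqI:
  assumes "f \<in> lin_maps R M N" "g \<in> lin_maps R M N" "\<And>x. x \<in> carrier M \<Longrightarrow> f x = g x"
  shows "f = g"
  using extensionalityI[OF lin_mapsD(1)[OF assms(1)] lin_mapsD(1)[OF assms(2)]] assms(3) by blast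

lemma lin_maps_zero:
  assumes "right_module R M" "right_module R N" "f \<in> lin_maps R M N"
  shows "f \<zero>\<^bsub>M\<^esub> = \<zero>\<^bsub>N\<^esub>"
proof -
  interpret M: right_module R M by fact
  interpret N: right_module R N by fact
  have "f \<zero>\<^bsub>M\<^esub> \<oplus>\<^bsub>N\<^esub> f \<zero>\<^bsub>M\<^esub> = f \<zero>\<^bsub>M\<^esub>"
    using lin_mapsD(3)[OF assms(3), of "\<zero>\<^bsub>M\<^esub>" "\<zero>\<^bsub>M\<^esub>"] by simp
  then show ?thesis
    using N.M.add.l_cancel_one[of "f \<zero>\<^bsub>M\<^esub>" "f \<zero>\<^bsub>M\<^esub>"] lin_mapsD(2)[OF assms(3)] by simp
qed

lemma lin_maps_minus:
  assumes "right_module R M" "right_module R N" "f \<in> lin_maps R M N"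
    "x \<in> carrier M" "y \<in> carrier M"
  shows "f (x \<ominus>\<^bsub>M\<^esub> y) = f x \<ominus>\<^bsub>N\<^esub> f y"
proof -
  interpret M: right_module R M by fact
  interpret N: right_module R N by fact
  note f = lin_mapsD[OF assms(3)]
  have "f (\<ominus>\<^bsub>M\<^esub> y) \<oplus>\<^bsub>N\<^esub> f y = \<zero>\<^bsub>N\<^esub>"
    using f(3)[of "\<ominus>\<^bsub>M\<^esub> y" y] lin_maps_zero[OF assms(1-3)] assms(5) by (simp add: M.M.l_neg)
  then have "f (\<ominus>\<^bsub>M\<^esub> y) = \<ominus>\<^bsub>N\<^esub> f y"
    using N.M.minus_equality[of "f (\<ominus>\<^bsub>M\<^esub> y)" "f y"] f(2) assms(5) by simp
  then show ?thesis
    using f(3)[of x "\<ominus>\<^bsub>M\<^esub> y"] assms(4,5) by (simp add: M.M.minus_eq N.M.minus_eq)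
qed

lemma lin_maps_compose:
  assumes "right_module R M" "f \<in> lin_maps R M N" "g \<in> lin_maps R N P"
  shows "compose (carrier M) g f \<in> lin_maps R M P"
proof -
  interpret M: right_module R M by fact
  show ?thesis
    using lin_mapsD[OF assms(2)] lin_mapsD[OF assms(3)]
    by (intro lin_mapsI) (auto simp: compose_def M.ract_closed)
qed

lemma compose_apply [simp]: "x \<in> A \<Longrightarrow> compose A g f x = g (f x)"
  by (simp add: compose_def)

context right_module
begin

lemma lin_maps_id: "(\<lambda>x\<in>carrier M. x) \<in> lin_maps R M M"
  by (intro lin_mapsI) (auto simp: ract_closed)

lemma zero_ract: "r \<in> carrier R \<Longrightarrow> \<zero>\<^bsub>M\<^esub> \<triangleleft>\<^bsub>M\<^esub> r = \<zero>\<^bsub>M\<^esub>"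
  using ract_add_left[of "\<zero>\<^bsub>M\<^esub>" "\<zero>\<^bsub>M\<^esub>" r] ract_closed[of "\<zero>\<^bsub>M\<^esub>" r]
    M.add.l_cancel_one'[of "\<zero>\<^bsub>M\<^esub> \<triangleleft>\<^bsub>M\<^esub> r" "\<zero>\<^bsub>M\<^esub> \<triangleleft>\<^bsub>M\<^esub> r"] by simp

lemma ract_zero: "x \<in> carrier M \<Longrightarrow> x \<triangleleft>\<^bsub>M\<^esub> \<zero>\<^bsub>R\<^esub> = \<zero>\<^bsub>M\<^esub>"
  using ract_add_right[of x "\<zero>\<^bsub>R\<^esub>" "\<zero>\<^bsub>R\<^esub>"] ract_closed[of x "\<zero>\<^bsub>R\<^esub>"]
    M.add.l_cancel_one'[of "x \<triangleleft>\<^bsub>M\<^esub> \<zero>\<^bsub>R\<^esub>" "x \<triangleleft>\<^bsub>M\<^esub> \<zero>\<^bsub>R\<^esub>"] by simp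

lemma ract_minus_one: "x \<in> carrier M \<Longrightarrow> x \<triangleleft>\<^bsub>M\<^esub> (\<ominus>\<^bsub>R\<^esub> \<one>\<^bsub>R\<^esub>) = \<ominus>\<^bsub>M\<^esub> x"
  using ract_add_right[of x "\<ominus>\<^bsub>R\<^esub> \<one>\<^bsub>R\<^esub>" "\<one>\<^bsub>R\<^esub>"] ract_closed[of x "\<ominus>\<^bsub>R\<^esub> \<one>\<^bsub>R\<^esub>"]
    M.minus_equality[of "x \<triangleleft>\<^bsub>M\<^esub> (\<ominus>\<^bsub>R\<^esub> \<one>\<^bsub>R\<^esub>)" x]
  by (simp add: ract_one ract_zero R.l_neg)

lemma minus_ract:
  assumes "x \<in> carrier M" "y \<in> carrier M" "r \<in> carrier R"
  shows "(x \<ominus>\<^bsub>M\<^esub> y) \<triangleleft>\<^bsub>M\<^esub> r = x \<triangleleft>\<^bsub>M\<^esub> r \<ominus>\<^bsub>M\<^esub> y \<triangleleft>\<^bsub>M\<^esub> r"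
proof -
  have "(\<lambda>x\<in>carrier M. x \<triangleleft>\<^bsub>M\<^esub> r) (\<ominus>\<^bsub>M\<^esub> y) = \<ominus>\<^bsub>M\<^esub> (y \<triangleleft>\<^bsub>M\<^esub> r)"
    using ract_add_left[of "\<ominus>\<^bsub>M\<^esub> y" y r] ract_closed assms
      M.minus_equality[of "(\<ominus>\<^bsub>M\<^esub> y) \<triangleleft>\<^bsub>M\<^esub> r" "y \<triangleleft>\<^bsub>M\<^esub> r"]
    by (simp add: M.l_neg zero_ract)
  then show ?thesis using assms by (simp add: M.minus_eq ract_add_left)
qed

end

lemma right_module_lin_maps_ops:
  assumes "right_module R M" "right_module R N"
  shows "(\<lambda>x\<in>carrier M. \<zero>\<^bsub>N\<^esub>) \<in> lin_maps R M N"
    and "\<lbrakk>f \<in> lin_maps R M N; g \<in> lin_maps R M N\<rbrakk>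
      \<Longrightarrow> (\<lambda>x\<in>carrier M. f x \<oplus>\<^bsub>N\<^esub> g x) \<in> lin_maps R M N"
proof -
  interpret M: right_module R M by fact
  interpret N: right_module R N by fact
  show "(\<lambda>x\<in>carrier M. \<zero>\<^bsub>N\<^esub>) \<in> lin_maps R M N"
    by (intro lin_mapsI) (auto simp: M.ract_closed N.zero_ract)
  assume fg: "f \<in> lin_maps R M N" "g \<in> lin_maps R M N"
  note f = lin_mapsD[OF fg(1)] and g = lin_mapsD[OF fg(2)]
  show "(\<lambda>x\<in>carrier M. f x \<oplus>\<^bsub>N\<^esub> g x) \<in> lin_maps R M N"
    by (intro lin_mapsI)
      (simp_all add: f(2-4) g(2-4) M.ract_closed N.ract_add_left N.M.a_ac)
qed

subsection \<open>Submodules\<close>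

definition is_submodule :: "('r, 's) ring_scheme \<Rightarrow> ('m, 'r) rmodule \<Rightarrow> 'm set \<Rightarrow> bool" where
  "is_submodule R M U \<longleftrightarrow> U \<subseteq> carrier M \<and> \<zero>\<^bsub>M\<^esub> \<in> U \<and>
     (\<forall>x\<in>U. \<forall>y\<in>U. x \<oplus>\<^bsub>M\<^esub> y \<in> U) \<and> (\<forall>x\<in>U. \<forall>r\<in>carrier R. x \<triangleleft>\<^bsub>M\<^esub> r \<in> U)"

lemma is_submoduleD:
  assumes "is_submodule R M U"
  shows "U \<subseteq> carrier M" "x \<in> U \<Longrightarrow> x \<in> carrier M" "\<zero>\<^bsub>M\<^esub> \<in> U"
    "\<lbrakk>x \<in> U; y \<in> U\<rbrakk> \<Longrightarrow> x \<oplus>\<^bsub>M\<^esub> y \<in> U" "\<lbrakk>x \<in> U; r \<in> carrier R\<rbrakk> \<Longrightarrow> x \<triangleleft>\<^bsub>M\<^esub> r \<in> U"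
  using assms by (auto simp: is_submodule_def)

text \<open>Negation is the action of \<open>-1\<close>.\<close>

lemma is_submodule_minus:
  assumes "right_module R M" "is_submodule R M U" "x \<in> U"
  shows "\<ominus>\<^bsub>M\<^esub> x \<in> U"
proof -
  interpret right_module R M by fact
  note U = is_submoduleD[OF assms(2)]
  show ?thesis using U(5)[OF assms(3), of "\<ominus>\<^bsub>R\<^esub> \<one>\<^bsub>R\<^esub>"] U(2)[OF assms(3)] by (simp add: ract_minus_one)
qed

lemma right_module_submodule:
  assumes "right_module R M" "is_submodule R M U"
  shows "right_module R (M\<lparr>carrier := U\<rparr>)"
proof -
  interpret right_module R M by fact
  note U = is_submoduleD[OF assms(2)]
  show ?thesis
  proof (rule right_moduleI)
    show "ring R" by (rule R.ring_axioms)
    show "abelian_group (M\<lparr>carrier := U\<rparr>)"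
    proof (rule abelian_groupI)
      fix x assume "x \<in> carrier (M\<lparr>carrier := U\<rparr>)"
      then have x: "x \<in> U" by simp
      show "\<exists>y\<in>carrier (M\<lparr>carrier := U\<rparr>). y \<oplus>\<^bsub>M\<lparr>carrier := U\<rparr>\<^esub> x = \<zero>\<^bsub>M\<lparr>carrier := U\<rparr>\<^esub>"
        using is_submodule_minus[OF assms x] U(2)[OF x] by (auto simp: M.l_neg intro!: bexI[of _ "\<ominus>\<^bsub>M\<^esub> x"])
    qed (use U in \<open>auto simp: M.a_ac\<close>)
  qed (use U in \<open>auto simp: ract_add_left ract_add_right ract_mult ract_one\<close>)
qed

lemma lin_maps_inclusion:
  assumes "is_submodule R M U"
  shows "(\<lambda>x\<in>U. x) \<in> lin_maps R (M\<lparr>carrier := U\<rparr>) M"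
  using is_submoduleD[OF assms] by (intro lin_mapsI) auto

lemma lin_maps_restrict:
  assumes "is_submodule R M U" "f \<in> lin_maps R M N"
  shows "restrict f U \<in> lin_maps R (M\<lparr>carrier := U\<rparr>) N"
  using is_submoduleD[OF assms(1)] lin_mapsD[OF assms(2)] by (intro lin_mapsI) auto

lemma lin_maps_corestrict:
  assumes "f \<in> lin_maps R M N" "\<And>x. x \<in> carrier M \<Longrightarrow> f x \<in> U"
  shows "f \<in> lin_maps R M (N\<lparr>carrier := U\<rparr>)"
  using lin_mapsD[OF assms(1)] assms(2) by (intro lin_mapsI) auto

lemma is_submodule_trans:
  assumes "is_submodule R M U" "is_submodule R M V" "V \<subseteq> U"
  shows "is_submodule R (M\<lparr>carrier := U\<rparr>) V"
  using assms by (auto simp: is_submodule_def)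

lemma is_submodule_kernel:
  assumes "right_module R M" "right_module R N" "f \<in> lin_maps R M N"
  shows "is_submodule R M {x \<in> carrier M. f x = \<zero>\<^bsub>N\<^esub>}"
proof -
  interpret M: right_module R M by fact
  interpret N: right_module R N by fact
  show ?thesis
    using lin_mapsD[OF assms(3)] lin_maps_zero[OF assms]
    by (auto simp: is_submodule_def M.ract_closed N.zero_ract)
qed

lemma is_submodule_image:
  assumes "right_module R M" "right_module R N" "f \<in> lin_maps R M N"
  shows "is_submodule R N (f ` carrier M)"
proof -
  interpret M: right_module R M by fact
  interpret N: right_module R N by fact
  show ?thesis
    using lin_mapsD[OF assms(3)] lin_maps_zero[OF assms]
    by (auto simp: is_submodule_def M.ract_closed image_iff
        simp flip: lin_mapsD(3,4)[OF assms(3)] intro: bexI[of _ "\<zero>\<^bsub>M\<^esub>"] M.M.a_closed)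
qed

lemma is_submodule_insert:
  assumes "right_module R M" "is_submodule R M U" "x \<in> carrier M"
  shows "is_submodule R M {u \<oplus>\<^bsub>M\<^esub> x \<triangleleft>\<^bsub>M\<^esub> r | u r. u \<in> U \<and> r \<in> carrier R}" (is "is_submodule R M ?V")
    and "U \<subseteq> {u \<oplus>\<^bsub>M\<^esub> x \<triangleleft>\<^bsub>M\<^esub> r | u r. u \<in> U \<and> r \<in> carrier R}"
    and "x \<in> {u \<oplus>\<^bsub>M\<^esub> x \<triangleleft>\<^bsub>M\<^esub> r | u r. u \<in> U \<and> r \<in> carrier R}"
proof -
  interpret right_module R M by fact
  note U = is_submoduleD[OF assms(2)]
  have VI: "u \<oplus>\<^bsub>M\<^esub> x \<triangleleft>\<^bsub>M\<^esub> r \<in> ?V" if "u \<in> U" "r \<in> carrier R" for u r using that by blast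
  show UV: "U \<subseteq> ?V"
  proof
    fix u assume u: "u \<in> U"
    then show "u \<in> ?V" using VI[OF u R.zero_closed] U(2)[OF u] assms(3) by (simp add: ract_zero)
  qed
  show "x \<in> ?V" using VI[OF U(3) R.one_closed] assms(3) by (simp add: ract_one)
  show "is_submodule R M ?V"
    unfolding is_submodule_def
  proof (intro conjI ballI)
    show "?V \<subseteq> carrier M" using U(2) assms(3) ract_closed by auto
    show "\<zero>\<^bsub>M\<^esub> \<in> ?V" using UV U(3) by blast
  next
    fix y z assume "y \<in> ?V" "z \<in> ?V"
    then obtain u r v s where u: "u \<in> U" "r \<in> carrier R" "y = u \<oplus>\<^bsub>M\<^esub> x \<triangleleft>\<^bsub>M\<^esub> r"
      and v: "v \<in> U" "s \<in> carrier R" "z = v \<oplus>\<^bsub>M\<^esub> x \<triangleleft>\<^bsub>M\<^esub> s" by blast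
    have "y \<oplus>\<^bsub>M\<^esub> z = (u \<oplus>\<^bsub>M\<^esub> v) \<oplus>\<^bsub>M\<^esub> x \<triangleleft>\<^bsub>M\<^esub> (r \<oplus>\<^bsub>R\<^esub> s)"
      using u v U(2) assms(3) by (simp add: ract_add_right ract_closed M.a_ac)
    then show "y \<oplus>\<^bsub>M\<^esub> z \<in> ?V" using VI[of "u \<oplus>\<^bsub>M\<^esub> v" "r \<oplus>\<^bsub>R\<^esub> s"] u v U(4) by simp
  next
    fix y t assume "y \<in> ?V" and t: "t \<in> carrier R"
    then obtain u r where u: "u \<in> U" "r \<in> carrier R" "y = u \<oplus>\<^bsub>M\<^esub> x \<triangleleft>\<^bsub>M\<^esub> r" by blast
    have "y \<triangleleft>\<^bsub>M\<^esub> t = u \<triangleleft>\<^bsub>M\<^esub> t \<oplus>\<^bsub>M\<^esub> x \<triangleleft>\<^bsub>M\<^esub> (r \<otimes>\<^bsub>R\<^esub> t)"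
      using u t U(2) assms(3) by (simp add: ract_add_left ract_closed ract_mult)
    then show "y \<triangleleft>\<^bsub>M\<^esub> t \<in> ?V" using VI[of "u \<triangleleft>\<^bsub>M\<^esub> t" "r \<otimes>\<^bsub>R\<^esub> t"] u t U(5) by simp
  qed
qed

text \<open>Adjoining one generator at a time and passing to unions of chains reaches all of \<open>M\<close>.  In
  the second step the union is indexed by its own elements, so that the index set is as small as
  the module.\<close>

lemma submodule_induct:
  assumes M: "right_module R M"
    and zero: "Q {\<zero>\<^bsub>M\<^esub>}"
    and insert: "\<And>U x. \<lbrakk>is_submodule R M U; Q U; x \<in> carrier M\<rbrakk>
      \<Longrightarrow> Q {u \<oplus>\<^bsub>M\<^esub> x \<triangleleft>\<^bsub>M\<^esub> r | u r. u \<in> U \<and> r \<in> carrier R}"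
    and union: "\<And>U W. \<lbrakk>is_submodule R M U; \<And>x. x \<in> U \<Longrightarrow> is_submodule R M (W x);
        \<And>x. x \<in> U \<Longrightarrow> Q (W x); \<And>x. x \<in> U \<Longrightarrow> x \<in> W x \<and> W x \<subseteq> U;
        \<And>x y. \<lbrakk>x \<in> U; y \<in> U\<rbrakk> \<Longrightarrow> W x \<subseteq> W y \<or> W y \<subseteq> W x\<rbrakk> \<Longrightarrow> Q U"
  shows "Q (carrier M)"
proof -
  interpret right_module R M by fact
  define \<Q> where "\<Q> = {U. is_submodule R M U \<and> Q U}"
  have "is_submodule R M {\<zero>\<^bsub>M\<^esub>}" by (auto simp: is_submodule_def zero_ract)
  then have "{\<zero>\<^bsub>M\<^esub>} \<in> \<Q>" using zero by (simp add: \<Q>_def)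
  moreover have "\<Union>\<C> \<in> \<Q>" if "\<C> \<noteq> {}" and chain: "subset.chain \<Q> \<C>" for \<C>
  proof -
    have sub: "is_submodule R M U" "Q U" if "U \<in> \<C>" for U
      using that chain by (auto simp: \<Q>_def subset.chain_def)
    have lin: "U \<subseteq> V \<or> V \<subseteq> U" if "U \<in> \<C>" "V \<in> \<C>" for U V
      using that chain unfolding subset.chain_def by blast
    have "is_submodule R M (\<Union>\<C>)"
      unfolding is_submodule_def
    proof (intro conjI ballI)
      show "\<zero>\<^bsub>M\<^esub> \<in> \<Union>\<C>" using that(1) is_submoduleD(3)[OF sub(1)] by blast
      fix x y assume "x \<in> \<Union>\<C>" "y \<in> \<Union>\<C>"
      then obtain U where "U \<in> \<C>" "x \<in> U" "y \<in> U" using lin by blast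
      then show "x \<oplus>\<^bsub>M\<^esub> y \<in> \<Union>\<C>" using is_submoduleD(4)[OF sub(1)] by blast
    qed (use is_submoduleD(1,5)[OF sub(1)] in blast)+
    moreover have "\<forall>x\<in>\<Union>\<C>. \<exists>W. W \<in> \<C> \<and> x \<in> W" by blast
    then obtain W where W: "\<And>x. x \<in> \<Union>\<C> \<Longrightarrow> W x \<in> \<C> \<and> x \<in> W x" by metis
    have "Q (\<Union>\<C>)"
    proof (rule union[of _ W])
      show "is_submodule R M (\<Union>\<C>)" by fact
      show "W x \<subseteq> W y \<or> W y \<subseteq> W x" if "x \<in> \<Union>\<C>" "y \<in> \<Union>\<C>" for x y
        using lin W that by blast
    qed (use W sub in blast)+
    ultimately show ?thesis by (simp add: \<Q>_def)
  qed
  ultimately obtain U where U: "U \<in> \<Q>" and max: "\<And>V. V \<in> \<Q> \<Longrightarrow> U \<subseteq> V \<Longrightarrow> V = U"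
    using subset_Zorn_nonempty[of \<Q>] by blast
  have sub: "is_submodule R M U" "Q U" using U by (auto simp: \<Q>_def)
  have "x \<in> U" if x: "x \<in> carrier M" for x
    using max[of "{u \<oplus>\<^bsub>M\<^esub> x \<triangleleft>\<^bsub>M\<^esub> r | u r. u \<in> U \<and> r \<in> carrier R}"]
      is_submodule_insert[OF M sub(1) x] insert[OF sub x] unfolding \<Q>_def by blast
  then have "U = carrier M" using is_submoduleD(1)[OF sub(1)] by blast
  then show ?thesis using sub by simp
qed

subsection \<open>Quotients and small copies\<close>

text \<open>The image of a module under a map whose fibres form a congruence.  Injective maps give copies
  of the module on another type; maps that choose representatives of cosets give quotients.\<close>

definition image_module :: "('m \<Rightarrow> 'n) \<Rightarrow> ('m, 'r) rmodule \<Rightarrow> ('n, 'r) rmodule" where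
  "image_module j M = \<lparr>carrier = j ` carrier M, mult = undefined, one = undefined, zero = j \<zero>\<^bsub>M\<^esub>,
     add = (\<lambda>x y. j (inv_into (carrier M) j x \<oplus>\<^bsub>M\<^esub> inv_into (carrier M) j y)),
     ract = (\<lambda>x r. j (inv_into (carrier M) j x \<triangleleft>\<^bsub>M\<^esub> r))\<rparr>"

lemma image_module:
  assumes M: "right_module R M"
    and add: "\<And>x x' y y'. \<lbrakk>x \<in> carrier M; x' \<in> carrier M; y \<in> carrier M; y' \<in> carrier M;
        j x = j x'; j y = j y'\<rbrakk> \<Longrightarrow> j (x \<oplus>\<^bsub>M\<^esub> y) = j (x' \<oplus>\<^bsub>M\<^esub> y')"
    and ract: "\<And>x x' r. \<lbrakk>x \<in> carrier M; x' \<in> carrier M; r \<in> carrier R; j x = j x'\<rbrakk>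
        \<Longrightarrow> j (x \<triangleleft>\<^bsub>M\<^esub> r) = j (x' \<triangleleft>\<^bsub>M\<^esub> r)"
  shows "right_module R (image_module j M)" and "restrict j (carrier M) \<in> lin_maps R M (image_module j M)"
proof -
  interpret right_module R M by fact
  have inv: "inv_into (carrier M) j (j x) \<in> carrier M" "j (inv_into (carrier M) j (j x)) = j x"
    if "x \<in> carrier M" for x
    using that by (auto intro: inv_into_into f_inv_into_f)
  have car [simp]: "carrier (image_module j M) = j ` carrier M"
    and zero [simp]: "\<zero>\<^bsub>image_module j M\<^esub> = j \<zero>\<^bsub>M\<^esub>"
    by (simp_all add: image_module_def)
  have add_simp [simp]: "j x \<oplus>\<^bsub>image_module j M\<^esub> j y = j (x \<oplus>\<^bsub>M\<^esub> y)"
    if "x \<in> carrier M" "y \<in> carrier M" for x y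
    unfolding image_module_def using that inv by (auto intro!: add)
  have ract_simp [simp]: "j x \<triangleleft>\<^bsub>image_module j M\<^esub> r = j (x \<triangleleft>\<^bsub>M\<^esub> r)"
    if "x \<in> carrier M" "r \<in> carrier R" for x r
    unfolding image_module_def using that inv by (auto intro!: ract)
  show "right_module R (image_module j M)"
  proof (rule right_moduleI)
    show "ring R" by (rule R.ring_axioms)
    show "abelian_group (image_module j M)"
    proof (rule abelian_groupI)
      fix x assume "x \<in> carrier (image_module j M)"
      then obtain x' where "x' \<in> carrier M" "x = j x'" by auto
      then show "\<exists>y\<in>carrier (image_module j M). y \<oplus>\<^bsub>image_module j M\<^esub> x = \<zero>\<^bsub>image_module j M\<^esub>"
        by (auto simp: M.l_neg intro!: bexI[of _ "\<ominus>\<^bsub>M\<^esub> x'"])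
    qed (auto simp: M.a_ac)
  qed (auto simp: ract_closed ract_add_left ract_add_right ract_mult ract_one)
  show "restrict j (carrier M) \<in> lin_maps R M (image_module j M)"
    by (intro lin_mapsI) (auto simp: ract_closed)
qed

lemma ex_copy:
  fixes M :: "('m, 'r) rmodule" and j :: "'m \<Rightarrow> 'n"
  assumes "right_module R M" "inj_on j (carrier M)"
  shows "\<exists>(N :: ('n, 'r) rmodule) q. right_module R N \<and> carrier N = j ` carrier M \<and>
    restrict j (carrier M) \<in> lin_maps R M N \<and> q \<in> lin_maps R N M \<and> (\<forall>x\<in>carrier M. q (j x) = x)"
proof -
  interpret right_module R M by fact
  let ?N = "image_module j M"
  define q where "q = restrict (inv_into (carrier M) j) (j ` carrier M)"
  have N: "right_module R ?N" "restrict j (carrier M) \<in> lin_maps R M ?N"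
    using image_module[OF assms(1), of j] inj_onD[OF assms(2)] by (metis)+
  have car: "carrier ?N = j ` carrier M" by (simp add: image_module_def)
  have q: "q (j x) = x" if "x \<in> carrier M" for x
    using that assms(2) by (simp add: q_def)
  have "q \<in> lin_maps R ?N M"
  proof (rule lin_mapsI)
    show "q \<in> extensional (carrier ?N)" unfolding car q_def by simp
  next
    fix x assume "x \<in> carrier ?N" then show "q x \<in> carrier M" using q car by auto
  next
    fix x y assume "x \<in> carrier ?N" "y \<in> carrier ?N"
    then obtain x' y' where "x' \<in> carrier M" "x = j x'" "y' \<in> carrier M" "y = j y'"
      using car by auto
    then show "q (x \<oplus>\<^bsub>?N\<^esub> y) = q x \<oplus>\<^bsub>M\<^esub> q y"
      using q lin_mapsD(3)[OF N(2), of x' y'] by (metis M.a_closed restrict_apply')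
  next
    fix x r assume "x \<in> carrier ?N" "r \<in> carrier R"
    moreover then obtain x' where "x' \<in> carrier M" "x = j x'" using car by auto
    ultimately show "q (x \<triangleleft>\<^bsub>?N\<^esub> r) = q x \<triangleleft>\<^bsub>M\<^esub> r"
      using q lin_mapsD(4)[OF N(2), of x' r] by (metis ract_closed restrict_apply')
  qed
  then show ?thesis using N car q by blast
qed

text \<open>Cosets are represented by chosen elements of \<open>M\<close>, so that the quotient lives on the same type
  as \<open>M\<close> and is at most as large.\<close>

lemma ex_quotient:
  fixes M :: "('m, 'r) rmodule"
  assumes "right_module R M" "is_submodule R M U"
  shows "\<exists>(N :: ('m, 'r) rmodule) q. right_module R N \<and> carrier N \<subseteq> carrier M \<and>
    q \<in> lin_maps R M N \<and> (\<forall>x\<in>carrier M. q x = \<zero>\<^bsub>N\<^esub> \<longleftrightarrow> x \<in> U)"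
proof -
  interpret right_module R M by fact
  note U = is_submoduleD[OF assms(2)]
  note U_minus = is_submodule_minus[OF assms]
  define j where "j x = (SOME y. y \<in> carrier M \<and> y \<ominus>\<^bsub>M\<^esub> x \<in> U)" for x
  have j: "j x \<in> carrier M" "j x \<ominus>\<^bsub>M\<^esub> x \<in> U" if "x \<in> carrier M" for x
  proof -
    have "x \<in> carrier M \<and> x \<ominus>\<^bsub>M\<^esub> x \<in> U" using that U(3) by (simp add: M.r_neg M.minus_eq)
    from someI[where P="\<lambda>y. y \<in> carrier M \<and> y \<ominus>\<^bsub>M\<^esub> x \<in> U", OF this]
    show "j x \<in> carrier M" "j x \<ominus>\<^bsub>M\<^esub> x \<in> U" unfolding j_def by auto
  qed
  have shift: "z \<ominus>\<^bsub>M\<^esub> y \<in> U" if "z \<ominus>\<^bsub>M\<^esub> x \<in> U" "x \<ominus>\<^bsub>M\<^esub> y \<in> U" "x \<in> carrier M" "y \<in> carrier M" "z \<in> carrier M"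
    for x y z
  proof -
    have "z \<ominus>\<^bsub>M\<^esub> y = (z \<ominus>\<^bsub>M\<^esub> x) \<oplus>\<^bsub>M\<^esub> (x \<ominus>\<^bsub>M\<^esub> y)"
      using that(3-5) by (simp add: M.minus_eq M.a_assoc M.r_neg1)
    then show ?thesis using U(4) that by simp
  qed
  have swap: "y \<ominus>\<^bsub>M\<^esub> x \<in> U" if "x \<ominus>\<^bsub>M\<^esub> y \<in> U" "x \<in> carrier M" "y \<in> carrier M" for x y
  proof -
    have "y \<ominus>\<^bsub>M\<^esub> x = \<ominus>\<^bsub>M\<^esub> (x \<ominus>\<^bsub>M\<^esub> y)"
      using that by (simp add: M.minus_eq M.minus_add M.a_comm)
    then show ?thesis using U_minus that by simp
  qed
  have j_iff: "j x = j y \<longleftrightarrow> x \<ominus>\<^bsub>M\<^esub> y \<in> U" if "x \<in> carrier M" "y \<in> carrier M" for x y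
  proof
    assume "j x = j y"
    then show "x \<ominus>\<^bsub>M\<^esub> y \<in> U"
      using shift[of x "j x" y] swap[of "j x" x] j[of x] j[of y] that by simp
  next
    assume xy: "x \<ominus>\<^bsub>M\<^esub> y \<in> U"
    have "z \<ominus>\<^bsub>M\<^esub> x \<in> U \<longleftrightarrow> z \<ominus>\<^bsub>M\<^esub> y \<in> U" if "z \<in> carrier M" for z
      using shift[of z x y] shift[of z y x] swap[OF xy] xy that \<open>x \<in> carrier M\<close> \<open>y \<in> carrier M\<close>
      by blast
    then show "j x = j y" unfolding j_def by metis
  qed
  have j_add: "j (x \<oplus>\<^bsub>M\<^esub> y) = j (x' \<oplus>\<^bsub>M\<^esub> y')"
    if xs: "x \<in> carrier M" "x' \<in> carrier M" "y \<in> carrier M" "y' \<in> carrier M"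
      "j x = j x'" "j y = j y'" for x x' y y'
  proof -
    have "(x \<oplus>\<^bsub>M\<^esub> y) \<ominus>\<^bsub>M\<^esub> (x' \<oplus>\<^bsub>M\<^esub> y') = (x \<ominus>\<^bsub>M\<^esub> x') \<oplus>\<^bsub>M\<^esub> (y \<ominus>\<^bsub>M\<^esub> y')"
      using xs(1-4) by (simp add: M.minus_eq M.minus_add M.a_ac)
    then show ?thesis using xs j_iff U(4) by simp
  qed
  have j_ract: "j (x \<triangleleft>\<^bsub>M\<^esub> r) = j (x' \<triangleleft>\<^bsub>M\<^esub> r)"
    if "x \<in> carrier M" "x' \<in> carrier M" "r \<in> carrier R" "j x = j x'" for x x' r
    using that j_iff U(5)[of "x \<ominus>\<^bsub>M\<^esub> x'" r] ract_closed by (simp add: minus_ract)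
  note N = image_module[OF assms(1) j_add j_ract]
  have "restrict j (carrier M) x = \<zero>\<^bsub>image_module j M\<^esub> \<longleftrightarrow> x \<in> U" if "x \<in> carrier M" for x
    using j_iff[of x "\<zero>\<^bsub>M\<^esub>"] M.minus_equality[of "\<zero>\<^bsub>M\<^esub>" "\<zero>\<^bsub>M\<^esub>"] that
    by (simp add: image_module_def M.minus_eq)
  moreover have "carrier (image_module j M) \<subseteq> carrier M"
    using j(1) by (auto simp: image_module_def)
  ultimately show ?thesis using N by blast
qed

definition product_module :: "('m, 'r) rmodule \<Rightarrow> ('n, 'r) rmodule \<Rightarrow> ('m \<times> 'n, 'r) rmodule" where
  "product_module M N = \<lparr>carrier = carrier M \<times> carrier N, mult = undefined, one = undefined,
     zero = (\<zero>\<^bsub>M\<^esub>, \<zero>\<^bsub>N\<^esub>), add = (\<lambda>(x, y) (x', y'). (x \<oplus>\<^bsub>M\<^esub> x', y \<oplus>\<^bsub>N\<^esub> y')),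
     ract = (\<lambda>(x, y) r. (x \<triangleleft>\<^bsub>M\<^esub> r, y \<triangleleft>\<^bsub>N\<^esub> r))\<rparr>"

lemma right_module_product:
  assumes "right_module R M" "right_module R N"
  shows "right_module R (product_module M N)"
proof -
  interpret M: right_module R M by fact
  interpret N: right_module R N by fact
  show ?thesis
  proof (rule right_moduleI)
    show "ring R" by (rule M.R.ring_axioms)
    show "abelian_group (product_module M N)"
    proof (rule abelian_groupI)
      fix x assume "x \<in> carrier (product_module M N)"
      then show "\<exists>y\<in>carrier (product_module M N).
          y \<oplus>\<^bsub>product_module M N\<^esub> x = \<zero>\<^bsub>product_module M N\<^esub>"
        by (auto simp: product_module_def M.M.l_neg N.M.l_neg
            intro!: bexI[of _ "\<ominus>\<^bsub>M\<^esub> fst x"] bexI[of _ "\<ominus>\<^bsub>N\<^esub> snd x"])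
    qed (auto simp: product_module_def M.M.a_ac N.M.a_ac)
  qed (auto simp: product_module_def M.ract_closed N.ract_closed M.ract_add_left N.ract_add_left
      M.ract_add_right N.ract_add_right M.ract_mult N.ract_mult M.ract_one N.ract_one)
qed

section \<open>The category of small right modules\<close>

lemma small_subset: "small S \<Longrightarrow> T \<subseteq> S \<Longrightarrow> small T"
  unfolding small_def using card_of_mono1 ordLeq_ordLess_trans by blast

lemma ex_small_injection:
  assumes "|S| <o |UNIV :: 'u set|"
  obtains j :: "'s \<Rightarrow> 'u" where "inj_on j S" "small (j ` S)"
proof -
  have "|S| \<le>o |UNIV :: 'u set|" using assms ordLess_imp_ordLeq by blast
  then obtain j :: "'s \<Rightarrow> 'u" where "inj_on j S" using card_of_ordLeq[of S "UNIV :: 'u set"] by auto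
  moreover have "small (j ` S)"
    unfolding small_def using card_of_image assms ordLeq_ordLess_trans by blast
  ultimately show ?thesis using that by blast
qed

abbreviation arrow_map :: "'x \<times> 'f \<times> 'y \<Rightarrow> 'f" where
  "arrow_map a \<equiv> fst (snd a)"

lemma Ob_Mod [simp]: "M \<in> Ob (Mod_cat R \<gamma>) \<longleftrightarrow> right_module R M \<and> small (carrier M)"
  by (simp add: Mod_cat_def)

lemma Hom_Mod [simp]: "(M', f, N') \<in> Hom (Mod_cat R \<gamma>) M N \<longleftrightarrow> M' = M \<and> N' = N \<and>
    M \<in> Ob (Mod_cat R \<gamma>) \<and> N \<in> Ob (Mod_cat R \<gamma>) \<and> f \<in> lin_maps R M N"
  by (auto simp: Mod_cat_def Hom_def)

lemma Comp_Mod [simp]: "(N', g, P) \<cdot>\<^bsub>Mod_cat R \<gamma>\<^esub> (M, f, N) = (M, compose (carrier M) g f, P)"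
  by (simp add: Mod_cat_def)

lemma Id_Mod [simp]: "Id (Mod_cat R \<gamma>) M = (M, (\<lambda>x\<in>carrier M. x), M)"
  by (simp add: Mod_cat_def)

lemma Dom_Cod_Mod [simp]: "Dom (Mod_cat R \<gamma>) (M, f, N) = M" "Cod (Mod_cat R \<gamma>) (M, f, N) = N"
  by (simp_all add: Mod_cat_def)

lemma zero_arr_Mod [simp]: "zero_arr (Mod_cat R \<gamma>) M N = (M, (\<lambda>x\<in>carrier M. \<zero>\<^bsub>N\<^esub>), N)"
  by (simp add: Mod_cat_def zero_arr_def)

lemma Arr_Mod [simp]: "(M, f, N) \<in> Arr (Mod_cat R \<gamma>) \<longleftrightarrow>
    M \<in> Ob (Mod_cat R \<gamma>) \<and> N \<in> Ob (Mod_cat R \<gamma>) \<and> f \<in> lin_maps R M N"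
  by (auto simp: Mod_cat_def)

lemma HomE_Mod:
  assumes "a \<in> Hom (Mod_cat R \<gamma>) M N"
  obtains f where "a = (M, f, N)" "f \<in> lin_maps R M N"
    "right_module R M" "small (carrier M)" "right_module R N" "small (carrier N)"
  using assms by (cases a) auto

lemma category_Mod: "category (Mod_cat R \<gamma>)"
proof
  fix f assume "f \<in> Arr (Mod_cat R \<gamma>)"
  then show "Dom (Mod_cat R \<gamma>) f \<in> Ob (Mod_cat R \<gamma>) \<and> Cod (Mod_cat R \<gamma>) f \<in> Ob (Mod_cat R \<gamma>)"
    by (cases f) auto
next
  fix M assume "M \<in> Ob (Mod_cat R \<gamma>)"
  then show "Id (Mod_cat R \<gamma>) M \<in> Hom (Mod_cat R \<gamma>) M M"
    by (simp add: right_module.lin_maps_id)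
next
  fix a b M N P assume "a \<in> Hom (Mod_cat R \<gamma>) M N" "b \<in> Hom (Mod_cat R \<gamma>) N P"
  then show "b \<cdot>\<^bsub>Mod_cat R \<gamma>\<^esub> a \<in> Hom (Mod_cat R \<gamma>) M P"
    by (elim HomE_Mod) (auto simp: lin_maps_compose)
next
  fix a M N assume "a \<in> Hom (Mod_cat R \<gamma>) M N"
  then obtain f where f: "a = (M, f, N)" "f \<in> lin_maps R M N" by (rule HomE_Mod)
  have "f \<in> carrier M \<rightarrow> carrier N" "f \<in> extensional (carrier M)" using lin_mapsD[OF f(2)] by auto
  then show "a \<cdot>\<^bsub>Mod_cat R \<gamma>\<^esub> Id (Mod_cat R \<gamma>) M = a" "Id (Mod_cat R \<gamma>) N \<cdot>\<^bsub>Mod_cat R \<gamma>\<^esub> a = a"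
    using f(1) by (simp_all add: Id_compose compose_Id)
next
  fix a b c M N P Q assume "a \<in> Hom (Mod_cat R \<gamma>) M N" "b \<in> Hom (Mod_cat R \<gamma>) N P"
    "c \<in> Hom (Mod_cat R \<gamma>) P Q"
  then obtain f g h where "a = (M, f, N)" "f \<in> lin_maps R M N" "b = (N, g, P)" "c = (P, h, Q)"
    by (elim HomE_Mod)
  moreover then have "f \<in> carrier M \<rightarrow> carrier N" using lin_mapsD[of f] by auto
  ultimately show "(c \<cdot>\<^bsub>Mod_cat R \<gamma>\<^esub> b) \<cdot>\<^bsub>Mod_cat R \<gamma>\<^esub> a = c \<cdot>\<^bsub>Mod_cat R \<gamma>\<^esub> (b \<cdot>\<^bsub>Mod_cat R \<gamma>\<^esub> a)"
    by (simp add: compose_assoc)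
qed

lemma ex_small_copy:
  fixes M :: "('m, 'r) rmodule"
  assumes "right_module R M" "|carrier M| <o |UNIV :: 'u set|"
  shows "\<exists>(N :: ('u, 'r) rmodule) p q. right_module R N \<and> small (carrier N) \<and>
    p \<in> lin_maps R M N \<and> q \<in> lin_maps R N M \<and>
    (\<forall>x\<in>carrier M. q (p x) = x) \<and> (\<forall>y\<in>carrier N. p (q y) = y)"
proof -
  obtain j :: "'m \<Rightarrow> 'u" where j: "inj_on j (carrier M)" "small (j ` carrier M)"
    using ex_small_injection[OF assms(2)] by blast
  obtain N :: "('u, 'r) rmodule" and q where N: "right_module R N" "carrier N = j ` carrier M"
    "restrict j (carrier M) \<in> lin_maps R M N" "q \<in> lin_maps R N M" "\<forall>x\<in>carrier M. q (j x) = x"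
    using ex_copy[OF assms(1) j(1)] by blast
  then show ?thesis using j(2) by (intro exI[of _ N] exI[of _ "restrict j (carrier M)"] exI[of _ q]) auto
qed

text \<open>The product of two small sets is the union of a small family of small sets, hence small by
  regularity of the universe.\<close>

lemma ex_product:
  fixes M N :: "('u, 'r) rmodule"
  assumes inf: "infinite (UNIV :: 'u set)" and reg: "regularCard |UNIV :: 'u set|"
    and M: "right_module R M" "small (carrier M)" and N: "right_module R N" "small (carrier N)"
  shows "\<exists>(P :: ('u, 'r) rmodule) i1 i2 p1 p2. right_module R P \<and> small (carrier P) \<and>
    i1 \<in> lin_maps R M P \<and> i2 \<in> lin_maps R N P \<and> p1 \<in> lin_maps R P M \<and> p2 \<in> lin_maps R P N \<and>
    (\<forall>z\<in>carrier P. i1 (p1 z) \<oplus>\<^bsub>P\<^esub> i2 (p2 z) = z) \<and>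
    (\<forall>x\<in>carrier M. \<forall>y\<in>carrier N. \<exists>z\<in>carrier P. p1 z = x \<and> p2 z = y)"
proof -
  let ?Q = "product_module M N"
  interpret M: right_module R M by fact
  interpret N: right_module R N by fact
  have Q: "right_module R ?Q" using right_module_product M N by blast
  have "stable |UNIV :: 'u set|"
    using regularCard_stable[OF card_of_Card_order _ reg] inf by (simp add: Field_card_of)
  then have "|SIGMA x : carrier M. carrier N| <o |UNIV :: 'u set|"
    using stable_elim[of "|UNIV :: 'u set|" "carrier M" "\<lambda>_. carrier N"] M N by (simp add: small_def)
  then have "|carrier ?Q| <o |UNIV :: 'u set|" by (simp add: product_module_def)
  from ex_small_copy[OF Q this] obtain P :: "('u, 'r) rmodule" and p q where
    *: "right_module R P \<and> small (carrier P) \<and> p \<in> lin_maps R ?Q P \<and> q \<in> lin_maps R P ?Q \<and>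
      (\<forall>x\<in>carrier ?Q. q (p x) = x) \<and> (\<forall>y\<in>carrier P. p (q y) = y)"
    by (elim exE)
  then have P: "right_module R P" "small (carrier P)" "p \<in> lin_maps R ?Q P" "q \<in> lin_maps R P ?Q"
    "\<And>x. x \<in> carrier ?Q \<Longrightarrow> q (p x) = x" "\<And>y. y \<in> carrier P \<Longrightarrow> p (q y) = y"
    by blast+
  have i: "(\<lambda>x\<in>carrier M. (x, \<zero>\<^bsub>N\<^esub>)) \<in> lin_maps R M ?Q" "(\<lambda>y\<in>carrier N. (\<zero>\<^bsub>M\<^esub>, y)) \<in> lin_maps R N ?Q"
    by (auto intro!: lin_mapsI simp: product_module_def M.ract_closed N.ract_closed
        M.zero_ract N.zero_ract)
  have pr: "(\<lambda>z\<in>carrier ?Q. fst z) \<in> lin_maps R ?Q M" "(\<lambda>z\<in>carrier ?Q. snd z) \<in> lin_maps R ?Q N"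
    by (auto intro!: lin_mapsI simp: product_module_def M.ract_closed N.ract_closed)
  show ?thesis
  proof (intro exI conjI ballI)
    show "right_module R P" "small (carrier P)" by fact+
    show "compose (carrier M) p (\<lambda>x\<in>carrier M. (x, \<zero>\<^bsub>N\<^esub>)) \<in> lin_maps R M P"
      "compose (carrier N) p (\<lambda>y\<in>carrier N. (\<zero>\<^bsub>M\<^esub>, y)) \<in> lin_maps R N P"
      "compose (carrier P) (\<lambda>z\<in>carrier ?Q. fst z) q \<in> lin_maps R P M"
      "compose (carrier P) (\<lambda>z\<in>carrier ?Q. snd z) q \<in> lin_maps R P N"
      using lin_maps_compose M(1) N(1) P(1,3,4) i pr by blast+
  next
    fix z assume z: "z \<in> carrier P"
    then obtain x y where xy: "q z = (x, y)" "x \<in> carrier M" "y \<in> carrier N"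
      using lin_mapsD(2)[OF P(4) z] by (auto simp: product_module_def)
    have "p (x, \<zero>\<^bsub>N\<^esub>) \<oplus>\<^bsub>P\<^esub> p (\<zero>\<^bsub>M\<^esub>, y) = p ((x, \<zero>\<^bsub>N\<^esub>) \<oplus>\<^bsub>?Q\<^esub> (\<zero>\<^bsub>M\<^esub>, y))"
      using lin_mapsD(3)[OF P(3), of "(x, \<zero>\<^bsub>N\<^esub>)" "(\<zero>\<^bsub>M\<^esub>, y)"] xy by (simp add: product_module_def)
    also have "\<dots> = p (q z)" using xy by (simp add: product_module_def)
    finally show "compose (carrier M) p (\<lambda>x\<in>carrier M. (x, \<zero>\<^bsub>N\<^esub>))
        (compose (carrier P) (\<lambda>z\<in>carrier ?Q. fst z) q z) \<oplus>\<^bsub>P\<^esub>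
      compose (carrier N) p (\<lambda>y\<in>carrier N. (\<zero>\<^bsub>M\<^esub>, y))
        (compose (carrier P) (\<lambda>z\<in>carrier ?Q. snd z) q z) = z"
      using xy z P(6)[OF z] by (simp add: product_module_def)
  next
    fix x y assume "x \<in> carrier M" "y \<in> carrier N"
    then have "(x, y) \<in> carrier ?Q" by (simp add: product_module_def)
    then show "\<exists>z\<in>carrier P. compose (carrier P) (\<lambda>z\<in>carrier ?Q. fst z) q z = x \<and>
        compose (carrier P) (\<lambda>z\<in>carrier ?Q. snd z) q z = y"
      using P(5) lin_mapsD(2)[OF P(3)] by (intro bexI[of _ "p (x, y)"]) auto
  qed
qed

subsection \<open>Right exact sequences of modules\<close>

lemma Mod_zero_object:
  assumes "right_module R M" "small (carrier M)"
  shows "is_zero_object (Mod_cat R \<gamma>) (M\<lparr>carrier := {\<zero>\<^bsub>M\<^esub>}\<rparr>)" (is "is_zero_object ?C ?Z")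
proof -
  interpret M: right_module R M by fact
  have "is_submodule R M {\<zero>\<^bsub>M\<^esub>}" by (auto simp: is_submodule_def M.zero_ract)
  then have Z: "right_module R ?Z" using right_module_submodule assms(1) by blast
  have sm: "small (carrier ?Z)" using small_subset[OF assms(2)] by simp
  show ?thesis
    unfolding is_zero_object_def
  proof (intro conjI ballI)
    show "?Z \<in> Ob ?C" using Z sm by simp
    fix X assume "X \<in> Ob ?C"
    then have X: "right_module R X" "small (carrier X)" by simp_all
    show "\<exists>!f. f \<in> Hom ?C ?Z X"
    proof (rule ex1I)
      show "(?Z, \<lambda>x\<in>carrier ?Z. \<zero>\<^bsub>X\<^esub>, X) \<in> Hom ?C ?Z X"
        using X Z sm right_module_lin_maps_ops(1)[OF Z X(1)] by simp
      fix f assume "f \<in> Hom ?C ?Z X"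
      then obtain h where h: "f = (?Z, h, X)" "h \<in> lin_maps R ?Z X" by (rule HomE_Mod)
      have "h = (\<lambda>x\<in>carrier ?Z. \<zero>\<^bsub>X\<^esub>)"
        using lin_maps_zero[OF Z X(1) h(2)] h(2) right_module_lin_maps_ops(1)[OF Z X(1)]
        by (intro lin_maps_eqI) auto
      then show "f = (?Z, \<lambda>x\<in>carrier ?Z. \<zero>\<^bsub>X\<^esub>, X)" using h by simp
    qed
    show "\<exists>!f. f \<in> Hom ?C X ?Z"
    proof (rule ex1I)
      show "(X, \<lambda>x\<in>carrier X. \<zero>\<^bsub>?Z\<^esub>, ?Z) \<in> Hom ?C X ?Z"
        using X Z sm right_module_lin_maps_ops(1)[OF X(1) Z] by simp
      fix f assume "f \<in> Hom ?C X ?Z"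
      then obtain h where h: "f = (X, h, ?Z)" "h \<in> lin_maps R X ?Z" by (rule HomE_Mod)
      have "h = (\<lambda>x\<in>carrier X. \<zero>\<^bsub>?Z\<^esub>)"
        using lin_mapsD(2)[OF h(2)] h(2) right_module_lin_maps_ops(1)[OF X(1) Z]
        by (intro lin_maps_eqI) auto
      then show "f = (X, \<lambda>x\<in>carrier X. \<zero>\<^bsub>?Z\<^esub>, ?Z)" using h by simp
    qed
  qed
qed

lemma lin_maps_factor_surj:
  assumes M: "right_module R M" and N: "right_module R N" and P: "right_module R P"
    and s: "s \<in> lin_maps R M N" "s ` carrier M = carrier N"
    and t: "t \<in> lin_maps R M P" "\<And>x. \<lbrakk>x \<in> carrier M; s x = \<zero>\<^bsub>N\<^esub>\<rbrakk> \<Longrightarrow> t x = \<zero>\<^bsub>P\<^esub>"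
  shows "\<exists>u\<in>lin_maps R N P. \<forall>x\<in>carrier M. u (s x) = t x"
proof -
  interpret M: right_module R M by fact
  interpret N: right_module R N by fact
  interpret P: right_module R P by fact
  note s_simps = lin_mapsD[OF s(1)] and t_simps = lin_mapsD[OF t(1)]
  define u where "u = (\<lambda>y\<in>carrier N. t (inv_into (carrier M) s y))"
  have u: "u (s x) = t x" if x: "x \<in> carrier M" for x
  proof -
    let ?x' = "inv_into (carrier M) s (s x)"
    have x': "?x' \<in> carrier M" "s ?x' = s x"
      using x by (auto intro: inv_into_into f_inv_into_f)
    have "s (?x' \<ominus>\<^bsub>M\<^esub> x) = \<zero>\<^bsub>N\<^esub>"
      using lin_maps_minus[OF M N s(1) x'(1) x] x' s_simps(2)[OF x] by (simp add: N.M.r_neg N.M.minus_eq)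
    then have "t ?x' \<ominus>\<^bsub>P\<^esub> t x = \<zero>\<^bsub>P\<^esub>"
      using t(2)[of "?x' \<ominus>\<^bsub>M\<^esub> x"] lin_maps_minus[OF M P t(1) x'(1) x] x' x by simp
    moreover have "t ?x' = (t ?x' \<ominus>\<^bsub>P\<^esub> t x) \<oplus>\<^bsub>P\<^esub> t x"
      using t_simps(2) x x' by (simp add: P.M.minus_eq P.M.a_assoc P.M.l_neg)
    ultimately have "t ?x' = t x" using t_simps(2) x by simp
    then show ?thesis using s_simps(2)[OF x] by (simp add: u_def)
  qed
  have "u \<in> lin_maps R N P"
  proof (rule lin_mapsI)
    show "u \<in> extensional (carrier N)" by (simp add: u_def)
  next
    fix y assume "y \<in> carrier N"
    then obtain x where "x \<in> carrier M" "y = s x" using s(2) by blast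
    then show "u y \<in> carrier P" using u t_simps(2) by simp
  next
    fix y y' assume "y \<in> carrier N" "y' \<in> carrier N"
    then obtain x x' where "x \<in> carrier M" "y = s x" "x' \<in> carrier M" "y' = s x'"
      using s(2) by blast
    then show "u (y \<oplus>\<^bsub>N\<^esub> y') = u y \<oplus>\<^bsub>P\<^esub> u y'"
      using u t_simps(3) by (simp flip: s_simps(3))
  next
    fix y r assume "y \<in> carrier N" and r: "r \<in> carrier R"
    then obtain x where "x \<in> carrier M" "y = s x" using s(2) by blast
    then show "u (y \<triangleleft>\<^bsub>N\<^esub> r) = u y \<triangleleft>\<^bsub>P\<^esub> r"
      using u t_simps(4) r M.ract_closed by (simp flip: s_simps(4))
  qed
  then show ?thesis using u by blast
qed

lemma Mod_is_cokernelI: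
  assumes X: "right_module R X" "small (carrier X)" and Y: "right_module R Y" "small (carrier Y)"
    and Z: "right_module R Z" "small (carrier Z)"
    and f: "f \<in> lin_maps R X Y" and g: "g \<in> lin_maps R Y Z" and surj: "g ` carrier Y = carrier Z"
    and exact: "\<And>y. y \<in> carrier Y \<Longrightarrow> g y = \<zero>\<^bsub>Z\<^esub> \<longleftrightarrow> y \<in> f ` carrier X"
  shows "is_cokernel (Mod_cat R \<gamma>) (X, f, Y) (Y, g, Z)" (is "is_cokernel ?C ?f ?g")
  unfolding is_cokernel_def
proof (intro conjI ballI impI)
  show "?g \<cdot>\<^bsub>?C\<^esub> ?f = zero_arr ?C (Dom ?C ?f) (Cod ?C ?g)"
    using exact lin_mapsD(2)[OF f] by (auto simp: compose_def fun_eq_iff)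
  fix h assume h: "h \<in> Arr ?C" "Dom ?C h = Cod ?C ?f \<and> h \<cdot>\<^bsub>?C\<^esub> ?f = zero_arr ?C (Dom ?C ?f) (Cod ?C h)"
  then obtain W t where t: "h = (Y, t, W)" "t \<in> lin_maps R Y W" "right_module R W" "small (carrier W)"
    by (cases h) auto
  have "t (f x) = \<zero>\<^bsub>W\<^esub>" if "x \<in> carrier X" for x
    using h t that by (auto simp: compose_def fun_eq_iff dest: spec[of _ x])
  then have "t y = \<zero>\<^bsub>W\<^esub>" if "y \<in> carrier Y" "g y = \<zero>\<^bsub>Z\<^esub>" for y
    using exact that by auto
  then obtain u where u: "u \<in> lin_maps R Z W" "\<And>y. y \<in> carrier Y \<Longrightarrow> u (g y) = t y"
    using lin_maps_factor_surj[OF Y(1) Z(1) t(3) g surj t(2)] by blast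
  show "\<exists>!u. u \<in> Hom ?C (Cod ?C ?g) (Cod ?C h) \<and> u \<cdot>\<^bsub>?C\<^esub> ?g = h"
  proof (rule ex1I)
    have "compose (carrier Y) u g = t"
      using u(2) lin_mapsD(1)[OF t(2)] by (auto simp: compose_def fun_eq_iff extensional_def)
    then show "(Z, u, W) \<in> Hom ?C (Cod ?C ?g) (Cod ?C h) \<and> (Z, u, W) \<cdot>\<^bsub>?C\<^esub> ?g = h"
      using t u Z by simp
    fix w assume w: "w \<in> Hom ?C (Cod ?C ?g) (Cod ?C h) \<and> w \<cdot>\<^bsub>?C\<^esub> ?g = h"
    then obtain v where v: "w = (Z, v, W)" "v \<in> lin_maps R Z W"
      using t(1) by (auto elim: HomE_Mod)
    have "compose (carrier Y) v g = t" using w v t(1) by simp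
    then have "v (g y) = t y" if "y \<in> carrier Y" for y using that by (auto simp: compose_def)
    then have "v z = u z" if "z \<in> carrier Z" for z
      using that u(2) unfolding surj[symmetric] by auto
    then show "w = (Z, u, W)" using v lin_maps_eqI[OF v(2) u(1)] by simp
  qed
qed (use X Y Z f g in simp_all)

lemma Mod_is_kernel_inclusion:
  assumes X: "right_module R X" "small (carrier X)" and Y: "right_module R Y" "small (carrier Y)"
    and f: "f \<in> lin_maps R X Y" and K: "K = {x \<in> carrier X. f x = \<zero>\<^bsub>Y\<^esub>}"
  shows "is_kernel (Mod_cat R \<gamma>) (X, f, Y) (X\<lparr>carrier := K\<rparr>, \<lambda>x\<in>K. x, X)"
    (is "is_kernel ?C ?f (?K, ?k, X)")
  unfolding is_kernel_def
proof (intro conjI ballI impI)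
  have sub: "is_submodule R X K" unfolding K by (rule is_submodule_kernel[OF X(1) Y(1) f])
  have K_Mod: "right_module R ?K" "small (carrier ?K)"
    using right_module_submodule[OF X(1) sub] small_subset[OF X(2) is_submoduleD(1)[OF sub]] by simp_all
  show "?f \<in> Arr ?C" using X Y f by simp
  show "(?K, ?k, X) \<in> Arr ?C" using K_Mod X lin_maps_inclusion[OF sub] by simp
  show "?f \<cdot>\<^bsub>?C\<^esub> (?K, ?k, X) = zero_arr ?C (Dom ?C (?K, ?k, X)) (Cod ?C ?f)"
    by (auto simp: K compose_def fun_eq_iff)
  fix h assume h: "h \<in> Arr ?C" "Cod ?C h = Dom ?C ?f \<and> ?f \<cdot>\<^bsub>?C\<^esub> h = zero_arr ?C (Dom ?C h) (Cod ?C ?f)"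
  then obtain W t where t: "h = (W, t, X)" "t \<in> lin_maps R W X" "W \<in> Ob ?C"
    by (cases h) auto
  have "f (t w) = \<zero>\<^bsub>Y\<^esub>" if "w \<in> carrier W" for w
    using h t that by (auto simp: compose_def fun_eq_iff dest: spec[of _ w])
  then have tK: "\<And>w. w \<in> carrier W \<Longrightarrow> t w \<in> K" using lin_mapsD(2)[OF t(2)] by (simp add: K)
  then have tK': "t \<in> lin_maps R W ?K" by (rule lin_maps_corestrict[OF t(2)])
  show "\<exists>!u. u \<in> Hom ?C (Dom ?C h) (Dom ?C (?K, ?k, X)) \<and> (?K, ?k, X) \<cdot>\<^bsub>?C\<^esub> u = h"
  proof (rule ex1I)
    have "compose (carrier W) ?k t = t"
      using tK lin_mapsD(1)[OF t(2)] by (auto simp: compose_def fun_eq_iff extensional_def)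
    then show "(W, t, ?K) \<in> Hom ?C (Dom ?C h) (Dom ?C (?K, ?k, X)) \<and> (?K, ?k, X) \<cdot>\<^bsub>?C\<^esub> (W, t, ?K) = h"
      using t tK' K_Mod by simp
    fix u assume u: "u \<in> Hom ?C (Dom ?C h) (Dom ?C (?K, ?k, X)) \<and> (?K, ?k, X) \<cdot>\<^bsub>?C\<^esub> u = h"
    then obtain v where v: "u = (W, v, ?K)" "v \<in> lin_maps R W ?K"
      using t(1) by (auto elim: HomE_Mod)
    have "compose (carrier W) ?k v = t" using u v t(1) by simp
    then have "v w = t w" if "w \<in> carrier W" for w
      using lin_mapsD(2)[OF v(2) that] that by (auto simp: compose_def)
    then show "u = (W, t, ?K)" using v lin_maps_eqI[OF v(2) tK'] by simp
  qed
qed simp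

text \<open>A surjection is a cokernel of the inclusion of its kernel.  Exactness at its target expresses that
  the zero map to the zero module is its cokernel.\<close>

lemma Mod_right_exact_seq_kernel:
  assumes M: "right_module R M" "small (carrier M)" and N: "right_module R N" "small (carrier N)"
    and s: "s \<in> lin_maps R M N" "s ` carrier M = carrier N"
    and K: "K = {x \<in> carrier M. s x = \<zero>\<^bsub>N\<^esub>}"
  shows "right_exact_seq (Mod_cat R \<gamma>) (M\<lparr>carrier := K\<rparr>, \<lambda>x\<in>K. x, M) (M, s, N)"
    (is "right_exact_seq ?C (?K, ?k, M) ?s")
proof -
  let ?O = "N\<lparr>carrier := {\<zero>\<^bsub>N\<^esub>}\<rparr>"
  have ker: "is_kernel ?C ?s (?K, ?k, M)" by (rule Mod_is_kernel_inclusion[OF M N s(1) K])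
  then have "(?K, ?k, M) \<in> Arr ?C" unfolding is_kernel_def by blast
  then have K_Mod: "right_module R ?K" "small (carrier ?K)" and k: "?k \<in> lin_maps R ?K M"
    by simp_all
  have coker: "is_cokernel ?C (?K, ?k, M) ?s"
    by (rule Mod_is_cokernelI[OF K_Mod M N k s]) (simp add: K)
  have O: "is_zero_object ?C ?O" by (rule Mod_zero_object[OF N])
  then have O_Mod: "right_module R ?O" "small (carrier ?O)" by (simp_all add: is_zero_object_def)
  let ?z = "\<lambda>x\<in>carrier N. \<zero>\<^bsub>?O\<^esub>"
  have z: "?z \<in> lin_maps R N ?O" by (rule right_module_lin_maps_ops(1)[OF N(1) O_Mod(1)])
  have "\<zero>\<^bsub>N\<^esub> \<in> carrier N" using is_submoduleD(3)[OF is_submodule_image[OF M(1) N(1) s(1)]] s(2) by simp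
  then have coker0: "is_cokernel ?C ?s (N, ?z, ?O)"
    by (intro Mod_is_cokernelI[OF M N O_Mod s(1) z]) (auto simp: s(2))
  have "is_kernel ?C (N, ?z, ?O) (N\<lparr>carrier := carrier N\<rparr>, \<lambda>x\<in>carrier N. x, N)"
    by (rule Mod_is_kernel_inclusion[OF N O_Mod z]) simp
  then have ker0: "is_kernel ?C (N, ?z, ?O) (Id ?C N)" by simp
  have "exact ?C (?K, ?k, M) ?s"
    unfolding exact_def
  proof (intro conjI exI)
    show "is_cokernel ?C (?K, ?k, M) ?s" "is_kernel ?C ?s (?K, ?k, M)" "is_kernel ?C ?s (?K, ?k, M)"
      by fact+
  qed (use K_Mod M N k s in simp_all)
  moreover have "exact ?C ?s (N, ?z, ?O)"
    unfolding exact_def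
  proof (intro conjI exI)
    show "is_cokernel ?C ?s (N, ?z, ?O)" "is_kernel ?C (N, ?z, ?O) (Id ?C N)"
      "is_kernel ?C (N, ?z, ?O) (Id ?C N)" by fact+
  qed (use M N s O_Mod z in simp_all)
  ultimately show ?thesis
    using O unfolding right_exact_seq_def Dom_Cod_Mod zero_arr_Mod by blast
qed

lemma right_exact_seqE:
  assumes "right_exact_seq C f g"
  obtains c i O' c' i' where "f \<in> Arr C" "g \<in> Arr C" "is_cokernel C f c" "is_kernel C c i"
    "is_kernel C g i" "is_cokernel C g c'" "is_kernel C c' i'"
    "is_kernel C (zero_arr C (Cod C g) O') i'"
proof -
  obtain O' where e: "exact C f g" "exact C g (zero_arr C (Cod C g) O')"
    using assms unfolding right_exact_seq_def by (elim conjE exE)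
  show ?thesis using e unfolding exact_def by (elim conjE exE) (rule that)
qed

lemma Comp_Mod_eq_iff:
  assumes "h \<in> extensional (carrier M)"
  shows "(N', g, P) \<cdot>\<^bsub>Mod_cat R \<gamma>\<^esub> (M, f, N) = (M, h, P) \<longleftrightarrow> (\<forall>x\<in>carrier M. g (f x) = h x)"
  using assms by (auto simp: compose_def fun_eq_iff extensional_def)

lemma Comp_Mod_eq_zero_iff:
  "(N', g, P) \<cdot>\<^bsub>Mod_cat R \<gamma>\<^esub> (M, f, N) = zero_arr (Mod_cat R \<gamma>) M P \<longleftrightarrow>
    (\<forall>x\<in>carrier M. g (f x) = \<zero>\<^bsub>P\<^esub>)"
  by (auto simp: compose_def fun_eq_iff)

lemma ex_small_quotient:
  fixes M :: "('u, 'r) rmodule"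
  assumes "right_module R M" "small (carrier M)" "is_submodule R M U"
  obtains Q :: "('u, 'r) rmodule" and q where "right_module R Q" "small (carrier Q)"
    "q \<in> lin_maps R M Q" "\<forall>x\<in>carrier M. q x = \<zero>\<^bsub>Q\<^esub> \<longleftrightarrow> x \<in> U"
proof -
  from ex_quotient[OF assms(1,3)] obtain Q q where
    "right_module R Q \<and> carrier Q \<subseteq> carrier M \<and> q \<in> lin_maps R M Q \<and>
      (\<forall>x\<in>carrier M. q x = \<zero>\<^bsub>Q\<^esub> \<longleftrightarrow> x \<in> U)" by (elim exE)
  then show ?thesis using that[of Q q] small_subset[OF assms(2)] by simp
qed

text \<open>Cokernels in the category are compared with quotient modules, which are again small.\<close>

lemma Mod_right_exact_seqD:
  fixes X Y Z :: "('u, 'r) rmodule"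
  assumes "right_exact_seq (Mod_cat R \<gamma>) (X, f, Y) (Y, g, Z)" (is "right_exact_seq ?C ?f ?g")
  shows "g ` carrier Y = carrier Z"
    and "\<And>x. x \<in> carrier X \<Longrightarrow> g (f x) = \<zero>\<^bsub>Z\<^esub>"
    and "\<And>y. \<lbrakk>y \<in> carrier Y; g y = \<zero>\<^bsub>Z\<^esub>\<rbrakk> \<Longrightarrow> y \<in> f ` carrier X"
proof -
  from assms obtain c i O' c' i' where f_Arr: "?f \<in> Arr ?C" and g_Arr: "?g \<in> Arr ?C"
    and c: "is_cokernel ?C ?f c" and ci: "is_kernel ?C c i" and gi: "is_kernel ?C ?g i"
    and c': "is_cokernel ?C ?g c'" and ci': "is_kernel ?C c' i'"
    and zi'': "is_kernel ?C (zero_arr ?C (Cod ?C ?g) O') i'"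
    by (rule right_exact_seqE)
  note zi' = zi''[unfolded Dom_Cod_Mod]
  have X: "right_module R X" "small (carrier X)" and Y: "right_module R Y" "small (carrier Y)"
    and Z: "right_module R Z" "small (carrier Z)"
    and f: "f \<in> lin_maps R X Y" and g: "g \<in> lin_maps R Y Z"
    using f_Arr g_Arr by simp_all
  interpret Z: right_module R Z by fact
  interpret Y: right_module R Y by fact
  show surj: "g ` carrier Y = carrier Z"
  proof -
    obtain V d where d: "c' = (Z, d, V)" "d \<in> lin_maps R Z V"
      using c' by (cases c') (auto simp: is_cokernel_def)
    obtain W j where j: "i' = (W, j, Z)" "j \<in> lin_maps R W Z"
      using ci' d by (cases i') (auto simp: is_kernel_def)
    have "Id ?C Z \<in> Hom ?C Z (Dom ?C (zero_arr ?C Z O'))" using Z Z.lin_maps_id by simp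
    moreover have "zero_arr ?C Z O' \<cdot>\<^bsub>?C\<^esub> Id ?C Z = zero_arr ?C Z (Cod ?C (zero_arr ?C Z O'))"
      by (simp add: compose_def cong: restrict_cong)
    ultimately obtain u where u: "u \<in> Hom ?C Z (Dom ?C i')" "i' \<cdot>\<^bsub>?C\<^esub> u = Id ?C Z"
      using is_kernel_factor[OF zi'] by blast
    from u(1) obtain v where v: "u = (Z, v, W)" "v \<in> lin_maps R Z W"
      unfolding j Dom_Cod_Mod by (rule HomE_Mod)
    have jv: "j (v z) = z" if "z \<in> carrier Z" for z
      using u(2) that unfolding j v Id_Mod by (subst (asm) Comp_Mod_eq_iff) auto
    have "c' \<cdot>\<^bsub>?C\<^esub> i' = zero_arr ?C W V" using ci' unfolding j d is_kernel_def by simp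
    then have "d (j w) = \<zero>\<^bsub>V\<^esub>" if "w \<in> carrier W" for w
      using that unfolding d j Comp_Mod_eq_zero_iff by blast
    then have d0: "d z = \<zero>\<^bsub>V\<^esub>" if "z \<in> carrier Z" for z
      using jv[OF that] lin_mapsD(2)[OF v(2) that] by metis
    have im: "is_submodule R Z (g ` carrier Y)" by (rule is_submodule_image[OF Y(1) Z(1) g])
    obtain Q :: "('u, 'r) rmodule" and q where Q: "right_module R Q" "small (carrier Q)" and q: "q \<in> lin_maps R Z Q"
      and q0: "\<forall>z\<in>carrier Z. q z = \<zero>\<^bsub>Q\<^esub> \<longleftrightarrow> z \<in> g ` carrier Y"
      by (rule ex_small_quotient[OF Z im])
    have "(Z, q, Q) \<in> Hom ?C (Cod ?C ?g) Q" using Z Q q by simp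
    moreover have "(Z, q, Q) \<cdot>\<^bsub>?C\<^esub> ?g = zero_arr ?C (Dom ?C ?g) Q"
      unfolding Dom_Cod_Mod Comp_Mod_eq_zero_iff using q0 lin_mapsD(2)[OF g] by auto
    ultimately obtain w where w: "w \<in> Hom ?C (Cod ?C c') Q" "w \<cdot>\<^bsub>?C\<^esub> c' = (Z, q, Q)"
      using is_cokernel_factor[OF c'] by blast
    from w(1) obtain t where t: "w = (V, t, Q)" "t \<in> lin_maps R V Q" "right_module R V"
      unfolding d Dom_Cod_Mod by (rule HomE_Mod)
    have "q z = \<zero>\<^bsub>Q\<^esub>" if "z \<in> carrier Z" for z
    proof -
      have "t (d z) = q z" using w(2) that lin_mapsD(1)[OF q]
        unfolding d t by (subst (asm) Comp_Mod_eq_iff) auto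
      then show ?thesis using d0[OF that] lin_maps_zero[OF t(3) Q(1) t(2)] by simp
    qed
    then show ?thesis using q0 lin_mapsD(2)[OF g] by blast
  qed
  obtain V d where d: "c = (Y, d, V)" "d \<in> lin_maps R Y V" "right_module R V"
    using c by (cases c) (auto simp: is_cokernel_def)
  obtain W j where j: "i = (W, j, Y)" "j \<in> lin_maps R W Y"
    using ci d by (cases i) (auto simp: is_kernel_def)
  have gj: "g (j w) = \<zero>\<^bsub>Z\<^esub>" and dj: "d (j w) = \<zero>\<^bsub>V\<^esub>" if "w \<in> carrier W" for w
  proof -
    have "?g \<cdot>\<^bsub>?C\<^esub> i = zero_arr ?C W Z" using gi unfolding j is_kernel_def by simp
    then show "g (j w) = \<zero>\<^bsub>Z\<^esub>" using that unfolding j Comp_Mod_eq_zero_iff by blast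
    have "c \<cdot>\<^bsub>?C\<^esub> i = zero_arr ?C W V" using ci unfolding j d is_kernel_def by simp
    then show "d (j w) = \<zero>\<^bsub>V\<^esub>" using that unfolding j d Comp_Mod_eq_zero_iff by blast
  qed
  show "g (f x) = \<zero>\<^bsub>Z\<^esub>" if "x \<in> carrier X" for x
  proof -
    have "?f \<in> Hom ?C X (Dom ?C c)" using X Y f by (simp add: d)
    moreover have "c \<cdot>\<^bsub>?C\<^esub> ?f = zero_arr ?C X (Cod ?C c)"
      using c unfolding is_cokernel_def by simp
    ultimately obtain u where u: "u \<in> Hom ?C X (Dom ?C i)" "i \<cdot>\<^bsub>?C\<^esub> u = ?f"
      using is_kernel_factor[OF ci] by blast
    from u(1) obtain v where v: "u = (X, v, W)" "v \<in> lin_maps R X W"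
      unfolding j Dom_Cod_Mod by (rule HomE_Mod)
    have "j (v x) = f x"
      using u(2) that lin_mapsD(1)[OF f] unfolding j v by (subst (asm) Comp_Mod_eq_iff) auto
    then show ?thesis using gj[of "v x"] lin_mapsD(2)[OF v(2) that] by simp
  qed
  show "y \<in> f ` carrier X" if y: "y \<in> carrier Y" "g y = \<zero>\<^bsub>Z\<^esub>" for y
  proof -
    define K where "K = {y \<in> carrier Y. g y = \<zero>\<^bsub>Z\<^esub>}"
    have K: "is_submodule R Y K" unfolding K_def by (rule is_submodule_kernel[OF Y(1) Z(1) g])
    let ?K = "Y\<lparr>carrier := K\<rparr>"
    have K_Mod: "right_module R ?K" "small (carrier ?K)"
      using right_module_submodule[OF Y(1) K] small_subset[OF Y(2)] K_def by auto
    have "(?K, \<lambda>y\<in>K. y, Y) \<in> Hom ?C ?K (Dom ?C ?g)"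
      using K_Mod Y lin_maps_inclusion[OF K] by simp
    moreover have "?g \<cdot>\<^bsub>?C\<^esub> (?K, \<lambda>y\<in>K. y, Y) = zero_arr ?C ?K (Cod ?C ?g)"
      unfolding Dom_Cod_Mod Comp_Mod_eq_zero_iff by (simp add: K_def)
    ultimately obtain u where u: "u \<in> Hom ?C ?K (Dom ?C i)" "i \<cdot>\<^bsub>?C\<^esub> u = (?K, \<lambda>y\<in>K. y, Y)"
      using is_kernel_factor[OF gi] by blast
    from u(1) obtain v where v: "u = (?K, v, W)" "v \<in> lin_maps R ?K W"
      unfolding j Dom_Cod_Mod by (rule HomE_Mod)
    have "j (v y) = y"
      using u(2) y unfolding j v by (subst (asm) Comp_Mod_eq_iff) (auto simp: K_def)
    moreover have "v y \<in> carrier W" using lin_mapsD(2)[OF v(2), of y] y by (simp add: K_def)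
    ultimately have dy: "d y = \<zero>\<^bsub>V\<^esub>" using dj[of "v y"] by simp
    have im: "is_submodule R Y (f ` carrier X)" by (rule is_submodule_image[OF X(1) Y(1) f])
    obtain Q :: "('u, 'r) rmodule" and q where Q: "right_module R Q" "small (carrier Q)" and q: "q \<in> lin_maps R Y Q"
      and q0: "\<forall>y\<in>carrier Y. q y = \<zero>\<^bsub>Q\<^esub> \<longleftrightarrow> y \<in> f ` carrier X"
      by (rule ex_small_quotient[OF Y im])
    have "(Y, q, Q) \<in> Hom ?C (Cod ?C ?f) Q" using Y Q q by simp
    moreover have "(Y, q, Q) \<cdot>\<^bsub>?C\<^esub> ?f = zero_arr ?C (Dom ?C ?f) Q"
      unfolding Dom_Cod_Mod Comp_Mod_eq_zero_iff using q0 lin_mapsD(2)[OF f] by auto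
    ultimately obtain w where w: "w \<in> Hom ?C (Cod ?C c) Q" "w \<cdot>\<^bsub>?C\<^esub> c = (Y, q, Q)"
      using is_cokernel_factor[OF c] by blast
    from w(1) obtain t where t: "w = (V, t, Q)" "t \<in> lin_maps R V Q"
      unfolding d Dom_Cod_Mod by (rule HomE_Mod)
    have "t (d y) = q y" using w(2) y(1) lin_mapsD(1)[OF q]
      unfolding d t by (subst (asm) Comp_Mod_eq_iff) auto
    then have "q y = \<zero>\<^bsub>Q\<^esub>" using dy lin_maps_zero[OF d(3) Q(1) t(2)] by simp
    then show ?thesis using q0 y by blast
  qed
qed

subsection \<open>Direct limits of modules\<close>

lemma directed_setD:
  assumes "directed_set I ord"
  shows "I \<noteq> {}" "(i, j) \<in> ord \<Longrightarrow> i \<in> I \<and> j \<in> I"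
    and "i \<in> I \<Longrightarrow> j \<in> I \<Longrightarrow> \<exists>l\<in>I. (i, l) \<in> ord \<and> (j, l) \<in> ord"
  using assms by (auto simp: directed_set_def preorder_on_def)

text \<open>The images of a directed family of compatible linear maps form a directed union.\<close>

lemma is_submodule_directed_images:
  fixes m :: "'i \<Rightarrow> 'm \<Rightarrow> 'h"
  assumes H: "right_module R H" and dir: "directed_set I ord"
    and X: "\<And>i. i \<in> I \<Longrightarrow> right_module R (X i)"
    and m: "\<And>i. i \<in> I \<Longrightarrow> m i \<in> lin_maps R (X i) H"
    and compat: "\<And>i j x. \<lbrakk>(i, j) \<in> ord; x \<in> carrier (X i)\<rbrakk>
      \<Longrightarrow> \<exists>x'\<in>carrier (X j). m j x' = m i x"
  shows "is_submodule R H (\<Union>i\<in>I. m i ` carrier (X i))"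
proof -
  have sub: "is_submodule R H (m i ` carrier (X i))" if "i \<in> I" for i
    using is_submodule_image[OF X H m] that by blast
  obtain i0 where "i0 \<in> I" using directed_setD(1)[OF dir] by blast
  show ?thesis
    unfolding is_submodule_def
  proof (intro conjI ballI)
    show "(\<Union>i\<in>I. m i ` carrier (X i)) \<subseteq> carrier H"
      using is_submoduleD(1)[OF sub] by (rule UN_least)
    fix y r assume y: "y \<in> (\<Union>i\<in>I. m i ` carrier (X i))" and r: "r \<in> carrier R"
    from y obtain i where i: "i \<in> I" "y \<in> m i ` carrier (X i)" by (rule UN_E)
    show "y \<triangleleft>\<^bsub>H\<^esub> r \<in> (\<Union>i\<in>I. m i ` carrier (X i))"
      using i(1) is_submoduleD(5)[OF sub[OF i(1)] i(2) r] by (rule UN_I)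
  next
    show "\<zero>\<^bsub>H\<^esub> \<in> (\<Union>i\<in>I. m i ` carrier (X i))"
      using is_submoduleD(3)[OF sub[OF \<open>i0 \<in> I\<close>]] \<open>i0 \<in> I\<close> by blast
    fix y z assume "y \<in> (\<Union>i\<in>I. m i ` carrier (X i))" "z \<in> (\<Union>i\<in>I. m i ` carrier (X i))"
    then obtain i x j x' where x: "i \<in> I" "x \<in> carrier (X i)" "y = m i x"
      "j \<in> I" "x' \<in> carrier (X j)" "z = m j x'" by blast
    obtain l where l: "l \<in> I" "(i, l) \<in> ord" "(j, l) \<in> ord"
      using directed_setD(3)[OF dir x(1,4)] by blast
    have "y \<in> m l ` carrier (X l)" "z \<in> m l ` carrier (X l)"
      using compat[OF l(2) x(2)] compat[OF l(3) x(5)] x by (auto simp: image_iff) metis+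
    then have "y \<oplus>\<^bsub>H\<^esub> z \<in> m l ` carrier (X l)" using is_submoduleD(4)[OF sub[OF l(1)]] by blast
    with l(1) show "y \<oplus>\<^bsub>H\<^esub> z \<in> (\<Union>i\<in>I. m i ` carrier (X i))" by (rule UN_I)
  qed
qed

text \<open>Direct limits of modules are given here by their universal property among small modules.  The two
  facts \<open>ex_preimage\<close> and \<open>ex_factor\<close> below describe them by elements and give the existence of
  factorisations through them for targets of any size.\<close>

locale Mod_direct_limit =
  fixes R :: "('r, 's) ring_scheme" and \<gamma> :: "'k \<Rightarrow> 'r" and I :: "'u set" and ord
    and X :: "'u \<Rightarrow> ('u, 'r) rmodule" and \<phi> and L and \<mu>
  assumes system: "direct_system (Mod_cat R \<gamma>) I ord X \<phi>"
    and limit: "is_direct_limit (Mod_cat R \<gamma>) I ord X \<phi> L \<mu>"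
begin

lemma directed: "directed_set I ord"
  using system by (simp add: direct_system_def)

lemma X_Mod: "i \<in> I \<Longrightarrow> right_module R (X i)" "i \<in> I \<Longrightarrow> small (carrier (X i))"
  using system unfolding direct_system_def Ob_Mod by blast+

lemma L_Mod: "right_module R L" "small (carrier L)"
  using limit unfolding is_direct_limit_def is_cocone_def Ob_Mod by blast+

lemma \<mu>: "i \<in> I \<Longrightarrow> \<mu> i = (X i, arrow_map (\<mu> i), L)"
    "i \<in> I \<Longrightarrow> arrow_map (\<mu> i) \<in> lin_maps R (X i) L"
proof -
  assume "i \<in> I"
  then have "\<mu> i \<in> Hom (Mod_cat R \<gamma>) (X i) L"
    using limit unfolding is_direct_limit_def is_cocone_def by blast
  then obtain f where "\<mu> i = (X i, f, L)" "f \<in> lin_maps R (X i) L" by (rule HomE_Mod)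
  then show "\<mu> i = (X i, arrow_map (\<mu> i), L)" "arrow_map (\<mu> i) \<in> lin_maps R (X i) L" by simp_all
qed

lemma \<phi>: "(i, j) \<in> ord \<Longrightarrow> \<phi> i j = (X i, arrow_map (\<phi> i j), X j)"
    "(i, j) \<in> ord \<Longrightarrow> arrow_map (\<phi> i j) \<in> lin_maps R (X i) (X j)"
proof -
  assume "(i, j) \<in> ord"
  then have "\<phi> i j \<in> Hom (Mod_cat R \<gamma>) (X i) (X j)"
    using system unfolding direct_system_def Ob_Mod by blast
  then obtain f where "\<phi> i j = (X i, f, X j)" "f \<in> lin_maps R (X i) (X j)" by (rule HomE_Mod)
  then show "\<phi> i j = (X i, arrow_map (\<phi> i j), X j)" "arrow_map (\<phi> i j) \<in> lin_maps R (X i) (X j)"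
    by simp_all
qed

lemma \<mu>_\<phi>: "\<lbrakk>(i, j) \<in> ord; x \<in> carrier (X i)\<rbrakk>
    \<Longrightarrow> arrow_map (\<mu> j) (arrow_map (\<phi> i j) x) = arrow_map (\<mu> i) x"
proof -
  assume ij: "(i, j) \<in> ord" and x: "x \<in> carrier (X i)"
  then have I: "i \<in> I" "j \<in> I" using directed_setD(2)[OF directed] by blast+
  have "\<mu> j \<cdot>\<^bsub>Mod_cat R \<gamma>\<^esub> \<phi> i j = \<mu> i"
    using limit ij unfolding is_direct_limit_def is_cocone_def by blast
  then have "arrow_map ((X j, arrow_map (\<mu> j), L) \<cdot>\<^bsub>Mod_cat R \<gamma>\<^esub> (X i, arrow_map (\<phi> i j), X j))
      = arrow_map (\<mu> i)"
    using \<mu>(1)[OF I(2)] \<phi>(1)[OF ij] by metis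
  then show ?thesis using x by (simp add: compose_def fun_eq_iff) metis
qed

text \<open>Both the projection of \<open>L\<close> to its quotient by the union of the images and the zero map
  restrict to zero on every \<open>X i\<close>.\<close>

lemma ex_preimage:
  assumes y: "y \<in> carrier L"
  shows "\<exists>i\<in>I. \<exists>x\<in>carrier (X i). arrow_map (\<mu> i) x = y"
proof -
  let ?C = "Mod_cat R \<gamma>"
  let ?U = "\<Union>i\<in>I. arrow_map (\<mu> i) ` carrier (X i)"
  have "is_submodule R L ?U"
  proof (rule is_submodule_directed_images[OF L_Mod(1) directed X_Mod(1) \<mu>(2)])
    fix i j x assume "(i, j) \<in> ord" "x \<in> carrier (X i)"
    then show "\<exists>x'\<in>carrier (X j). arrow_map (\<mu> j) x' = arrow_map (\<mu> i) x"
      using \<mu>_\<phi> lin_mapsD(2)[OF \<phi>(2)] by blast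
  qed
  then obtain Q :: "('u, 'r) rmodule" and q where Q: "right_module R Q" "small (carrier Q)" and q: "q \<in> lin_maps R L Q"
      and q0: "\<forall>z\<in>carrier L. q z = \<zero>\<^bsub>Q\<^esub> \<longleftrightarrow> z \<in> ?U"
    by (rule ex_small_quotient[OF L_Mod])
  let ?\<nu> = "\<lambda>i. zero_arr ?C (X i) Q"
  have zero: "(\<lambda>x\<in>carrier (X i). \<zero>\<^bsub>Q\<^esub>) \<in> lin_maps R (X i) Q" if "i \<in> I" for i
    using right_module_lin_maps_ops(1)[OF X_Mod(1)[OF that] Q(1)] .
  have "is_cocone ?C I ord X \<phi> Q ?\<nu>"
    unfolding is_cocone_def
  proof (intro conjI allI impI ballI)
    show "Q \<in> Ob ?C" using Q by simp
    show "?\<nu> i \<in> Hom ?C (X i) Q" if "i \<in> I" for i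
      using that zero X_Mod Q by simp
    show "?\<nu> j \<cdot>\<^bsub>?C\<^esub> \<phi> i j = ?\<nu> i" if ij: "(i, j) \<in> ord" for i j
      by (subst \<phi>(1)[OF ij]) (use lin_mapsD(2)[OF \<phi>(2)[OF ij]] in
        \<open>auto simp: compose_def fun_eq_iff\<close>)
  qed
  then have ex1: "\<exists>!h. h \<in> Hom ?C L Q \<and> (\<forall>i\<in>I. h \<cdot>\<^bsub>?C\<^esub> \<mu> i = ?\<nu> i)"
    using limit unfolding is_direct_limit_def by blast
  have "(L, q, Q) \<cdot>\<^bsub>?C\<^esub> \<mu> i = ?\<nu> i" if "i \<in> I" for i
    by (subst \<mu>(1)[OF that]) (use q0 lin_mapsD(2)[OF \<mu>(2)[OF that]] that in
        \<open>auto simp: Comp_Mod_eq_zero_iff simp del: zero_arr_Mod Comp_Mod\<close>)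
  moreover have "zero_arr ?C L Q \<cdot>\<^bsub>?C\<^esub> \<mu> i = ?\<nu> i" if "i \<in> I" for i
    by (subst \<mu>(1)[OF that]) (use lin_mapsD(2)[OF \<mu>(2)[OF that]] in
        \<open>auto simp: compose_def fun_eq_iff\<close>)
  moreover have "(L, q, Q) \<in> Hom ?C L Q" "zero_arr ?C L Q \<in> Hom ?C L Q"
    using L_Mod Q q right_module_lin_maps_ops(1)[OF L_Mod(1) Q(1)] by simp_all
  ultimately have "(L, q, Q) = zero_arr ?C L Q" using ex1 by blast
  then have "q y = \<zero>\<^bsub>Q\<^esub>" using y by simp
  then show ?thesis using bspec[OF q0 y] by blast
qed

text \<open>The module \<open>H\<close> need not be small, but the union of the images of a small family of small
  modules is, so the universal property applies to a small copy of it.\<close>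

lemma ex_factor:
  fixes H :: "('h, 'r) rmodule"
  assumes inf: "infinite (UNIV :: 'u set)" and reg: "regularCard |UNIV :: 'u set|"
    and I: "small I" and H: "right_module R H"
    and \<nu>: "\<And>i. i \<in> I \<Longrightarrow> \<nu> i \<in> lin_maps R (X i) H"
    and compat: "\<And>i j x. \<lbrakk>(i, j) \<in> ord; x \<in> carrier (X i)\<rbrakk>
      \<Longrightarrow> \<nu> j (arrow_map (\<phi> i j) x) = \<nu> i x"
  shows "\<exists>g\<in>lin_maps R L H. \<forall>i\<in>I. \<forall>x\<in>carrier (X i). g (arrow_map (\<mu> i) x) = \<nu> i x"
proof -
  let ?C = "Mod_cat R \<gamma>"
  let ?U = "\<Union>i\<in>I. \<nu> i ` carrier (X i)"
  have U: "is_submodule R H ?U"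
  proof (rule is_submodule_directed_images[OF H directed X_Mod(1) \<nu>])
    fix i j x assume "(i, j) \<in> ord" "x \<in> carrier (X i)"
    then show "\<exists>x'\<in>carrier (X j). \<nu> j x' = \<nu> i x"
      using compat lin_mapsD(2)[OF \<phi>(2)] by blast
  qed
  let ?H = "H\<lparr>carrier := ?U\<rparr>"
  have H': "right_module R ?H" by (rule right_module_submodule[OF H U])
  have "|\<nu> i ` carrier (X i)| <o |UNIV :: 'u set|" if "i \<in> I" for i
    using X_Mod(2)[OF that] card_of_image ordLeq_ordLess_trans unfolding small_def by blast
  then have "|?U| <o |UNIV :: 'u set|"
    using card_of_UNION_ordLess_infinite_Field_regularCard[OF reg, of I "\<lambda>i. \<nu> i ` carrier (X i)"]
      inf I by (simp add: small_def cinfinite_def Field_card_of card_of_card_order_on)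
  then have "|carrier ?H| <o |UNIV :: 'u set|" by simp
  from ex_small_copy[OF H' this] obtain N :: "('u, 'r) rmodule" and p q where
    *: "right_module R N \<and> small (carrier N) \<and> p \<in> lin_maps R ?H N \<and> q \<in> lin_maps R N ?H \<and>
      (\<forall>x\<in>carrier ?H. q (p x) = x) \<and> (\<forall>y\<in>carrier N. p (q y) = y)"
    by (elim exE)
  then have N: "right_module R N" "small (carrier N)" "p \<in> lin_maps R ?H N" "q \<in> lin_maps R N ?H"
    "\<And>x. x \<in> ?U \<Longrightarrow> q (p x) = x" by auto
  define \<nu>' where "\<nu>' i = compose (carrier (X i)) p (\<nu> i)" for i
  have \<nu>': "\<nu>' i \<in> lin_maps R (X i) N" if "i \<in> I" for i
    unfolding \<nu>'_def
  proof (rule lin_maps_compose[OF X_Mod(1)[OF that] _ N(3)])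
    show "\<nu> i \<in> lin_maps R (X i) ?H" using \<nu>[OF that] that by (intro lin_maps_corestrict) auto
  qed
  have "is_cocone ?C I ord X \<phi> N (\<lambda>i. (X i, \<nu>' i, N))"
    unfolding is_cocone_def
  proof (intro conjI allI impI ballI)
    show "N \<in> Ob ?C" using N by simp
    show "(X i, \<nu>' i, N) \<in> Hom ?C (X i) N" if "i \<in> I" for i
      using that \<nu>' X_Mod N by simp
    show "(X j, \<nu>' j, N) \<cdot>\<^bsub>?C\<^esub> \<phi> i j = (X i, \<nu>' i, N)" if ij: "(i, j) \<in> ord" for i j
    proof -
      have "i \<in> I" using directed_setD(2)[OF directed] ij by blast
      have "(X j, \<nu>' j, N) \<cdot>\<^bsub>?C\<^esub> (X i, arrow_map (\<phi> i j), X j) = (X i, \<nu>' i, N)"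
      proof (subst Comp_Mod_eq_iff)
        show "\<forall>x\<in>carrier (X i). \<nu>' j (arrow_map (\<phi> i j) x) = \<nu>' i x"
          using compat[OF ij] lin_mapsD(2)[OF \<phi>(2)[OF ij]] by (simp add: \<nu>'_def)
      qed (use lin_mapsD(1)[OF \<nu>'[OF \<open>i \<in> I\<close>]] in simp)
      then show ?thesis using \<phi>(1)[OF ij] by simp
    qed
  qed
  then obtain h where h: "h \<in> Hom ?C L N" "\<And>i. i \<in> I \<Longrightarrow> h \<cdot>\<^bsub>?C\<^esub> \<mu> i = (X i, \<nu>' i, N)"
    using limit unfolding is_direct_limit_def by blast
  from h(1) obtain t where t: "h = (L, t, N)" "t \<in> lin_maps R L N" by (rule HomE_Mod)
  have t\<mu>: "t (arrow_map (\<mu> i) x) = \<nu>' i x" if "i \<in> I" "x \<in> carrier (X i)" for i x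
  proof -
    have "(L, t, N) \<cdot>\<^bsub>?C\<^esub> (X i, arrow_map (\<mu> i), L) = (X i, \<nu>' i, N)"
      using h(2)[OF that(1)] \<mu>(1)[OF that(1)] t(1) by simp
    then show ?thesis using Comp_Mod_eq_iff[OF lin_mapsD(1)[OF \<nu>'[OF that(1)]]] that(2) by blast
  qed
  have "compose (carrier L) q t \<in> lin_maps R L H"
  proof (rule lin_maps_compose[OF L_Mod(1) t(2)])
    show "q \<in> lin_maps R N H"
      using lin_mapsD[OF N(4)] is_submoduleD(1)[OF U] by (intro lin_mapsI) auto
  qed
  moreover have "compose (carrier L) q t (arrow_map (\<mu> i) x) = \<nu> i x"
    if "i \<in> I" "x \<in> carrier (X i)" for i x
    using that t\<mu>[OF that] N(5)[of "\<nu> i x"] lin_mapsD(2)[OF \<mu>(2)[OF that(1)] that(2)]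
    by (auto simp: \<nu>'_def)
  ultimately show ?thesis by blast
qed

end

text \<open>The members of a chain of submodules with union \<open>U\<close> are indexed by elements of \<open>U\<close>, which makes
  the index set small.  Several elements may index the same submodule, so the order on the indices
  is only a preorder.\<close>

lemma Mod_direct_limit_union:
  fixes M :: "('u, 'r) rmodule" and \<gamma> :: "'k \<Rightarrow> 'r"
  assumes M: "right_module R M" "small (carrier M)" and U: "is_submodule R M U"
    and W: "\<And>x. x \<in> U \<Longrightarrow> is_submodule R M (W x)" "\<And>x. x \<in> U \<Longrightarrow> x \<in> W x \<and> W x \<subseteq> U"
    and chain: "\<And>x y. \<lbrakk>x \<in> U; y \<in> U\<rbrakk> \<Longrightarrow> W x \<subseteq> W y \<or> W y \<subseteq> W x"
  defines "ord \<equiv> {(x, y). x \<in> U \<and> y \<in> U \<and> W x \<subseteq> W y}"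
    and "X \<equiv> \<lambda>x. M\<lparr>carrier := W x\<rparr>"
    and "\<phi> \<equiv> \<lambda>x y. (M\<lparr>carrier := W x\<rparr>, \<lambda>z\<in>W x. z, M\<lparr>carrier := W y\<rparr>)"
    and "\<mu> \<equiv> \<lambda>x. (M\<lparr>carrier := W x\<rparr>, \<lambda>z\<in>W x. z, M\<lparr>carrier := U\<rparr>)"
  shows "Mod_direct_limit R \<gamma> U ord X \<phi> (M\<lparr>carrier := U\<rparr>) \<mu>"
proof -
  let ?C = "Mod_cat R \<gamma>" and ?U = "M\<lparr>carrier := U\<rparr>"
  note U_sub = is_submoduleD[OF U]
  have sub_Mod: "right_module R (M\<lparr>carrier := V\<rparr>)" "small (carrier (M\<lparr>carrier := V\<rparr>))"
    if "is_submodule R M V" for V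
    using right_module_submodule[OF M(1) that] small_subset[OF M(2)] is_submoduleD(1)[OF that]
    by simp_all
  have incl: "(\<lambda>z\<in>V. z) \<in> lin_maps R (M\<lparr>carrier := V\<rparr>) (M\<lparr>carrier := V'\<rparr>)"
    if "is_submodule R M V" "is_submodule R M V'" "V \<subseteq> V'" for V V'
    using lin_maps_corestrict[OF lin_maps_inclusion[OF that(1)], of V'] that by auto
  have "directed_set U ord"
    unfolding directed_set_def
  proof (intro conjI ballI)
    show "U \<noteq> {}" using U_sub(3) by blast
    show "preorder_on U ord" by (auto simp: preorder_on_def ord_def refl_on_def trans_def)
    show "\<exists>l\<in>U. (i, l) \<in> ord \<and> (j, l) \<in> ord" if "i \<in> U" "j \<in> U" for i j
      using chain[OF that] that by (auto simp: ord_def)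
  qed
  then have sys: "direct_system ?C U ord X \<phi>"
    unfolding direct_system_def
  proof (intro conjI ballI allI impI)
    show "X i \<in> Ob ?C" "\<phi> i i = Id ?C (X i)" if "i \<in> U" for i
      using sub_Mod[OF W(1)[OF that]] by (simp_all add: X_def \<phi>_def)
    show "\<phi> i j \<in> Hom ?C (X i) (X j)" if "(i, j) \<in> ord" for i j
      using that sub_Mod[OF W(1)] incl W(1) by (auto simp: X_def \<phi>_def ord_def)
    show "\<phi> j l \<cdot>\<^bsub>?C\<^esub> \<phi> i j = \<phi> i l" if "(i, j) \<in> ord \<and> (j, l) \<in> ord" for i j l
      using that by (auto simp: \<phi>_def ord_def compose_def fun_eq_iff)
  qed
  have cocone: "is_cocone ?C U ord X \<phi> ?U \<mu>"
    unfolding is_cocone_def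
  proof (intro conjI ballI allI impI)
    show "?U \<in> Ob ?C" using sub_Mod[OF U] by simp
    show "\<mu> i \<in> Hom ?C (X i) ?U" if "i \<in> U" for i
      using that sub_Mod[OF W(1)] sub_Mod[OF U] incl W U by (auto simp: X_def \<mu>_def)
    show "\<mu> j \<cdot>\<^bsub>?C\<^esub> \<phi> i j = \<mu> i" if "(i, j) \<in> ord" for i j
      using that by (auto simp: \<phi>_def \<mu>_def ord_def compose_def fun_eq_iff)
  qed
  have univ: "\<exists>!h. h \<in> Hom ?C ?U Y \<and> (\<forall>i\<in>U. h \<cdot>\<^bsub>?C\<^esub> \<mu> i = \<nu> i)"
    if co: "is_cocone ?C U ord X \<phi> Y \<nu>" for Y \<nu>
  proof -
    have Y: "right_module R Y" "small (carrier Y)" using co unfolding is_cocone_def Ob_Mod by blast+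
    have \<nu>: "\<nu> i = (X i, arrow_map (\<nu> i), Y)" "arrow_map (\<nu> i) \<in> lin_maps R (X i) Y"
      if "i \<in> U" for i
    proof -
      have "\<nu> i \<in> Hom ?C (X i) Y" using co that unfolding is_cocone_def by blast
      then obtain f where "\<nu> i = (X i, f, Y)" "f \<in> lin_maps R (X i) Y" by (rule HomE_Mod)
      then show "\<nu> i = (X i, arrow_map (\<nu> i), Y)" "arrow_map (\<nu> i) \<in> lin_maps R (X i) Y" by simp_all
    qed
    have agree: "arrow_map (\<nu> j) z = arrow_map (\<nu> i) z" if ij: "(i, j) \<in> ord" and z: "z \<in> W i" for i j z
    proof -
      have I: "i \<in> U" "j \<in> U" using ij by (auto simp: ord_def)
      have "\<nu> j \<cdot>\<^bsub>?C\<^esub> \<phi> i j = \<nu> i" using co ij unfolding is_cocone_def by blast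
      then have "(X j, arrow_map (\<nu> j), Y) \<cdot>\<^bsub>?C\<^esub> (X i, \<lambda>z\<in>W i. z, X j) = (X i, arrow_map (\<nu> i), Y)"
        using \<nu>(1)[OF I(1)] \<nu>(1)[OF I(2)] by (simp add: \<phi>_def X_def)
      then have "\<forall>x\<in>carrier (X i). arrow_map (\<nu> j) ((\<lambda>z\<in>W i. z) x) = arrow_map (\<nu> i) x"
        using Comp_Mod_eq_iff[OF lin_mapsD(1)[OF \<nu>(2)[OF I(1)]]] by blast
      then show ?thesis using z by (simp add: X_def)
    qed
    define h where "h = (\<lambda>z\<in>U. arrow_map (\<nu> z) z)"
    have h: "h z = arrow_map (\<nu> i) z" if "i \<in> U" "z \<in> W i" for i z
    proof -
      have "z \<in> U" using W(2) that by blast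
      then show ?thesis
        using chain[of z i] agree[of z i z] agree[of i z z] W(2)[of z] that by (auto simp: ord_def h_def)
    qed
    have h_lin: "h \<in> lin_maps R ?U Y"
    proof (rule lin_mapsI)
      show "h \<in> extensional (carrier ?U)" by (simp add: h_def)
      show "h x \<in> carrier Y" if "x \<in> carrier ?U" for x
        using that h[of x x] W(2)[of x] lin_mapsD(2)[OF \<nu>(2)[of x], of x] by (simp add: X_def)
      show "h (x \<oplus>\<^bsub>?U\<^esub> y) = h x \<oplus>\<^bsub>Y\<^esub> h y" if xy: "x \<in> carrier ?U" "y \<in> carrier ?U" for x y
      proof -
        obtain i where i: "i \<in> U" "x \<in> W i" "y \<in> W i"
          using chain[of x y] W(2)[of x] W(2)[of y] xy by auto
        then show ?thesis
          using h is_submoduleD(4)[OF W(1)[OF i(1)]] lin_mapsD(3)[OF \<nu>(2)[OF i(1)], of x y]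
          by (simp add: X_def)
      qed
      show "h (x \<triangleleft>\<^bsub>?U\<^esub> r) = h x \<triangleleft>\<^bsub>Y\<^esub> r" if x: "x \<in> carrier ?U" and r: "r \<in> carrier R" for x r
        using h[of x] is_submoduleD(5)[OF W(1)[of x], of x r] lin_mapsD(4)[OF \<nu>(2)[of x], of x r]
          W(2)[of x] x r by (simp add: X_def)
    qed
    have iff: "(?U, t, Y) \<cdot>\<^bsub>?C\<^esub> \<mu> i = \<nu> i \<longleftrightarrow> (\<forall>z\<in>W i. t z = arrow_map (\<nu> i) z)" if "i \<in> U" for t i
    proof -
      have "(?U, t, Y) \<cdot>\<^bsub>?C\<^esub> \<mu> i = \<nu> i \<longleftrightarrow>
          (?U, t, Y) \<cdot>\<^bsub>?C\<^esub> (X i, \<lambda>z\<in>W i. z, ?U) = (X i, arrow_map (\<nu> i), Y)"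
        using \<nu>(1)[OF that] by (simp add: \<mu>_def X_def)
      then show ?thesis
        using Comp_Mod_eq_iff[OF lin_mapsD(1)[OF \<nu>(2)[OF that]],
            where N' = ?U and g = t and P = Y and R = R and \<gamma> = \<gamma> and f = "\<lambda>z\<in>W i. z" and N = ?U]
        by (simp add: X_def del: Comp_Mod)
    qed
    show ?thesis
    proof (rule ex1I)
      show "(?U, h, Y) \<in> Hom ?C ?U Y \<and> (\<forall>i\<in>U. (?U, h, Y) \<cdot>\<^bsub>?C\<^esub> \<mu> i = \<nu> i)"
        using h_lin sub_Mod[OF U] Y iff h by simp
      fix t assume t: "t \<in> Hom ?C ?U Y \<and> (\<forall>i\<in>U. t \<cdot>\<^bsub>?C\<^esub> \<mu> i = \<nu> i)"
      then obtain t' where t': "t = (?U, t', Y)" "t' \<in> lin_maps R ?U Y" by (auto elim: HomE_Mod)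
      have "t' = h"
      proof (rule lin_maps_eqI[OF t'(2) h_lin])
        fix x assume "x \<in> carrier ?U"
        then show "t' x = h x" using t iff[of x t'] t'(1) h[of x x] W(2)[of x] by simp
      qed
      then show "t = (?U, h, Y)" using t'(1) by simp
    qed
  qed
  show ?thesis
    by (rule Mod_direct_limit.intro) (use sys cocone univ in \<open>auto simp: is_direct_limit_def\<close>)
qed

section \<open>Tensor products as universal arrows\<close>

lemma Ex1_eqI: "\<lbrakk>\<exists>!x. P x; P a; P b\<rbrakk> \<Longrightarrow> a = b"
  by blast


text \<open>The module \<open>B\<close> is a copy of \<open>R\<close> inside the universe: it is free on the generator \<open>b\<close>, and so
  represents the underlying set of a module.\<close>

locale tensor_setting =
  alg: assoc_algebra k R \<gamma> + A: abelian_category k A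
  for k :: "('k, 'l) ring_scheme" and R :: "('r, 's) ring_scheme" and \<gamma> :: "'k \<Rightarrow> 'r"
    and A :: "('o, 'a, 'k) lcategory" +
  fixes B :: "('u, 'r) rmodule" and b :: 'u
  assumes infinite_universe: "infinite (UNIV :: 'u set)"
    and regular_universe: "regularCard |UNIV :: 'u set|"
    and cocomplete: "cocomplete TYPE('u) A"
    and B_Mod: "right_module R B" "small (carrier B)"
    and b_closed: "b \<in> carrier B"
    and b_free: "bij_betw (\<lambda>r. b \<triangleleft>\<^bsub>B\<^esub> r) (carrier R) (carrier B)"
begin

abbreviation Mod :: "(('u, 'r) rmodule, ('u, 'r) rmod_arr, 'k) lcategory" where
  "Mod \<equiv> Mod_cat R \<gamma>"

abbreviation comp_A :: "'a \<Rightarrow> 'a \<Rightarrow> 'a" (infixr "\<circ>\<^sub>A" 72) where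
  "g \<circ>\<^sub>A f \<equiv> g \<cdot>\<^bsub>A\<^esub> f"

abbreviation lmods :: "('o, 'a, 'r) lmod set" where
  "lmods \<equiv> lmods_in k R \<gamma> A"

lemma lmodsD:
  assumes "F \<in> lmods"
  shows "fst F \<in> Ob A" "snd F \<in> extensional (carrier R)"
    and "r \<in> carrier R \<Longrightarrow> snd F r \<in> Hom A (fst F) (fst F)"
    and "\<lbrakk>r \<in> carrier R; s \<in> carrier R\<rbrakk>
      \<Longrightarrow> snd F (r \<oplus>\<^bsub>R\<^esub> s) = snd F r \<oplus>\<^bsub>HomMod A (fst F) (fst F)\<^esub> snd F s"
    and "\<lbrakk>r \<in> carrier R; s \<in> carrier R\<rbrakk> \<Longrightarrow> snd F (r \<otimes>\<^bsub>R\<^esub> s) = snd F r \<circ>\<^sub>A snd F s"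
    and "snd F \<one>\<^bsub>R\<^esub> = Id A (fst F)"
    and "a \<in> carrier k \<Longrightarrow> snd F (\<gamma> a) = a \<odot>\<^bsub>HomMod A (fst F) (fst F)\<^esub> Id A (fst F)"
  using assms by (auto simp: lmods_in_def ring_hom_def End_ring_def)

lemma Hom_rmodule_simps [simp]:
  "carrier (Hom_rmodule A F N) = Hom A (fst F) N"
  "\<alpha> \<oplus>\<^bsub>Hom_rmodule A F N\<^esub> \<beta> = \<alpha> \<oplus>\<^bsub>HomMod A (fst F) N\<^esub> \<beta>"
  "\<zero>\<^bsub>Hom_rmodule A F N\<^esub> = zero_arr A (fst F) N"
  "\<alpha> \<triangleleft>\<^bsub>Hom_rmodule A F N\<^esub> r = \<alpha> \<circ>\<^sub>A snd F r"
  by (simp_all add: Hom_rmodule_def)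

text \<open>A left action of \<open>R\<close> on \<open>F\<close> becomes a right action on arrows out of \<open>F\<close>.\<close>

lemma right_module_Hom:
  assumes F: "F \<in> lmods" and N: "N \<in> Ob A"
  shows "right_module R (Hom_rmodule A F N)"
proof -
  note F_simps = lmodsD[OF F]
  interpret H: abelian_group "HomMod A (fst F) N" using A.hom_abelian_group F_simps(1) N .
  have car: "carrier (HomMod A (fst F) N) = Hom A (fst F) N"
    using A.HomMod_carrier F_simps(1) N .
  show ?thesis
  proof (rule right_moduleI)
    show "ring R" by (rule alg.R.ring_axioms)
    show "abelian_group (Hom_rmodule A F N)"
    proof (rule abelian_groupI)
      fix \<alpha> assume "\<alpha> \<in> carrier (Hom_rmodule A F N)"
      then have "\<alpha> \<in> carrier (HomMod A (fst F) N)" by (simp add: car)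
      then show "\<exists>\<beta>\<in>carrier (Hom_rmodule A F N).
          \<beta> \<oplus>\<^bsub>Hom_rmodule A F N\<^esub> \<alpha> = \<zero>\<^bsub>Hom_rmodule A F N\<^esub>"
        using H.l_neg[of \<alpha>] H.a_inv_closed[of \<alpha>] car by (auto simp: zero_arr_def)
    qed (use H.a_assoc H.a_comm A.add_zero_arr F_simps(1) N in \<open>simp_all add: car\<close>)
    fix \<alpha> \<beta> r s
    assume "\<alpha> \<in> carrier (Hom_rmodule A F N)"
    then have \<alpha>: "\<alpha> \<in> Hom A (fst F) N" by simp
    show "\<alpha> \<triangleleft>\<^bsub>Hom_rmodule A F N\<^esub> \<one>\<^bsub>R\<^esub> = \<alpha>"
      using A.HomD[OF \<alpha>] by (simp add: F_simps(6))
    assume r: "r \<in> carrier R"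
    show "\<alpha> \<triangleleft>\<^bsub>Hom_rmodule A F N\<^esub> r \<in> carrier (Hom_rmodule A F N)"
      using A.Comp_Hom[OF F_simps(3)[OF r] \<alpha>] by simp
    {
      assume "\<beta> \<in> carrier (Hom_rmodule A F N)"
      then have \<beta>: "\<beta> \<in> Hom A (fst F) N" by simp
      show "(\<alpha> \<oplus>\<^bsub>Hom_rmodule A F N\<^esub> \<beta>) \<triangleleft>\<^bsub>Hom_rmodule A F N\<^esub> r =
          \<alpha> \<triangleleft>\<^bsub>Hom_rmodule A F N\<^esub> r \<oplus>\<^bsub>Hom_rmodule A F N\<^esub> \<beta> \<triangleleft>\<^bsub>Hom_rmodule A F N\<^esub> r"
        using A.Comp_add_left[OF F_simps(3)[OF r] \<alpha> \<beta>] by simp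
    }
    assume s: "s \<in> carrier R"
    show "\<alpha> \<triangleleft>\<^bsub>Hom_rmodule A F N\<^esub> (r \<oplus>\<^bsub>R\<^esub> s) =
        \<alpha> \<triangleleft>\<^bsub>Hom_rmodule A F N\<^esub> r \<oplus>\<^bsub>Hom_rmodule A F N\<^esub> \<alpha> \<triangleleft>\<^bsub>Hom_rmodule A F N\<^esub> s"
      using A.Comp_add_right[OF F_simps(3)[OF r] F_simps(3)[OF s] \<alpha>] by (simp add: F_simps(4)[OF r s])
    show "\<alpha> \<triangleleft>\<^bsub>Hom_rmodule A F N\<^esub> (r \<otimes>\<^bsub>R\<^esub> s) =
        (\<alpha> \<triangleleft>\<^bsub>Hom_rmodule A F N\<^esub> r) \<triangleleft>\<^bsub>Hom_rmodule A F N\<^esub> s"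
      using A.Comp_assoc[OF F_simps(3)[OF s] F_simps(3)[OF r] \<alpha>] by (simp add: F_simps(5)[OF r s])
  qed
qed

lemma Hom_valued_lin_mapsD:
  assumes "g \<in> lin_maps R M (Hom_rmodule A F N)"
  shows "g \<in> extensional (carrier M)" "x \<in> carrier M \<Longrightarrow> g x \<in> Hom A (fst F) N"
    and "\<lbrakk>x \<in> carrier M; y \<in> carrier M\<rbrakk> \<Longrightarrow> g (x \<oplus>\<^bsub>M\<^esub> y) = g x \<oplus>\<^bsub>HomMod A (fst F) N\<^esub> g y"
    and "\<lbrakk>x \<in> carrier M; r \<in> carrier R\<rbrakk> \<Longrightarrow> g (x \<triangleleft>\<^bsub>M\<^esub> r) = g x \<circ>\<^sub>A snd F r"
  using lin_mapsD[OF assms] by simp_all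

lemma Hom_valued_postcomp:
  assumes F: "F \<in> lmods" and M: "right_module R M" and g: "g \<in> lin_maps R M (Hom_rmodule A F N)"
    and h: "h \<in> Hom A N N'"
  shows "(\<lambda>x\<in>carrier M. h \<circ>\<^sub>A g x) \<in> lin_maps R M (Hom_rmodule A F N')"
proof -
  interpret right_module R M by fact
  note g_simps = Hom_valued_lin_mapsD[OF g]
  show ?thesis
  proof (rule lin_mapsI)
    fix x r assume x: "x \<in> carrier M" and r: "r \<in> carrier R"
    show "(\<lambda>x\<in>carrier M. h \<circ>\<^sub>A g x) (x \<triangleleft>\<^bsub>M\<^esub> r) =
        (\<lambda>x\<in>carrier M. h \<circ>\<^sub>A g x) x \<triangleleft>\<^bsub>Hom_rmodule A F N'\<^esub> r"
      using A.Comp_assoc[OF lmodsD(3)[OF F r] g_simps(2)[OF x] h] g_simps(4)[OF x r] x ract_closed[OF x r]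
      by simp
  next
    fix x y assume x: "x \<in> carrier M" and y: "y \<in> carrier M"
    show "(\<lambda>x\<in>carrier M. h \<circ>\<^sub>A g x) (x \<oplus>\<^bsub>M\<^esub> y) =
        (\<lambda>x\<in>carrier M. h \<circ>\<^sub>A g x) x \<oplus>\<^bsub>Hom_rmodule A F N'\<^esub> (\<lambda>x\<in>carrier M. h \<circ>\<^sub>A g x) y"
      using A.Comp_add_right[OF g_simps(2)[OF x] g_simps(2)[OF y] h] g_simps(3)[OF x y] x y by simp
  qed (use A.Comp_Hom[OF g_simps(2) h] in auto)
qed

definition is_lmod_hom :: "('o, 'a, 'r) lmod \<Rightarrow> 'a \<Rightarrow> ('o, 'a, 'r) lmod \<Rightarrow> bool" where
  "is_lmod_hom F \<phi> G \<longleftrightarrow> \<phi> \<in> Hom A (fst F) (fst G) \<and>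
     (\<forall>r\<in>carrier R. snd G r \<circ>\<^sub>A \<phi> = \<phi> \<circ>\<^sub>A snd F r)"

lemma Hom_valued_precomp:
  assumes F: "F \<in> lmods" and G: "G \<in> lmods" and \<phi>: "is_lmod_hom F \<phi> G"
    and M: "right_module R M" and g: "g \<in> lin_maps R M (Hom_rmodule A G N)"
  shows "(\<lambda>x\<in>carrier M. g x \<circ>\<^sub>A \<phi>) \<in> lin_maps R M (Hom_rmodule A F N)"
proof -
  interpret right_module R M by fact
  note g_simps = Hom_valued_lin_mapsD[OF g]
  have \<phi>_Hom: "\<phi> \<in> Hom A (fst F) (fst G)" using \<phi> by (simp add: is_lmod_hom_def)
  show ?thesis
  proof (rule lin_mapsI)
    fix x r assume x: "x \<in> carrier M" and r: "r \<in> carrier R"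
    have "(g x \<circ>\<^sub>A snd G r) \<circ>\<^sub>A \<phi> = g x \<circ>\<^sub>A (snd G r \<circ>\<^sub>A \<phi>)"
      using A.Comp_assoc[OF \<phi>_Hom lmodsD(3)[OF G r] g_simps(2)[OF x]] .
    also have "\<dots> = g x \<circ>\<^sub>A (\<phi> \<circ>\<^sub>A snd F r)"
      using \<phi> r by (simp add: is_lmod_hom_def)
    also have "\<dots> = (g x \<circ>\<^sub>A \<phi>) \<circ>\<^sub>A snd F r"
      using A.Comp_assoc[OF lmodsD(3)[OF F r] \<phi>_Hom g_simps(2)[OF x]] by simp
    finally show "(\<lambda>x\<in>carrier M. g x \<circ>\<^sub>A \<phi>) (x \<triangleleft>\<^bsub>M\<^esub> r) =
        (\<lambda>x\<in>carrier M. g x \<circ>\<^sub>A \<phi>) x \<triangleleft>\<^bsub>Hom_rmodule A F N\<^esub> r"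
      using g_simps(4)[OF x r] x ract_closed[OF x r] by simp
  next
    fix x y assume x: "x \<in> carrier M" and y: "y \<in> carrier M"
    show "(\<lambda>x\<in>carrier M. g x \<circ>\<^sub>A \<phi>) (x \<oplus>\<^bsub>M\<^esub> y) =
        (\<lambda>x\<in>carrier M. g x \<circ>\<^sub>A \<phi>) x \<oplus>\<^bsub>Hom_rmodule A F N\<^esub> (\<lambda>x\<in>carrier M. g x \<circ>\<^sub>A \<phi>) y"
      using A.Comp_add_left[OF \<phi>_Hom g_simps(2)[OF x] g_simps(2)[OF y]] g_simps(3)[OF x y] x y by simp
  qed (use A.Comp_Hom[OF \<phi>_Hom g_simps(2)] in auto)
qed

text \<open>A tensor functor is recorded by its universal linear maps \<open>e M : M \<rightarrow> Hom(F, L M)\<close>,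
  the images of the identities under the adjunction; \<open>e M x\<close> is the arrow \<open>x \<otimes> - : F \<rightarrow> M \<otimes> F\<close>.\<close>

definition tensor_universal ::
  "('o, 'a, 'r) lmod \<Rightarrow> (('u, 'r) rmodule, ('u, 'r) rmod_arr, 'o, 'a) cfunctor
    \<Rightarrow> (('u, 'r) rmodule \<Rightarrow> 'u \<Rightarrow> 'a) \<Rightarrow> bool" where
  "tensor_universal F L e \<longleftrightarrow> is_functor Mod A L \<and>
     (\<forall>M\<in>Ob Mod. e M \<in> lin_maps R M (Hom_rmodule A F (FOb L M))) \<and>
     (\<forall>M N f. (M, f, N) \<in> Arr Mod \<longrightarrow> (\<forall>x\<in>carrier M. FArr L (M, f, N) \<circ>\<^sub>A e M x = e N (f x))) \<and>
     (\<forall>M\<in>Ob Mod. \<forall>N\<in>Ob A. \<forall>g\<in>lin_maps R M (Hom_rmodule A F N).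
        \<exists>!h. h \<in> Hom A (FOb L M) N \<and> (\<forall>x\<in>carrier M. h \<circ>\<^sub>A e M x = g x))"

lemma tensor_universalD:
  assumes "tensor_universal F L e"
  shows "is_functor Mod A L"
    and "M \<in> Ob Mod \<Longrightarrow> e M \<in> lin_maps R M (Hom_rmodule A F (FOb L M))"
    and "\<lbrakk>(M, f, N) \<in> Arr Mod; x \<in> carrier M\<rbrakk> \<Longrightarrow> FArr L (M, f, N) \<circ>\<^sub>A e M x = e N (f x)"
    and "\<lbrakk>M \<in> Ob Mod; Y \<in> Ob A; g \<in> lin_maps R M (Hom_rmodule A F Y)\<rbrakk>
      \<Longrightarrow> \<exists>!h. h \<in> Hom A (FOb L M) Y \<and> (\<forall>x\<in>carrier M. h \<circ>\<^sub>A e M x = g x)"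
    and "M \<in> Ob Mod \<Longrightarrow> FOb L M \<in> Ob A"
    and "\<lbrakk>M \<in> Ob Mod; x \<in> carrier M\<rbrakk> \<Longrightarrow> e M x \<in> Hom A (fst F) (FOb L M)"
proof -
  show 1: "is_functor Mod A L"
    using assms unfolding tensor_universal_def by blast
  show 2: "M \<in> Ob Mod \<Longrightarrow> e M \<in> lin_maps R M (Hom_rmodule A F (FOb L M))" for M
    using assms unfolding tensor_universal_def by blast
  show "\<lbrakk>(M, f, N) \<in> Arr Mod; x \<in> carrier M\<rbrakk> \<Longrightarrow> FArr L (M, f, N) \<circ>\<^sub>A e M x = e N (f x)"
    using assms unfolding tensor_universal_def by blast
  show "\<lbrakk>M \<in> Ob Mod; Y \<in> Ob A; g \<in> lin_maps R M (Hom_rmodule A F Y)\<rbrakk>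
      \<Longrightarrow> \<exists>!h. h \<in> Hom A (FOb L M) Y \<and> (\<forall>x\<in>carrier M. h \<circ>\<^sub>A e M x = g x)"
    using assms unfolding tensor_universal_def by blast
  show "M \<in> Ob Mod \<Longrightarrow> FOb L M \<in> Ob A" using is_functorD(1)[OF 1] .
  show "\<lbrakk>M \<in> Ob Mod; x \<in> carrier M\<rbrakk> \<Longrightarrow> e M x \<in> Hom A (fst F) (FOb L M)"
    using Hom_valued_lin_mapsD(2)[OF 2] .
qed

lemma tensor_universal_cancel:
  assumes F: "F \<in> lmods" and L: "tensor_universal F L e" and M: "M \<in> Ob Mod"
    and u: "u \<in> Hom A (FOb L M) N" and v: "v \<in> Hom A (FOb L M) N"
    and eq: "\<And>x. x \<in> carrier M \<Longrightarrow> u \<circ>\<^sub>A e M x = v \<circ>\<^sub>A e M x"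
  shows "u = v"
proof -
  have M_mod: "right_module R M" using M by simp
  have "(\<lambda>x\<in>carrier M. v \<circ>\<^sub>A e M x) \<in> lin_maps R M (Hom_rmodule A F N)"
    by (rule Hom_valued_postcomp[OF F M_mod tensor_universalD(2)[OF L M] v])
  from tensor_universalD(4)[OF L M A.HomD(5)[OF v] this]
  show ?thesis by (rule Ex1_eqI) (use u v eq in simp_all)
qed

lemma tensor_adjunction_imp_universal:
  assumes adj: "is_tensor_adjunction R \<gamma> A F L \<theta>"
  defines "e \<equiv> \<lambda>M. \<theta> M (FOb L M) (Id A (FOb L M))"
  shows "tensor_universal F L e"
    and "\<lbrakk>M \<in> Ob Mod; h \<in> Hom A (FOb L M) N\<rbrakk> \<Longrightarrow> \<theta> M N h = (\<lambda>x\<in>carrier M. h \<circ>\<^sub>A e M x)"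
proof -
  have L: "is_functor Mod A L" using adj unfolding is_tensor_adjunction_def by blast
  have bij: "bij_betw (\<theta> M N) (Hom A (FOb L M) N) (lin_maps R M (Hom_rmodule A F N))"
    if "M \<in> Ob Mod" "N \<in> Ob A" for M N
    using adj that unfolding is_tensor_adjunction_def by blast
  have nat: "\<theta> M' N' (g \<circ>\<^sub>A h \<circ>\<^sub>A FArr L (M', f, M)) = (\<lambda>x\<in>carrier M'. g \<circ>\<^sub>A \<theta> M N h (f x))"
    if "(M', f, M) \<in> Arr Mod" "g \<in> Hom A N N'" "h \<in> Hom A (FOb L M) N" for M M' N N' f g h
    using adj that unfolding is_tensor_adjunction_def by blast
  have L_Ob: "FOb L M \<in> Ob A" if "M \<in> Ob Mod" for M using is_functorD(1)[OF L that] .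
  show \<theta>: "\<theta> M N h = (\<lambda>x\<in>carrier M. h \<circ>\<^sub>A e M x)" if M: "M \<in> Ob Mod" and h: "h \<in> Hom A (FOb L M) N"
    for M N h
  proof -
    have id: "(M, \<lambda>x\<in>carrier M. x, M) \<in> Arr Mod" using M right_module.lin_maps_id by auto
    have "FArr L (M, \<lambda>x\<in>carrier M. x, M) = Id A (FOb L M)"
      using is_functorD(3)[OF L M] by simp
    then show ?thesis
      using nat[OF id h A.Id_Hom[OF L_Ob[OF M]]] A.HomD[OF h] L_Ob[OF M]
      by (simp add: e_def cong: restrict_cong)
  qed
  have e: "e M \<in> lin_maps R M (Hom_rmodule A F (FOb L M))" if M: "M \<in> Ob Mod" for M
    using bij[OF M L_Ob[OF M]] A.Id_Hom[OF L_Ob[OF M]] by (auto simp: e_def bij_betw_def)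
  show "tensor_universal F L e"
    unfolding tensor_universal_def
  proof (intro conjI ballI allI impI)
    fix M N f x assume f: "(M, f, N) \<in> Arr Mod" and x: "x \<in> carrier M"
    then have M: "M \<in> Ob Mod" and N: "N \<in> Ob Mod" and f_lin: "f \<in> lin_maps R M N" by simp_all
    have f_Hom: "(M, f, N) \<in> Hom Mod M N" using f by simp
    note Lf = is_functorD(2)[OF L f_Hom]
    have "\<theta> M (FOb L N) (FArr L (M, f, N)) = (\<lambda>x\<in>carrier M. Id A (FOb L N) \<circ>\<^sub>A e N (f x))"
      using nat[OF f A.Id_Hom A.Id_Hom, OF L_Ob[OF N] L_Ob[OF N]] A.HomD[OF Lf] by (simp add: e_def)
    from trans[OF \<theta>[OF M Lf, symmetric] this]
    have "FArr L (M, f, N) \<circ>\<^sub>A e M x = Id A (FOb L N) \<circ>\<^sub>A e N (f x)"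
      using x by (auto dest!: fun_cong[of _ _ x])
    moreover have "e N (f x) \<in> Hom A (fst F) (FOb L N)"
      using Hom_valued_lin_mapsD(2)[OF e[OF N] lin_mapsD(2)[OF f_lin x]] .
    ultimately show "FArr L (M, f, N) \<circ>\<^sub>A e M x = e N (f x)"
      using A.Comp_Id_left by simp
  next
    fix M N g assume M: "M \<in> Ob Mod" and N: "N \<in> Ob A" and g: "g \<in> lin_maps R M (Hom_rmodule A F N)"
    have iff: "\<theta> M N h = g \<longleftrightarrow> (\<forall>x\<in>carrier M. h \<circ>\<^sub>A e M x = g x)" if "h \<in> Hom A (FOb L M) N" for h
      using \<theta>[OF M that] lin_mapsD(1)[OF g] by (auto simp: fun_eq_iff extensional_def)
    have "g \<in> \<theta> M N ` Hom A (FOb L M) N" using bij_betw_imp_surj_on[OF bij[OF M N]] g by simp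
    then obtain h where h: "h \<in> Hom A (FOb L M) N" "\<theta> M N h = g" by (elim imageE) simp
    show "\<exists>!h. h \<in> Hom A (FOb L M) N \<and> (\<forall>x\<in>carrier M. h \<circ>\<^sub>A e M x = g x)"
    proof (rule ex1I)
      show "h \<in> Hom A (FOb L M) N \<and> (\<forall>x\<in>carrier M. h \<circ>\<^sub>A e M x = g x)"
        using h iff[OF h(1)] by simp
      fix u assume u: "u \<in> Hom A (FOb L M) N \<and> (\<forall>x\<in>carrier M. u \<circ>\<^sub>A e M x = g x)"
      then have "\<theta> M N u = \<theta> M N h" using h(2) iff[of u] by simp
      then show "u = h"
        using inj_onD[OF bij_betw_imp_inj_on[OF bij[OF M N]]] u h(1) by simp
    qed
  qed (use L e in auto)
qed

text \<open>Universality of \<open>e M\<close> is bijectivity of the transposition \<open>h \<mapsto> (x \<mapsto> h \<circ> e M x)\<close>.\<close>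

lemma universal_imp_tensor_adjunction:
  assumes F: "F \<in> lmods" and L: "tensor_universal F L e"
  shows "is_tensor_adjunction R \<gamma> A F L (\<lambda>M N h. \<lambda>x\<in>carrier M. h \<circ>\<^sub>A e M x)"
  unfolding is_tensor_adjunction_def
proof (intro conjI ballI allI impI)
  note L_simps = tensor_universalD[OF L]
  show "is_functor Mod A L" by (rule L_simps(1))
  fix M N assume M: "M \<in> Ob Mod" and N: "N \<in> Ob A"
  then have M_mod: "right_module R M" by simp
  show "bij_betw (\<lambda>h. \<lambda>x\<in>carrier M. h \<circ>\<^sub>A e M x) (Hom A (FOb L M) N) (lin_maps R M (Hom_rmodule A F N))"
    unfolding bij_betw_def
  proof
    show "inj_on (\<lambda>h. \<lambda>x\<in>carrier M. h \<circ>\<^sub>A e M x) (Hom A (FOb L M) N)"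
    proof (rule inj_onI)
      fix u v assume u: "u \<in> Hom A (FOb L M) N" and v: "v \<in> Hom A (FOb L M) N"
        and eq: "(\<lambda>x\<in>carrier M. u \<circ>\<^sub>A e M x) = (\<lambda>x\<in>carrier M. v \<circ>\<^sub>A e M x)"
      show "u = v"
      proof (rule tensor_universal_cancel[OF F L M u v])
        show "u \<circ>\<^sub>A e M x = v \<circ>\<^sub>A e M x" if "x \<in> carrier M" for x
          using fun_cong[OF eq, of x] that by simp
      qed
    qed
    show "(\<lambda>h. \<lambda>x\<in>carrier M. h \<circ>\<^sub>A e M x) ` Hom A (FOb L M) N = lin_maps R M (Hom_rmodule A F N)"
    proof (intro equalityI subsetI)
      fix g assume "g \<in> (\<lambda>h. \<lambda>x\<in>carrier M. h \<circ>\<^sub>A e M x) ` Hom A (FOb L M) N"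
      then show "g \<in> lin_maps R M (Hom_rmodule A F N)"
        using Hom_valued_postcomp[OF F M_mod L_simps(2)[OF M]] by auto
    next
      fix g assume g: "g \<in> lin_maps R M (Hom_rmodule A F N)"
      obtain h where h: "h \<in> Hom A (FOb L M) N" "\<And>x. x \<in> carrier M \<Longrightarrow> h \<circ>\<^sub>A e M x = g x"
        using L_simps(4)[OF M N g] by blast
      have "g = (\<lambda>x\<in>carrier M. h \<circ>\<^sub>A e M x)"
        using h(2) lin_mapsD(1)[OF g] by (auto simp: fun_eq_iff extensional_def)
      then show "g \<in> (\<lambda>h. \<lambda>x\<in>carrier M. h \<circ>\<^sub>A e M x) ` Hom A (FOb L M) N"
        using h(1) by blast
    qed
  qed
next
  note L_simps = tensor_universalD[OF L]
  fix M M' f N N' g h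
  assume f: "(M', f, M) \<in> Arr Mod" and g: "g \<in> Hom A N N'" and h: "h \<in> Hom A (FOb L M) N"
  have M: "M \<in> Ob Mod" and M': "M' \<in> Ob Mod" and f_lin: "f \<in> lin_maps R M' M" using f by simp_all
  have f_Hom: "(M', f, M) \<in> Hom Mod M' M" using f by simp
  note Lf = is_functorD(2)[OF L_simps(1) f_Hom]
  show "(\<lambda>x\<in>carrier M'. (g \<circ>\<^sub>A h \<circ>\<^sub>A FArr L (M', f, M)) \<circ>\<^sub>A e M' x) =
      (\<lambda>x\<in>carrier M'. g \<circ>\<^sub>A (\<lambda>x\<in>carrier M. h \<circ>\<^sub>A e M x) (f x))"
  proof (rule restrict_ext)
    fix x assume x: "x \<in> carrier M'"
    note fx = lin_mapsD(2)[OF f_lin x]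
    show "(g \<circ>\<^sub>A h \<circ>\<^sub>A FArr L (M', f, M)) \<circ>\<^sub>A e M' x = g \<circ>\<^sub>A (\<lambda>x\<in>carrier M. h \<circ>\<^sub>A e M x) (f x)"
      using A.HomD[OF g] A.HomD[OF h] A.HomD[OF Lf] A.HomD[OF L_simps(6)[OF M' x]] fx
      by (simp add: L_simps(3)[OF f x])
  qed
qed

subsection \<open>Existence of tensor products\<close>

lemma coproduct_factor:
  assumes S: "is_coproduct A I X S \<iota>" and Y: "Y \<in> Ob A" and f: "\<And>i. i \<in> I \<Longrightarrow> f i \<in> Hom A (X i) Y"
  shows "\<exists>!h. h \<in> Hom A S Y \<and> (\<forall>i\<in>I. h \<circ>\<^sub>A \<iota> i = f i)"
proof -
  have "\<forall>Y\<in>Ob A. \<forall>f. (\<forall>i\<in>I. f i \<in> Hom A (X i) Y) \<longrightarrow> (\<exists>!h. h \<in> Hom A S Y \<and> (\<forall>i\<in>I. h \<circ>\<^sub>A \<iota> i = f i))"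
    using S unfolding is_coproduct_def by simp
  from this[THEN bspec, OF Y, THEN spec, of f] f show ?thesis by simp
qed

lemma ex_coproduct:
  fixes J :: "'i set"
  assumes J: "|J| <o |UNIV :: 'u set|" and X: "\<And>i. i \<in> J \<Longrightarrow> X i \<in> Ob A"
  shows "\<exists>S \<iota>. is_coproduct A J X S \<iota>"
proof -
  obtain j :: "'i \<Rightarrow> 'u" where j: "inj_on j J" "small (j ` J)"
    by (rule ex_small_injection[OF J])
  define j' where "j' = inv_into J j"
  have j' [simp]: "j' (j i) = i" if "i \<in> J" for i using that j(1) by (simp add: j'_def)
  have "\<forall>i\<in>j ` J. X (j' i) \<in> Ob A" using X by simp
  then have "\<exists>S \<iota>. is_coproduct A (j ` J) (\<lambda>i. X (j' i)) S \<iota>"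
    using cocomplete[unfolded cocomplete_def, THEN spec, THEN spec, of "j ` J" "\<lambda>i. X (j' i)"] j(2)
    by simp
  then obtain S \<iota> where S: "is_coproduct A (j ` J) (\<lambda>i. X (j' i)) S \<iota>" by (elim exE)
  have "is_coproduct A J X S (\<lambda>i. \<iota> (j i))"
    unfolding is_coproduct_def
  proof (intro conjI ballI allI impI)
    show "S \<in> Ob A" using S by (simp add: is_coproduct_def)
    show "\<iota> (j i) \<in> Hom A (X i) S" if "i \<in> J" for i
      using S that by (auto simp: is_coproduct_def)
    fix Y f assume Y: "Y \<in> Ob A" and f: "\<forall>i\<in>J. f i \<in> Hom A (X i) Y"
    have "f (j' i) \<in> Hom A (X (j' i)) Y" if "i \<in> j ` J" for i using f that by auto
    from coproduct_factor[OF S Y, of "\<lambda>i. f (j' i)", OF this]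
    show "\<exists>!h. h \<in> Hom A S Y \<and> (\<forall>i\<in>J. h \<circ>\<^sub>A \<iota> (j i) = f i)" by simp
  qed
  then show ?thesis by blast
qed

lemma stable_universe: "stable |UNIV :: 'u set|"
  using regularCard_stable[OF card_of_Card_order _ regular_universe] infinite_universe
  by (simp add: Field_card_of)

lemma R_small: "|carrier R| <o |UNIV :: 'u set|"
proof -
  have "|carrier R| \<le>o |carrier B|"
    using b_free card_of_ordLeq[of "carrier R" "carrier B"] by (auto simp: bij_betw_def)
  then show ?thesis using B_Mod(2) ordLeq_ordLess_trans unfolding small_def by blast
qed

lemma coproduct_cancel:
  assumes S: "is_coproduct A I X S \<iota>" and u: "u \<in> Hom A S Y" and v: "v \<in> Hom A S Y"
    and eq: "\<And>i. i \<in> I \<Longrightarrow> u \<circ>\<^sub>A \<iota> i = v \<circ>\<^sub>A \<iota> i"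
  shows "u = v"
proof -
  have \<iota>: "\<And>i. i \<in> I \<Longrightarrow> \<iota> i \<in> Hom A (X i) S" using S unfolding is_coproduct_def by blast
  from coproduct_factor[OF S A.HomD(5)[OF v], of "\<lambda>i. v \<circ>\<^sub>A \<iota> i", OF A.Comp_Hom[OF \<iota> v]]
  show ?thesis by (rule Ex1_eqI) (use u v eq in simp_all)
qed

text \<open>\<open>M \<otimes> F\<close> is the quotient of the coproduct of copies of \<open>F\<close> indexed by \<open>M\<close> by the relations
  of additivity and of balancedness, which form a small set.\<close>

lemma ex_tensor_object:
  assumes F: "F \<in> lmods" and M: "right_module R M" "small (carrier (M :: ('u, 'r) rmodule))"
  shows "\<exists>T e. T \<in> Ob A \<and> e \<in> lin_maps R M (Hom_rmodule A F T) \<and>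
    (\<forall>N\<in>Ob A. \<forall>g\<in>lin_maps R M (Hom_rmodule A F N).
      \<exists>!h. h \<in> Hom A T N \<and> (\<forall>x\<in>carrier M. h \<circ>\<^sub>A e x = g x))"
proof -
  interpret M: right_module R M by fact
  let ?F = "fst F" and ?\<rho> = "snd F"
  note F_simps = lmodsD[OF F]
  obtain S \<iota> where S: "is_coproduct A (carrier M) (\<lambda>_. ?F) S \<iota>"
    using ex_coproduct[of "carrier M" "\<lambda>_. ?F"] M(2) F_simps(1) by (auto simp: small_def)
  have S_Ob: "S \<in> Ob A" and \<iota>: "\<And>x. x \<in> carrier M \<Longrightarrow> \<iota> x \<in> Hom A ?F S"
    using S by (auto simp: is_coproduct_def)
  let ?J = "(SIGMA x : carrier M. carrier M) <+> (SIGMA x : carrier M. carrier R)"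
  have "|SIGMA x : carrier M. carrier M| <o |UNIV :: 'u set|"
    "|SIGMA x : carrier M. carrier R| <o |UNIV :: 'u set|"
    using stable_elim[OF stable_universe, of "carrier M" "\<lambda>_. carrier M"]
      stable_elim[OF stable_universe, of "carrier M" "\<lambda>_. carrier R"] M(2) R_small
    by (simp_all add: small_def)
  then have "|?J| <o |UNIV :: 'u set|"
    using card_of_Plus_ordLess_infinite infinite_universe by blast
  from ex_coproduct[OF this, of "\<lambda>_. ?F"] obtain S' \<kappa>
    where S': "is_coproduct A ?J (\<lambda>_. ?F) S' \<kappa>" using F_simps(1) by auto
  have \<kappa>: "\<And>j. j \<in> ?J \<Longrightarrow> \<kappa> j \<in> Hom A ?F S'" using S' unfolding is_coproduct_def by blast
  define lhs where "lhs = case_sum (\<lambda>(x, y). \<iota> (x \<oplus>\<^bsub>M\<^esub> y)) (\<lambda>(x, r). \<iota> (x \<triangleleft>\<^bsub>M\<^esub> r))"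
  define rhs where "rhs = case_sum (\<lambda>(x, y). \<iota> x \<oplus>\<^bsub>HomMod A ?F S\<^esub> \<iota> y) (\<lambda>(x, r). \<iota> x \<circ>\<^sub>A ?\<rho> r)"
  have lhs: "lhs j \<in> Hom A ?F S" if "j \<in> ?J" for j
    using that \<iota> M.ract_closed by (auto simp: lhs_def)
  have rhs: "rhs j \<in> Hom A ?F S" if "j \<in> ?J" for j
    using that \<iota> A.Comp_Hom[OF F_simps(3) \<iota>] by (auto simp: rhs_def)
  obtain p where p: "p \<in> Hom A S' S" "\<And>j. j \<in> ?J \<Longrightarrow> p \<circ>\<^sub>A \<kappa> j = lhs j"
    using coproduct_factor[OF S' S_Ob, of lhs, OF lhs] by blast
  obtain q where q: "q \<in> Hom A S' S" "\<And>j. j \<in> ?J \<Longrightarrow> q \<circ>\<^sub>A \<kappa> j = rhs j"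
    using coproduct_factor[OF S' S_Ob, of rhs, OF rhs] by blast
  from A.ex_coequalizer[OF p(1) q(1)] obtain T c where
    *: "c \<in> Hom A S T \<and> c \<circ>\<^sub>A p = c \<circ>\<^sub>A q \<and>
      (\<forall>Z. \<forall>h\<in>Hom A S Z. h \<circ>\<^sub>A p = h \<circ>\<^sub>A q \<longrightarrow> (\<exists>!u. u \<in> Hom A T Z \<and> u \<circ>\<^sub>A c = h))"
    by (elim exE)
  then have c: "c \<in> Hom A S T" and cpq: "c \<circ>\<^sub>A p = c \<circ>\<^sub>A q"
    and c_univ: "\<And>Z h. h \<in> Hom A S Z \<Longrightarrow> h \<circ>\<^sub>A p = h \<circ>\<^sub>A q \<Longrightarrow> \<exists>!u. u \<in> Hom A T Z \<and> u \<circ>\<^sub>A c = h"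
    by blast+
  \<comment> \<open>An arrow out of the coproduct equalises \<open>p\<close> and \<open>q\<close> iff its components are linear in \<open>M\<close>.\<close>
  have balanced: "h \<circ>\<^sub>A p = h \<circ>\<^sub>A q \<longleftrightarrow> (\<forall>j\<in>?J. h \<circ>\<^sub>A lhs j = h \<circ>\<^sub>A rhs j)" if h: "h \<in> Hom A S N" for h N
  proof
    assume eq: "h \<circ>\<^sub>A p = h \<circ>\<^sub>A q"
    show "\<forall>j\<in>?J. h \<circ>\<^sub>A lhs j = h \<circ>\<^sub>A rhs j"
    proof
      fix j assume j: "j \<in> ?J"
      have "h \<circ>\<^sub>A lhs j = (h \<circ>\<^sub>A p) \<circ>\<^sub>A \<kappa> j"
        using A.Comp_assoc[OF \<kappa>[OF j] p(1) h] p(2)[OF j] by simp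
      also have "\<dots> = h \<circ>\<^sub>A rhs j"
        using A.Comp_assoc[OF \<kappa>[OF j] q(1) h] q(2)[OF j] eq by simp
      finally show "h \<circ>\<^sub>A lhs j = h \<circ>\<^sub>A rhs j" .
    qed
  next
    assume eq: "\<forall>j\<in>?J. h \<circ>\<^sub>A lhs j = h \<circ>\<^sub>A rhs j"
    show "h \<circ>\<^sub>A p = h \<circ>\<^sub>A q"
    proof (rule coproduct_cancel[OF S'])
      show "h \<circ>\<^sub>A p \<in> Hom A S' N" "h \<circ>\<^sub>A q \<in> Hom A S' N" using A.Comp_Hom h p(1) q(1) by blast+
      fix j assume j: "j \<in> ?J"
      show "(h \<circ>\<^sub>A p) \<circ>\<^sub>A \<kappa> j = (h \<circ>\<^sub>A q) \<circ>\<^sub>A \<kappa> j"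
        using A.Comp_assoc[OF \<kappa>[OF j] p(1) h] p(2)[OF j] A.Comp_assoc[OF \<kappa>[OF j] q(1) h] q(2)[OF j]
          bspec[OF eq j] by simp
    qed
  qed
  have rel: "h \<circ>\<^sub>A rhs (Inl (x, y)) = h \<circ>\<^sub>A \<iota> x \<oplus>\<^bsub>HomMod A ?F N\<^esub> h \<circ>\<^sub>A \<iota> y"
    "h \<circ>\<^sub>A rhs (Inr (x, r)) = (h \<circ>\<^sub>A \<iota> x) \<circ>\<^sub>A ?\<rho> r"
    if h: "h \<in> Hom A S N" and x: "x \<in> carrier M" and y: "y \<in> carrier M" and r: "r \<in> carrier R"
    for h N x y r
    using A.Comp_add_right[OF \<iota>[OF x] \<iota>[OF y] h] A.Comp_assoc[OF F_simps(3)[OF r] \<iota>[OF x] h]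
    by (simp_all add: rhs_def)
  define e where "e = (\<lambda>x\<in>carrier M. c \<circ>\<^sub>A \<iota> x)"
  have "e \<in> lin_maps R M (Hom_rmodule A F T)"
  proof (rule lin_mapsI)
    have c_bal: "\<forall>j\<in>?J. c \<circ>\<^sub>A lhs j = c \<circ>\<^sub>A rhs j" using balanced[OF c] cpq by blast
    show "e \<in> extensional (carrier M)" by (simp add: e_def)
    show "e x \<in> carrier (Hom_rmodule A F T)" if "x \<in> carrier M" for x
      using that A.Comp_Hom[OF \<iota> c] by (simp add: e_def)
    show "e (x \<oplus>\<^bsub>M\<^esub> y) = e x \<oplus>\<^bsub>Hom_rmodule A F T\<^esub> e y" if x: "x \<in> carrier M" and y: "y \<in> carrier M" for x y
      using bspec[OF c_bal InlI[OF SigmaI[OF x y]]] rel(1)[OF c x y alg.R.zero_closed] x y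
      by (simp add: e_def lhs_def)
    show "e (x \<triangleleft>\<^bsub>M\<^esub> r) = e x \<triangleleft>\<^bsub>Hom_rmodule A F T\<^esub> r" if x: "x \<in> carrier M" and r: "r \<in> carrier R" for x r
      using bspec[OF c_bal InrI[OF SigmaI[OF x r]]] rel(2)[OF c x x r] x r M.ract_closed
      by (simp add: e_def lhs_def)
  qed
  moreover have "\<exists>!h. h \<in> Hom A T N \<and> (\<forall>x\<in>carrier M. h \<circ>\<^sub>A e x = g x)"
    if N: "N \<in> Ob A" and g: "g \<in> lin_maps R M (Hom_rmodule A F N)" for N g
  proof -
    note g_simps = Hom_valued_lin_mapsD[OF g]
    obtain h where h: "h \<in> Hom A S N" "\<And>x. x \<in> carrier M \<Longrightarrow> h \<circ>\<^sub>A \<iota> x = g x"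
      using coproduct_factor[OF S N, of g, OF g_simps(2)] by blast
    have "h \<circ>\<^sub>A lhs j = h \<circ>\<^sub>A rhs j" if j: "j \<in> ?J" for j
    proof (cases j)
      case (Inl z)
      then obtain x y where "j = Inl (x, y)" "x \<in> carrier M" "y \<in> carrier M" using j by auto
      then show ?thesis using rel(1)[OF h(1), of x y "\<zero>\<^bsub>R\<^esub>"] h(2) g_simps(3) by (simp add: lhs_def)
    next
      case (Inr z)
      then obtain x r where "j = Inr (x, r)" "x \<in> carrier M" "r \<in> carrier R" using j by auto
      then show ?thesis
        using rel(2)[OF h(1), of x x r] h(2) g_simps(4) M.ract_closed by (simp add: lhs_def)
    qed
    then have "h \<circ>\<^sub>A p = h \<circ>\<^sub>A q" using balanced[OF h(1)] by blast
    note ex1 = c_univ[OF h(1) this]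
    then obtain u where u: "u \<in> Hom A T N" "u \<circ>\<^sub>A c = h" by (elim ex1E conjE)
    show ?thesis
    proof (rule ex1I)
      show "u \<in> Hom A T N \<and> (\<forall>x\<in>carrier M. u \<circ>\<^sub>A e x = g x)"
      proof (intro conjI ballI)
        fix x assume x: "x \<in> carrier M"
        show "u \<circ>\<^sub>A e x = g x"
          using A.Comp_assoc[OF \<iota>[OF x] c u(1)] u(2) h(2)[OF x] x by (simp add: e_def)
      qed fact
      fix v assume v: "v \<in> Hom A T N \<and> (\<forall>x\<in>carrier M. v \<circ>\<^sub>A e x = g x)"
      have "v \<circ>\<^sub>A c = h"
      proof (rule coproduct_cancel[OF S])
        show "v \<circ>\<^sub>A c \<in> Hom A S N" using A.Comp_Hom[OF c] v by blast
        show "h \<in> Hom A S N" by fact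
        fix x assume x: "x \<in> carrier M"
        show "(v \<circ>\<^sub>A c) \<circ>\<^sub>A \<iota> x = h \<circ>\<^sub>A \<iota> x"
          using A.Comp_assoc[OF \<iota>[OF x] c conjunct1[OF v]] v h(2)[OF x] x by (simp add: e_def)
      qed
      then show "v = u" by (intro Ex1_eqI[OF ex1]) (use u v in simp_all)
    qed
  qed
  ultimately show ?thesis
    using A.HomD(5)[OF c] by (intro exI[of _ T] exI[of _ e] conjI ballI)
qed

lemma ex_tensor_universal:
  assumes F: "F \<in> lmods"
  shows "\<exists>L e. tensor_universal F L e"
proof -
  let ?P = "\<lambda>M T e. T \<in> Ob A \<and> e \<in> lin_maps R M (Hom_rmodule A F T) \<and>
    (\<forall>N\<in>Ob A. \<forall>g\<in>lin_maps R M (Hom_rmodule A F N).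
      \<exists>!h. h \<in> Hom A T N \<and> (\<forall>x\<in>carrier M. h \<circ>\<^sub>A e x = g x))"
  have "\<forall>M\<in>Ob Mod. \<exists>T e. ?P M T e"
  proof
    fix M assume "M \<in> Ob Mod"
    then have "right_module R M" "small (carrier M)" by simp_all
    then show "\<exists>T e. ?P M T e" by (rule ex_tensor_object[OF F])
  qed
  then obtain T where "\<forall>M\<in>Ob Mod. \<exists>e. ?P M (T M) e" by (rule bchoice[THEN exE])
  then obtain e where P: "\<forall>M\<in>Ob Mod. ?P M (T M) (e M)" by (rule bchoice[THEN exE])
  have T: "T M \<in> Ob A" if "M \<in> Ob Mod" for M
    by (rule conjunct1[OF bspec[OF P that]])
  have e: "e M \<in> lin_maps R M (Hom_rmodule A F (T M))" if "M \<in> Ob Mod" for M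
    by (rule conjunct1[OF conjunct2[OF bspec[OF P that]]])
  have univ: "\<exists>!h. h \<in> Hom A (T M) N \<and> (\<forall>x\<in>carrier M. h \<circ>\<^sub>A e M x = g x)"
    if "M \<in> Ob Mod" "N \<in> Ob A" "g \<in> lin_maps R M (Hom_rmodule A F N)" for M N g
    by (rule bspec[OF bspec[OF conjunct2[OF conjunct2[OF bspec[OF P that(1)]]] that(2)] that(3)])
  have e_Hom: "e M x \<in> Hom A (fst F) (T M)" if "M \<in> Ob Mod" "x \<in> carrier M" for M x
    using Hom_valued_lin_mapsD(2)[OF e] that .
  define L where "L = \<lparr>FOb = T, FArr = (\<lambda>(M, f, N). THE h. h \<in> Hom A (T M) (T N) \<and>
    (\<forall>x\<in>carrier M. h \<circ>\<^sub>A e M x = e N (f x)))\<rparr>"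
  have FOb [simp]: "FOb L = T" by (simp add: L_def)
  have ex1: "\<exists>!h. h \<in> Hom A (T M) (T N) \<and> (\<forall>x\<in>carrier M. h \<circ>\<^sub>A e M x = e N (f x))"
    if "(M, f, N) \<in> Hom Mod M N" for M f N
  proof -
    have M: "right_module R M" "M \<in> Ob Mod" and N: "N \<in> Ob Mod" and f: "f \<in> lin_maps R M N"
      using that by simp_all
    have "\<exists>!h. h \<in> Hom A (T M) (T N) \<and> (\<forall>x\<in>carrier M. h \<circ>\<^sub>A e M x = compose (carrier M) (e N) f x)"
      using univ[OF M(2) T[OF N] lin_maps_compose[OF M(1) f e[OF N]]] .
    then show ?thesis by simp
  qed
  have L_Arr: "FArr L (M, f, N) \<in> Hom A (T M) (T N)"
      "\<And>x. x \<in> carrier M \<Longrightarrow> FArr L (M, f, N) \<circ>\<^sub>A e M x = e N (f x)"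
    if "(M, f, N) \<in> Hom Mod M N" for M f N
    using theI'[OF ex1[OF that]] by (simp_all add: L_def)
  have L_eq: "FArr L (M, f, N) = h" if "(M, f, N) \<in> Hom Mod M N" "h \<in> Hom A (T M) (T N)"
    "\<And>x. x \<in> carrier M \<Longrightarrow> h \<circ>\<^sub>A e M x = e N (f x)" for M f N h
    using ex1[OF that(1)] L_Arr[OF that(1)] that(2,3) by blast
  have "is_functor Mod A L"
    unfolding is_functor_def
  proof (intro conjI ballI allI)
    show "FOb L M \<in> Ob A" if "M \<in> Ob Mod" for M using T[OF that] by simp
    show "FArr L f \<in> Hom A (FOb L M) (FOb L N)" if "f \<in> Hom Mod M N" for M N f
      using that L_Arr(1) by (elim HomE_Mod) auto
    show "FArr L (Id Mod M) = Id A (FOb L M)" if M: "M \<in> Ob Mod" for M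
      unfolding Id_Mod FOb
    proof (rule L_eq)
      show "(M, \<lambda>x\<in>carrier M. x, M) \<in> Hom Mod M M" using M right_module.lin_maps_id by auto
      show "Id A (T M) \<in> Hom A (T M) (T M)" using A.Id_Hom[OF T[OF M]] .
      show "Id A (T M) \<circ>\<^sub>A e M x = e M ((\<lambda>x\<in>carrier M. x) x)" if "x \<in> carrier M" for x
        using A.Comp_Id_left[OF e_Hom[OF M that]] that by simp
    qed
    show "FArr L (g \<cdot>\<^bsub>Mod\<^esub> f) = FArr L g \<circ>\<^sub>A FArr L f" if f: "f \<in> Hom Mod M N" and g: "g \<in> Hom Mod N P"
      for M N P f g
    proof -
      from f obtain f' where f': "f = (M, f', N)" "f' \<in> lin_maps R M N" by (rule HomE_Mod)
      from g obtain g' where g': "g = (N, g', P)" "g' \<in> lin_maps R N P" by (rule HomE_Mod)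
      note Lf = L_Arr[OF f[unfolded f'(1)]] and Lg = L_Arr[OF g[unfolded g'(1)]]
      have M: "M \<in> Ob Mod" using f by (rule HomE_Mod) simp
      show ?thesis
        unfolding f'(1) g'(1) Comp_Mod
      proof (rule L_eq)
        show "(M, compose (carrier M) g' f', P) \<in> Hom Mod M P"
          using category.Comp_Hom[OF category_Mod f g] by (simp add: f' g')
        show "FArr L (N, g', P) \<circ>\<^sub>A FArr L (M, f', N) \<in> Hom A (T M) (T P)"
          using A.Comp_Hom Lf(1) Lg(1) by blast
        fix x assume x: "x \<in> carrier M"
        show "(FArr L (N, g', P) \<circ>\<^sub>A FArr L (M, f', N)) \<circ>\<^sub>A e M x = e P (compose (carrier M) g' f' x)"
          using A.Comp_assoc[OF e_Hom[OF M x] Lf(1) Lg(1)] Lf(2)[OF x] Lg(2)[OF lin_mapsD(2)[OF f'(2) x]] x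
          by simp
      qed
    qed
  qed
  then have "tensor_universal F L e"
    unfolding tensor_universal_def using e univ L_Arr(2) by simp
  then show ?thesis by blast
qed

end

section \<open>Tensor functors are right exact and commute with direct limits\<close>

lemma right_exact_seq_composable: "right_exact_seq C f g \<Longrightarrow> Cod C f = Dom C g"
  unfolding right_exact_seq_def exact_def by blast

lemma add_Mod [simp]: "(M, f, N) \<oplus>\<^bsub>HomMod (Mod_cat R \<gamma>) M N\<^esub> (M, g, N) =
    (M, \<lambda>x\<in>carrier M. f x \<oplus>\<^bsub>N\<^esub> g x, N)"
  by (simp add: Mod_cat_def)

lemma smult_Mod [simp]: "a \<odot>\<^bsub>HomMod (Mod_cat R \<gamma>) M N\<^esub> (M, f, N) =
    (M, \<lambda>x\<in>carrier M. f x \<triangleleft>\<^bsub>N\<^esub> \<gamma> a, N)"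
  by (simp add: Mod_cat_def)

context tensor_setting
begin

lemma \<gamma>_closed: "a \<in> carrier k \<Longrightarrow> \<gamma> a \<in> carrier R"
  using ring_hom_closed[OF alg.structure_map] .

lemma smult_Hom:
  assumes "a \<in> carrier k" "f \<in> Hom A X Y"
  shows "a \<odot>\<^bsub>HomMod A X Y\<^esub> f \<in> Hom A X Y"
proof -
  note o = A.HomD(4,5)[OF assms(2)]
  interpret module k "HomMod A X Y" using A.HomMod_module[OF o] .
  show ?thesis using smult_closed[of a f] assms A.HomMod_carrier[OF o] by simp
qed

text \<open>An element \<open>a\<close> of \<open>k\<close> acts on the arrows \<open>e N y\<close> through \<open>\<gamma> a\<close> in \<open>R\<close>, and this is the scalar
  multiplication of the category because \<open>\<rho> (\<gamma> a)\<close> is \<open>a\<close> times the identity of \<open>F\<close>.\<close>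

lemma tensor_universal_linear:
  assumes F: "F \<in> lmods" and L: "tensor_universal F L e"
  shows "linear_functor k Mod A L"
  unfolding linear_functor_def
proof (intro conjI allI ballI)
  note L_simps = tensor_universalD[OF L]
  fix M N a b assume a: "a \<in> Hom Mod M N" and b: "b \<in> Hom Mod M N"
  obtain f where f: "a = (M, f, N)" "f \<in> lin_maps R M N" "right_module R M" "small (carrier M)"
    "right_module R N" "small (carrier N)" using a by (rule HomE_Mod)
  obtain g where g: "b = (M, g, N)" "g \<in> lin_maps R M N" using b by (rule HomE_Mod)
  have M: "M \<in> Ob Mod" and N: "N \<in> Ob Mod" using f by simp_all
  have Arr: "(M, f, N) \<in> Arr Mod" "(M, g, N) \<in> Arr Mod" using f g by simp_all
  have sum_Hom: "(M, \<lambda>x\<in>carrier M. f x \<oplus>\<^bsub>N\<^esub> g x, N) \<in> Hom Mod M N"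
    using f g right_module_lin_maps_ops(2) by simp
  note La = is_functorD(2)[OF L_simps(1) a] and Lb = is_functorD(2)[OF L_simps(1) b]
  show "FArr L (a \<oplus>\<^bsub>HomMod Mod M N\<^esub> b) = FArr L a \<oplus>\<^bsub>HomMod A (FOb L M) (FOb L N)\<^esub> FArr L b"
  proof (rule tensor_universal_cancel[OF F L M])
    show "FArr L (a \<oplus>\<^bsub>HomMod Mod M N\<^esub> b) \<in> Hom A (FOb L M) (FOb L N)"
      using is_functorD(2)[OF L_simps(1) sum_Hom] by (simp add: f g)
    show "FArr L a \<oplus>\<^bsub>HomMod A (FOb L M) (FOb L N)\<^esub> FArr L b \<in> Hom A (FOb L M) (FOb L N)"
      using La Lb by blast
    fix x assume x: "x \<in> carrier M"
    note fx = lin_mapsD(2)[OF f(2) x] and gx = lin_mapsD(2)[OF g(2) x]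
    have "FArr L (a \<oplus>\<^bsub>HomMod Mod M N\<^esub> b) \<circ>\<^sub>A e M x = e N (f x \<oplus>\<^bsub>N\<^esub> g x)"
      using L_simps(3)[of M "\<lambda>x\<in>carrier M. f x \<oplus>\<^bsub>N\<^esub> g x" N x] sum_Hom x by (simp add: f(1) g(1))
    also have "\<dots> = e N (f x) \<oplus>\<^bsub>HomMod A (fst F) (FOb L N)\<^esub> e N (g x)"
      by (rule Hom_valued_lin_mapsD(3)[OF L_simps(2)[OF N] fx gx])
    also have "\<dots> = (FArr L a \<oplus>\<^bsub>HomMod A (FOb L M) (FOb L N)\<^esub> FArr L b) \<circ>\<^sub>A e M x"
      using A.Comp_add_left[OF L_simps(6)[OF M x] La Lb] L_simps(3)[OF Arr(1) x] L_simps(3)[OF Arr(2) x]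
      by (simp add: f(1) g(1))
    finally show "FArr L (a \<oplus>\<^bsub>HomMod Mod M N\<^esub> b) \<circ>\<^sub>A e M x =
        (FArr L a \<oplus>\<^bsub>HomMod A (FOb L M) (FOb L N)\<^esub> FArr L b) \<circ>\<^sub>A e M x" .
  qed
next
  note L_simps = tensor_universalD[OF L]
  fix M N t a assume t: "t \<in> carrier k" and a: "a \<in> Hom Mod M N"
  obtain f where f: "a = (M, f, N)" "f \<in> lin_maps R M N" "right_module R M" "small (carrier M)"
    "right_module R N" "small (carrier N)" using a by (rule HomE_Mod)
  interpret M: right_module R M by fact
  interpret N: right_module R N by fact
  have M: "M \<in> Ob Mod" and N: "N \<in> Ob Mod" using f by simp_all
  have Arr: "(M, f, N) \<in> Arr Mod" using f by simp
  note f_simps = lin_mapsD[OF f(2)]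
  have "(\<lambda>x\<in>carrier M. f x \<triangleleft>\<^bsub>N\<^esub> \<gamma> t) \<in> lin_maps R M N"
  proof (rule lin_mapsI)
    fix x r assume x: "x \<in> carrier M" and r: "r \<in> carrier R"
    have "(f x \<triangleleft>\<^bsub>N\<^esub> r) \<triangleleft>\<^bsub>N\<^esub> \<gamma> t = (f x \<triangleleft>\<^bsub>N\<^esub> \<gamma> t) \<triangleleft>\<^bsub>N\<^esub> r"
      using N.ract_mult[OF f_simps(2)[OF x] r \<gamma>_closed[OF t]]
        N.ract_mult[OF f_simps(2)[OF x] \<gamma>_closed[OF t] r] alg.structure_map_central[OF t r] by simp
    then show "(\<lambda>x\<in>carrier M. f x \<triangleleft>\<^bsub>N\<^esub> \<gamma> t) (x \<triangleleft>\<^bsub>M\<^esub> r) =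
        (\<lambda>x\<in>carrier M. f x \<triangleleft>\<^bsub>N\<^esub> \<gamma> t) x \<triangleleft>\<^bsub>N\<^esub> r"
      using x r f_simps(4)[OF x r] M.ract_closed[OF x r] by simp
  qed (use f_simps(2,3) N.ract_closed N.ract_add_left \<gamma>_closed[OF t] in auto)
  then have smult_Mod_Hom: "(M, \<lambda>x\<in>carrier M. f x \<triangleleft>\<^bsub>N\<^esub> \<gamma> t, N) \<in> Hom Mod M N" using f by simp
  note La = is_functorD(2)[OF L_simps(1) a]
  show "FArr L (t \<odot>\<^bsub>HomMod Mod M N\<^esub> a) = t \<odot>\<^bsub>HomMod A (FOb L M) (FOb L N)\<^esub> FArr L a"
  proof (rule tensor_universal_cancel[OF F L M])
    show "FArr L (t \<odot>\<^bsub>HomMod Mod M N\<^esub> a) \<in> Hom A (FOb L M) (FOb L N)"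
      using is_functorD(2)[OF L_simps(1) smult_Mod_Hom] by (simp add: f(1))
    show "t \<odot>\<^bsub>HomMod A (FOb L M) (FOb L N)\<^esub> FArr L a \<in> Hom A (FOb L M) (FOb L N)"
      by (rule smult_Hom[OF t La])
    fix x assume x: "x \<in> carrier M"
    note fx = lin_mapsD(2)[OF f(2) x]
    note efx = L_simps(6)[OF N fx]
    have "FArr L (t \<odot>\<^bsub>HomMod Mod M N\<^esub> a) \<circ>\<^sub>A e M x = e N (f x \<triangleleft>\<^bsub>N\<^esub> \<gamma> t)"
      using L_simps(3)[of M "\<lambda>x\<in>carrier M. f x \<triangleleft>\<^bsub>N\<^esub> \<gamma> t" N x] smult_Mod_Hom x by (simp add: f(1))
    also have "\<dots> = e N (f x) \<circ>\<^sub>A (t \<odot>\<^bsub>HomMod A (fst F) (fst F)\<^esub> Id A (fst F))"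
      using Hom_valued_lin_mapsD(4)[OF L_simps(2)[OF N] fx \<gamma>_closed[OF t]] lmodsD(7)[OF F t] by simp
    also have "\<dots> = t \<odot>\<^bsub>HomMod A (fst F) (FOb L N)\<^esub> e N (f x)"
      using A.Comp_smult_right[OF t A.Id_Hom[OF lmodsD(1)[OF F]] efx] A.Comp_Id_right[OF efx] by simp
    also have "\<dots> = (t \<odot>\<^bsub>HomMod A (FOb L M) (FOb L N)\<^esub> FArr L a) \<circ>\<^sub>A e M x"
      using A.Comp_smult_left[OF t L_simps(6)[OF M x] La] L_simps(3)[OF Arr x] by (simp add: f(1))
    finally show "FArr L (t \<odot>\<^bsub>HomMod Mod M N\<^esub> a) \<circ>\<^sub>A e M x =
        (t \<odot>\<^bsub>HomMod A (FOb L M) (FOb L N)\<^esub> FArr L a) \<circ>\<^sub>A e M x" .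
  qed
qed

lemma Hom_valued_zero:
  assumes F: "F \<in> lmods" and M: "right_module R M" and N: "N \<in> Ob A"
    and g: "g \<in> lin_maps R M (Hom_rmodule A F N)"
  shows "g \<zero>\<^bsub>M\<^esub> = zero_arr A (fst F) N"
  using lin_maps_zero[OF M right_module_Hom[OF F N] g] by simp

text \<open>An arrow \<open>h\<close> out of \<open>L Y\<close> that kills \<open>L f\<close> transposes to a linear map that kills the image of
  \<open>f\<close>, which is the kernel of \<open>g\<close>; it descends along the surjection \<open>g\<close>, and the transpose of
  the resulting map on \<open>Z\<close> is the required factorisation.\<close>

lemma tensor_universal_right_exact:
  assumes F: "F \<in> lmods" and L: "tensor_universal F L e"
  shows "right_exact_functor Mod A L"
  unfolding right_exact_functor_def
proof (intro allI impI)
  note L_simps = tensor_universalD[OF L]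
  fix a c assume ac: "right_exact_seq Mod a c"
  then obtain X f Y g Z where a: "a = (X, f, Y)" and c: "c = (Y, g, Z)"
    using right_exact_seq_composable[OF ac] by (cases a; cases c) simp
  have seq: "right_exact_seq Mod (X, f, Y) (Y, g, Z)" using ac a c by simp
  note exact = Mod_right_exact_seqD[OF seq]
  have Arr: "(X, f, Y) \<in> Arr Mod" "(Y, g, Z) \<in> Arr Mod"
    using seq by (rule right_exact_seqE, blast)+
  then have f_Hom: "(X, f, Y) \<in> Hom Mod X Y" and g_Hom: "(Y, g, Z) \<in> Hom Mod Y Z"
    and X: "X \<in> Ob Mod" and Y: "Y \<in> Ob Mod" and Z: "Z \<in> Ob Mod"
    and f: "f \<in> lin_maps R X Y" and g: "g \<in> lin_maps R Y Z"
    and mods: "right_module R X" "right_module R Y" "right_module R Z" by simp_all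
  let ?f = "FArr L (X, f, Y)" and ?g = "FArr L (Y, g, Z)"
  note Lf = is_functorD(2)[OF L_simps(1) f_Hom] and Lg = is_functorD(2)[OF L_simps(1) g_Hom]
  note Lf_Arr = A.HomD[OF Lf] and Lg_Arr = A.HomD[OF Lg]
  have "is_cokernel A ?f ?g"
    unfolding is_cokernel_def
  proof (intro conjI ballI impI)
    show "?g \<circ>\<^sub>A ?f = zero_arr A (Dom A ?f) (Cod A ?g)"
      unfolding Lf_Arr Lg_Arr
    proof (rule tensor_universal_cancel[OF F L X A.Comp_Hom[OF Lf Lg] A.zero_Hom[OF Lf_Arr(4) Lg_Arr(5)]])
      fix x assume x: "x \<in> carrier X"
      note fx = lin_mapsD(2)[OF f x]
      have "(?g \<circ>\<^sub>A ?f) \<circ>\<^sub>A e X x = e Z (g (f x))"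
        using A.Comp_assoc[OF L_simps(6)[OF X x] Lf Lg] L_simps(3)[OF Arr(1) x] L_simps(3)[OF Arr(2) fx]
        by simp
      also have "\<dots> = zero_arr A (fst F) (FOb L Z)"
        using exact(2)[OF x] Hom_valued_zero[OF F mods(3) L_simps(5)[OF Z] L_simps(2)[OF Z]] by simp
      also have "\<dots> = zero_arr A (FOb L X) (FOb L Z) \<circ>\<^sub>A e X x"
        using A.zero_arr_comp[OF L_simps(6)[OF X x] L_simps(5)[OF Z]] by simp
      finally show "(?g \<circ>\<^sub>A ?f) \<circ>\<^sub>A e X x = zero_arr A (FOb L X) (FOb L Z) \<circ>\<^sub>A e X x" .
    qed
  next
    fix h assume h: "h \<in> Arr A" "Dom A h = Cod A ?f \<and> h \<circ>\<^sub>A ?f = zero_arr A (Dom A ?f) (Cod A h)"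
    let ?N = "Cod A h"
    have h_Hom: "h \<in> Hom A (FOb L Y) ?N" using h Lf_Arr by (simp add: Hom_def)
    have hf: "h \<circ>\<^sub>A ?f = zero_arr A (FOb L X) ?N" using h Lf_Arr by simp
    have N: "?N \<in> Ob A" using h(1) by simp
    define t where "t = (\<lambda>y\<in>carrier Y. h \<circ>\<^sub>A e Y y)"
    have t: "t \<in> lin_maps R Y (Hom_rmodule A F ?N)"
      unfolding t_def by (rule Hom_valued_postcomp[OF F mods(2) L_simps(2)[OF Y] h_Hom])
    have "t y = \<zero>\<^bsub>Hom_rmodule A F ?N\<^esub>" if y: "y \<in> carrier Y" "g y = \<zero>\<^bsub>Z\<^esub>" for y
    proof -
      obtain x where x: "x \<in> carrier X" "y = f x" using exact(3)[OF y] by blast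
      have "h \<circ>\<^sub>A e Y (f x) = (h \<circ>\<^sub>A ?f) \<circ>\<^sub>A e X x"
        using A.Comp_assoc[OF L_simps(6)[OF X x(1)] Lf h_Hom] L_simps(3)[OF Arr(1) x(1)] by simp
      also have "\<dots> = zero_arr A (fst F) ?N"
        unfolding hf by (rule A.zero_arr_comp[OF L_simps(6)[OF X x(1)] N])
      finally show ?thesis using y x by (simp add: t_def)
    qed
    then obtain u where u: "u \<in> lin_maps R Z (Hom_rmodule A F ?N)"
      and ug: "\<forall>y\<in>carrier Y. u (g y) = t y"
      using lin_maps_factor_surj[OF mods(2,3) right_module_Hom[OF F N] g exact(1) t] by blast
    have iff: "w \<circ>\<^sub>A ?g = h \<longleftrightarrow> (\<forall>z\<in>carrier Z. w \<circ>\<^sub>A e Z z = u z)" if w: "w \<in> Hom A (FOb L Z) ?N" for w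
    proof -
      have wg: "(w \<circ>\<^sub>A ?g) \<circ>\<^sub>A e Y y = w \<circ>\<^sub>A e Z (g y)" if y: "y \<in> carrier Y" for y
        using A.Comp_assoc[OF L_simps(6)[OF Y y] Lg w] L_simps(3)[OF Arr(2) y] by simp
      have ug': "u (g y) = h \<circ>\<^sub>A e Y y" if "y \<in> carrier Y" for y
        using ug that by (simp add: t_def)
      show ?thesis
      proof
        assume eq: "w \<circ>\<^sub>A ?g = h"
        show "\<forall>z\<in>carrier Z. w \<circ>\<^sub>A e Z z = u z"
        proof
          fix z assume "z \<in> carrier Z"
          then obtain y where y: "y \<in> carrier Y" "z = g y" using exact(1) by blast
          show "w \<circ>\<^sub>A e Z z = u z" using wg[OF y(1)] ug'[OF y(1)] eq y(2) by simp
        qed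
      next
        assume eq: "\<forall>z\<in>carrier Z. w \<circ>\<^sub>A e Z z = u z"
        show "w \<circ>\<^sub>A ?g = h"
        proof (rule tensor_universal_cancel[OF F L Y A.Comp_Hom[OF Lg w] h_Hom])
          fix y assume y: "y \<in> carrier Y"
          show "(w \<circ>\<^sub>A ?g) \<circ>\<^sub>A e Y y = h \<circ>\<^sub>A e Y y"
            using wg[OF y] ug'[OF y] bspec[OF eq lin_mapsD(2)[OF g y]] by simp
        qed
      qed
    qed
    have ex1: "\<exists>!w. w \<in> Hom A (FOb L Z) ?N \<and> (\<forall>z\<in>carrier Z. w \<circ>\<^sub>A e Z z = u z)"
      by (rule L_simps(4)[OF Z N u])
    then obtain w where w: "w \<in> Hom A (FOb L Z) ?N" "\<forall>z\<in>carrier Z. w \<circ>\<^sub>A e Z z = u z"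
      by (elim ex1E conjE)
    show "\<exists>!w. w \<in> Hom A (Cod A ?g) ?N \<and> w \<circ>\<^sub>A ?g = h"
      unfolding Lg_Arr
    proof (rule ex1I)
      show "w \<in> Hom A (FOb L Z) ?N \<and> w \<circ>\<^sub>A ?g = h" using w iff[OF w(1)] by simp
      fix v assume v: "v \<in> Hom A (FOb L Z) ?N \<and> v \<circ>\<^sub>A ?g = h"
      show "v = w" by (rule Ex1_eqI[OF ex1]) (use v w iff[of v] in simp_all)
    qed
  qed (use Lf_Arr Lg_Arr in simp_all)
  then show "right_exact_seq A (FArr L a) (FArr L c)"
    using A.right_exact_seq_iff_is_cokernel a c by simp
qed

text \<open>A cocone under the \<open>L (X i)\<close> transposes to a compatible family of linear maps into the module
  \<open>Hom(F, Y)\<close>, which need not be small.\<close>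

lemma tensor_universal_direct_limits:
  assumes F: "F \<in> lmods" and L: "tensor_universal F L e"
  shows "commutes_with_direct_limits TYPE('u) Mod A L"
  unfolding commutes_with_direct_limits_def
proof (intro allI impI)
  note L_simps = tensor_universalD[OF L]
  fix I :: "'u set" and ord X \<phi> S \<mu>
  assume asm: "small I \<and> direct_system Mod I ord X \<phi> \<and> is_direct_limit Mod I ord X \<phi> S \<mu>"
  interpret Mod_direct_limit R \<gamma> I ord X \<phi> S \<mu>
    using asm by (intro Mod_direct_limit.intro) simp_all
  have S: "S \<in> Ob Mod" using L_Mod by simp
  have X: "X i \<in> Ob Mod" if "i \<in> I" for i using X_Mod[OF that] by simp
  have \<mu>_Hom: "\<mu> i \<in> Hom Mod (X i) S" if "i \<in> I" for i
    using limit that unfolding is_direct_limit_def is_cocone_def by blast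
  have \<phi>_Hom: "\<phi> i j \<in> Hom Mod (X i) (X j)" if "(i, j) \<in> ord" for i j
    using system that unfolding direct_system_def by blast
  have ord: "i \<in> I" "j \<in> I" if "(i, j) \<in> ord" for i j
    using directed_setD(2)[OF directed that] by simp_all
  have L\<mu>: "FArr L (\<mu> i) \<in> Hom A (FOb L (X i)) (FOb L S)" if "i \<in> I" for i
    using is_functorD(2)[OF L_simps(1) \<mu>_Hom[OF that]] .
  have L\<mu>_e: "FArr L (\<mu> i) \<circ>\<^sub>A e (X i) x = e S (arrow_map (\<mu> i) x)"
    if i: "i \<in> I" and x: "x \<in> carrier (X i)" for i x
    using L_simps(3)[of "X i" "arrow_map (\<mu> i)" S x, folded \<mu>(1)[OF i]] \<mu>_Hom[OF i] x
    by (simp add: Hom_def)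
  have L\<phi>_e: "FArr L (\<phi> i j) \<circ>\<^sub>A e (X i) x = e (X j) (arrow_map (\<phi> i j) x)"
    if ij: "(i, j) \<in> ord" and x: "x \<in> carrier (X i)" for i j x
    using L_simps(3)[of "X i" "arrow_map (\<phi> i j)" "X j" x, folded \<phi>(1)[OF ij]] \<phi>_Hom[OF ij] x
    by (simp add: Hom_def)
  show "is_direct_limit A I ord (FOb L \<circ> X) (\<lambda>i j. FArr L (\<phi> i j)) (FOb L S) (FArr L \<circ> \<mu>)"
    unfolding is_direct_limit_def
  proof (intro conjI allI impI)
    show "is_cocone A I ord (FOb L \<circ> X) (\<lambda>i j. FArr L (\<phi> i j)) (FOb L S) (FArr L \<circ> \<mu>)"
      unfolding is_cocone_def
    proof (intro conjI ballI allI impI)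
      show "FOb L S \<in> Ob A" by (rule L_simps(5)[OF S])
      show "(FArr L \<circ> \<mu>) i \<in> Hom A ((FOb L \<circ> X) i) (FOb L S)" if "i \<in> I" for i
        using L\<mu>[OF that] by simp
      show "(FArr L \<circ> \<mu>) j \<circ>\<^sub>A FArr L (\<phi> i j) = (FArr L \<circ> \<mu>) i" if ij: "(i, j) \<in> ord" for i j
      proof -
        have "\<mu> j \<cdot>\<^bsub>Mod\<^esub> \<phi> i j = \<mu> i"
          using limit ij unfolding is_direct_limit_def is_cocone_def by blast
        then show ?thesis
          using is_functorD(4)[OF L_simps(1) \<phi>_Hom[OF ij] \<mu>_Hom[OF ord(2)[OF ij]]] by simp
      qed
    qed
    fix Y \<nu> assume co: "is_cocone A I ord (FOb L \<circ> X) (\<lambda>i j. FArr L (\<phi> i j)) Y \<nu>"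
    have Y: "Y \<in> Ob A" using co unfolding is_cocone_def by blast
    have \<nu>: "\<nu> i \<in> Hom A (FOb L (X i)) Y" if "i \<in> I" for i
      using co that unfolding is_cocone_def comp_apply by blast
    have \<nu>_compat: "\<nu> j \<circ>\<^sub>A FArr L (\<phi> i j) = \<nu> i" if "(i, j) \<in> ord" for i j
      using co that unfolding is_cocone_def by blast
    define m where "m i = (\<lambda>x\<in>carrier (X i). \<nu> i \<circ>\<^sub>A e (X i) x)" for i
    have m: "m i \<in> lin_maps R (X i) (Hom_rmodule A F Y)" if i: "i \<in> I" for i
      unfolding m_def by (rule Hom_valued_postcomp[OF F X_Mod(1)[OF i] L_simps(2)[OF X[OF i]] \<nu>[OF i]])
    have m_compat: "m j (arrow_map (\<phi> i j) x) = m i x"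
      if ij: "(i, j) \<in> ord" and x: "x \<in> carrier (X i)" for i j x
    proof -
      note o = ord[OF ij]
      have "\<nu> j \<circ>\<^sub>A e (X j) (arrow_map (\<phi> i j) x) = (\<nu> j \<circ>\<^sub>A FArr L (\<phi> i j)) \<circ>\<^sub>A e (X i) x"
        using A.Comp_assoc[OF L_simps(6)[OF X[OF o(1)] x] is_functorD(2)[OF L_simps(1) \<phi>_Hom[OF ij]] \<nu>[OF o(2)]]
          L\<phi>_e[OF ij x] by simp
      then show ?thesis
        using \<nu>_compat[OF ij] x lin_mapsD(2)[OF \<phi>(2)[OF ij] x] by (simp add: m_def)
    qed
    have "small I" using asm by blast
    then have "\<exists>g\<in>lin_maps R S (Hom_rmodule A F Y).
        \<forall>i\<in>I. \<forall>x\<in>carrier (X i). g (arrow_map (\<mu> i) x) = m i x"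
      by (rule ex_factor[OF infinite_universe regular_universe _ right_module_Hom[OF F Y]])
        (fact m m_compat)+
    then obtain g where g: "g \<in> lin_maps R S (Hom_rmodule A F Y)"
      and g\<mu>: "\<forall>i\<in>I. \<forall>x\<in>carrier (X i). g (arrow_map (\<mu> i) x) = m i x" by (elim bexE)
    have iff: "(\<forall>i\<in>I. h \<circ>\<^sub>A (FArr L \<circ> \<mu>) i = \<nu> i) \<longleftrightarrow> (\<forall>y\<in>carrier S. h \<circ>\<^sub>A e S y = g y)"
      if h: "h \<in> Hom A (FOb L S) Y" for h
    proof -
      have h\<mu>: "(h \<circ>\<^sub>A FArr L (\<mu> i)) \<circ>\<^sub>A e (X i) x = h \<circ>\<^sub>A e S (arrow_map (\<mu> i) x)"
        if i: "i \<in> I" and x: "x \<in> carrier (X i)" for i x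
        using A.Comp_assoc[OF L_simps(6)[OF X[OF i] x] L\<mu>[OF i] h] L\<mu>_e[OF i x] by simp
      have g\<nu>: "g (arrow_map (\<mu> i) x) = \<nu> i \<circ>\<^sub>A e (X i) x" if "i \<in> I" "x \<in> carrier (X i)" for i x
        using g\<mu> that by (simp add: m_def)
      show ?thesis
      proof
        assume eq: "\<forall>i\<in>I. h \<circ>\<^sub>A (FArr L \<circ> \<mu>) i = \<nu> i"
        show "\<forall>y\<in>carrier S. h \<circ>\<^sub>A e S y = g y"
        proof
          fix y assume "y \<in> carrier S"
          then obtain i x where x: "i \<in> I" "x \<in> carrier (X i)" "y = arrow_map (\<mu> i) x"
            using ex_preimage by blast
          show "h \<circ>\<^sub>A e S y = g y"
            using h\<mu>[OF x(1,2)] g\<nu>[OF x(1,2)] bspec[OF eq x(1)] x(3) by simp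
        qed
      next
        assume eq: "\<forall>y\<in>carrier S. h \<circ>\<^sub>A e S y = g y"
        show "\<forall>i\<in>I. h \<circ>\<^sub>A (FArr L \<circ> \<mu>) i = \<nu> i"
        proof
          fix i assume i: "i \<in> I"
          have "h \<circ>\<^sub>A FArr L (\<mu> i) = \<nu> i"
          proof (rule tensor_universal_cancel[OF F L X[OF i] A.Comp_Hom[OF L\<mu>[OF i] h] \<nu>[OF i]])
            fix x assume x: "x \<in> carrier (X i)"
            show "(h \<circ>\<^sub>A FArr L (\<mu> i)) \<circ>\<^sub>A e (X i) x = \<nu> i \<circ>\<^sub>A e (X i) x"
              using h\<mu>[OF i x] g\<nu>[OF i x] bspec[OF eq lin_mapsD(2)[OF \<mu>(2)[OF i] x]] by simp
          qed
          then show "h \<circ>\<^sub>A (FArr L \<circ> \<mu>) i = \<nu> i" by simp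
        qed
      qed
    qed
    have ex1: "\<exists>!h. h \<in> Hom A (FOb L S) Y \<and> (\<forall>y\<in>carrier S. h \<circ>\<^sub>A e S y = g y)"
      by (rule L_simps(4)[OF S Y g])
    then obtain h where h: "h \<in> Hom A (FOb L S) Y" "\<forall>y\<in>carrier S. h \<circ>\<^sub>A e S y = g y"
      by (elim ex1E conjE)
    show "\<exists>!h. h \<in> Hom A (FOb L S) Y \<and> (\<forall>i\<in>I. h \<circ>\<^sub>A (FArr L \<circ> \<mu>) i = \<nu> i)"
    proof (rule ex1I)
      show "h \<in> Hom A (FOb L S) Y \<and> (\<forall>i\<in>I. h \<circ>\<^sub>A (FArr L \<circ> \<mu>) i = \<nu> i)"
        using h(2) unfolding iff[OF h(1)] using h(1) by blast
      fix v assume v: "v \<in> Hom A (FOb L S) Y \<and> (\<forall>i\<in>I. v \<circ>\<^sub>A (FArr L \<circ> \<mu>) i = \<nu> i)"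
      then have "\<forall>y\<in>carrier S. v \<circ>\<^sub>A e S y = g y" using iff[of v] by blast
      then show "v = h" using v h by (intro Ex1_eqI[OF ex1]) blast+
    qed
  qed
qed

subsection \<open>Comparison of tensor functors\<close>

text \<open>A homomorphism \<open>\<phi>\<close> from \<open>F\<close> to \<open>G\<close> turns the universal maps of \<open>G\<close> into linear maps to modules
  of arrows out of \<open>F\<close>, which factor through the universal maps of \<open>F\<close>.\<close>

lemma ex1_comparison:
  assumes F: "F \<in> lmods" and G: "G \<in> lmods" and \<phi>: "is_lmod_hom F \<phi> G"
    and L: "tensor_universal F L e" and L': "tensor_universal G L' e'" and M: "M \<in> Ob Mod"
  shows "\<exists>!u. u \<in> Hom A (FOb L M) (FOb L' M) \<and> (\<forall>x\<in>carrier M. u \<circ>\<^sub>A e M x = e' M x \<circ>\<^sub>A \<phi>)"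
proof -
  have "right_module R M" using M by simp
  from tensor_universalD(4)[OF L M tensor_universalD(5)[OF L' M]
      Hom_valued_precomp[OF F G \<phi> this tensor_universalD(2)[OF L' M]]]
  show ?thesis by simp
qed

lemma comparison_natural:
  assumes F: "F \<in> lmods" and G: "G \<in> lmods" and \<phi>: "is_lmod_hom F \<phi> G"
    and L: "tensor_universal F L e" and L': "tensor_universal G L' e'"
    and u: "\<And>M. M \<in> Ob Mod \<Longrightarrow> u M \<in> Hom A (FOb L M) (FOb L' M)"
    and ue: "\<And>M x. \<lbrakk>M \<in> Ob Mod; x \<in> carrier M\<rbrakk> \<Longrightarrow> u M \<circ>\<^sub>A e M x = e' M x \<circ>\<^sub>A \<phi>"
    and ext: "u \<in> extensional (Ob Mod)"
  shows "nat_transf Mod A L L' u"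
  unfolding nat_transf_def
proof (intro conjI ballI allI)
  note L_simps = tensor_universalD[OF L] and L'_simps = tensor_universalD[OF L']
  fix M N a assume a: "a \<in> Hom Mod M N"
  then obtain f where f: "a = (M, f, N)" "f \<in> lin_maps R M N" "right_module R M" "small (carrier M)"
    "right_module R N" "small (carrier N)" by (rule HomE_Mod)
  then have M: "M \<in> Ob Mod" and N: "N \<in> Ob Mod" and Arr: "(M, f, N) \<in> Arr Mod" by simp_all
  note La = is_functorD(2)[OF L_simps(1) a] and L'a = is_functorD(2)[OF L'_simps(1) a]
  have \<phi>_Hom: "\<phi> \<in> Hom A (fst F) (fst G)" using \<phi> by (simp add: is_lmod_hom_def)
  show "u N \<circ>\<^sub>A FArr L a = FArr L' a \<circ>\<^sub>A u M"
  proof (rule tensor_universal_cancel[OF F L M A.Comp_Hom[OF La u[OF N]] A.Comp_Hom[OF u[OF M] L'a]])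
    fix x assume x: "x \<in> carrier M"
    have "(u N \<circ>\<^sub>A FArr L a) \<circ>\<^sub>A e M x = u N \<circ>\<^sub>A e N (f x)"
      using A.Comp_assoc[OF L_simps(6)[OF M x] La u[OF N]] L_simps(3)[OF Arr x] f(1) by simp
    also have "\<dots> = (FArr L' a \<circ>\<^sub>A e' M x) \<circ>\<^sub>A \<phi>"
      using ue[OF N lin_mapsD(2)[OF f(2) x]] L'_simps(3)[OF Arr x] f(1) by simp
    also have "\<dots> = FArr L' a \<circ>\<^sub>A (u M \<circ>\<^sub>A e M x)"
      using A.Comp_assoc[OF \<phi>_Hom L'_simps(6)[OF M x] L'a] ue[OF M x] by simp
    also have "\<dots> = (FArr L' a \<circ>\<^sub>A u M) \<circ>\<^sub>A e M x"
      using A.Comp_assoc[OF L_simps(6)[OF M x] u[OF M] L'a] by simp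
    finally show "(u N \<circ>\<^sub>A FArr L a) \<circ>\<^sub>A e M x = (FArr L' a \<circ>\<^sub>A u M) \<circ>\<^sub>A e M x" .
  qed
qed (use u ext in blast)+

end

section \<open>The free module on one generator\<close>

context tensor_setting
begin

text \<open>The map from the free module \<open>B\<close> that sends its generator \<open>b\<close> to \<open>x\<close>.\<close>

definition hat :: "('m, 'r) rmodule \<Rightarrow> 'm \<Rightarrow> 'u \<Rightarrow> 'm" where
  "hat M x = (\<lambda>y\<in>carrier B. x \<triangleleft>\<^bsub>M\<^esub> inv_into (carrier R) (\<lambda>r. b \<triangleleft>\<^bsub>B\<^esub> r) y)"

lemma b_ract_closed: "r \<in> carrier R \<Longrightarrow> b \<triangleleft>\<^bsub>B\<^esub> r \<in> carrier B"
  using right_module.ract_closed[OF B_Mod(1) b_closed] .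

lemma B_cases:
  assumes "y \<in> carrier B"
  obtains r where "r \<in> carrier R" "y = b \<triangleleft>\<^bsub>B\<^esub> r"
  using assms bij_betw_imp_surj_on[OF b_free] by blast

lemma hat_ract:
  assumes "r \<in> carrier R"
  shows "hat M x (b \<triangleleft>\<^bsub>B\<^esub> r) = x \<triangleleft>\<^bsub>M\<^esub> r"
  using inv_into_f_f[OF bij_betw_imp_inj_on[OF b_free] assms] b_ract_closed[OF assms]
  by (simp add: hat_def)

lemma hat_lin:
  assumes M: "right_module R M" and x: "x \<in> carrier M"
  shows "hat M x \<in> lin_maps R B M"
proof -
  interpret M: right_module R M by fact
  interpret B: right_module R B by (rule B_Mod(1))
  show ?thesis
  proof (rule lin_mapsI)
    show "hat M x \<in> extensional (carrier B)" by (simp add: hat_def)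
  next
    fix y assume "y \<in> carrier B"
    then obtain r where r: "r \<in> carrier R" "y = b \<triangleleft>\<^bsub>B\<^esub> r" by (rule B_cases)
    then show "hat M x y \<in> carrier M" using M.ract_closed[OF x] by (simp add: hat_ract)
  next
    fix y z assume "y \<in> carrier B" "z \<in> carrier B"
    then obtain r s where r: "r \<in> carrier R" "y = b \<triangleleft>\<^bsub>B\<^esub> r" and s: "s \<in> carrier R" "z = b \<triangleleft>\<^bsub>B\<^esub> s"
      using B_cases by metis
    then show "hat M x (y \<oplus>\<^bsub>B\<^esub> z) = hat M x y \<oplus>\<^bsub>M\<^esub> hat M x z"
      using hat_ract[OF alg.R.a_closed[OF r(1) s(1)], of M x] M.ract_add_right[OF x r(1) s(1)]
        B.ract_add_right[OF b_closed r(1) s(1)] by (simp add: hat_ract)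
  next
    fix y s assume "y \<in> carrier B" and s: "s \<in> carrier R"
    then obtain r where r: "r \<in> carrier R" "y = b \<triangleleft>\<^bsub>B\<^esub> r" using B_cases by metis
    then show "hat M x (y \<triangleleft>\<^bsub>B\<^esub> s) = hat M x y \<triangleleft>\<^bsub>M\<^esub> s"
      using hat_ract[OF alg.R.m_closed[OF r(1) s(1)], of M x] M.ract_mult[OF x r(1) s(1)]
        B.ract_mult[OF b_closed r(1) s(1)] by (simp add: hat_ract)
  qed
qed

lemma hat_b: "right_module R M \<Longrightarrow> x \<in> carrier M \<Longrightarrow> hat M x b = x"
  using hat_ract[OF alg.R.one_closed, of M x] right_module.ract_one[OF B_Mod(1) b_closed]
    right_module.ract_one[of R M x] by simp

lemma hat_unique:
  assumes "f \<in> lin_maps R B M"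
  shows "hat M (f b) = f"
proof (rule extensionalityI[of _ "carrier B"])
  fix y assume "y \<in> carrier B"
  then obtain r where "r \<in> carrier R" "y = b \<triangleleft>\<^bsub>B\<^esub> r" by (rule B_cases)
  then show "hat M (f b) y = f y" using lin_mapsD(4)[OF assms b_closed] by (simp add: hat_ract)
qed (use lin_mapsD(1)[OF assms] in \<open>simp_all add: hat_def\<close>)

lemma hat_compose:
  assumes M: "right_module R M" and x: "x \<in> carrier M" and f: "f \<in> lin_maps R M N"
  shows "compose (carrier B) f (hat M x) = hat N (f x)"
  using hat_unique[OF lin_maps_compose[OF B_Mod(1) hat_lin[OF M x] f]] b_closed hat_b[OF M x] by simp

lemma B_Ob: "B \<in> Ob Mod"
  using B_Mod by simp

lemma hat_Hom: "\<lbrakk>M \<in> Ob Mod; x \<in> carrier M\<rbrakk> \<Longrightarrow> (B, hat M x, M) \<in> Hom Mod B M"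
  using B_Mod hat_lin[of M x] by simp

end

section \<open>Right exact functors that commute with direct limits are tensor functors\<close>

text \<open>Such a functor \<open>T\<close> is shown to be the tensor functor of the object \<open>T B\<close>, on which \<open>r \<in> R\<close> acts
  through the endomorphism \<open>b \<mapsto> b r\<close> of \<open>B\<close>.  Its universal arrows \<open>T B \<rightarrow> T M\<close> are the images of
  the maps \<open>B \<rightarrow> M\<close> that pick out the elements of \<open>M\<close>.\<close>

locale right_exact_continuous_functor = tensor_setting k R \<gamma> A B b
  for k :: "('k, 'l) ring_scheme" and R :: "('r, 's) ring_scheme" and \<gamma> :: "'k \<Rightarrow> 'r"
    and A :: "('o, 'a, 'k) lcategory" and B :: "('u, 'r) rmodule" and b :: 'u +
  fixes T :: "(('u, 'r) rmodule, ('u, 'r) rmod_arr, 'o, 'a) cfunctor"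
  assumes is_functor: "is_functor Mod A T"
    and linear: "linear_functor k Mod A T"
    and right_exact: "right_exact_functor Mod A T"
    and direct_limits: "commutes_with_direct_limits TYPE('u) Mod A T"
begin

lemmas T_Ob = is_functorD(1)[OF is_functor]
  and T_Hom = is_functorD(2)[OF is_functor]
  and T_Id = is_functorD(3)[OF is_functor]
  and T_Comp = is_functorD(4)[OF is_functor]

lemma T_add: "\<lbrakk>f \<in> Hom Mod M N; g \<in> Hom Mod M N\<rbrakk> \<Longrightarrow>
    FArr T (f \<oplus>\<^bsub>HomMod Mod M N\<^esub> g) = FArr T f \<oplus>\<^bsub>HomMod A (FOb T M) (FOb T N)\<^esub> FArr T g"
  using linear by (simp add: linear_functor_def)

definition act :: "'r \<Rightarrow> 'a" where
  "act = (\<lambda>r\<in>carrier R. FArr T (B, hat B (b \<triangleleft>\<^bsub>B\<^esub> r), B))"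

definition T_lmod :: "('o, 'a, 'r) lmod" where
  "T_lmod = (FOb T B, act)"

definition elt :: "('u, 'r) rmodule \<Rightarrow> 'u \<Rightarrow> 'a" where
  "elt M = (\<lambda>x\<in>carrier M. FArr T (B, hat M x, M))"

lemma fst_T_lmod [simp]: "fst T_lmod = FOb T B" and snd_T_lmod: "snd T_lmod = act"
  by (simp_all add: T_lmod_def)

lemma elt_Hom: "\<lbrakk>M \<in> Ob Mod; x \<in> carrier M\<rbrakk> \<Longrightarrow> elt M x \<in> Hom A (FOb T B) (FOb T M)"
  using T_Hom[OF hat_Hom] by (simp add: elt_def)

lemma elt_natural:
  assumes f: "(M, f, N) \<in> Hom Mod M N" and x: "x \<in> carrier M"
  shows "FArr T (M, f, N) \<circ>\<^sub>A elt M x = elt N (f x)"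
proof -
  have M: "M \<in> Ob Mod" and M_mod: "right_module R M" and f_lin: "f \<in> lin_maps R M N" using f by simp_all
  show ?thesis
    using T_Comp[OF hat_Hom[OF M x] f] hat_compose[OF M_mod x f_lin] x lin_mapsD(2)[OF f_lin x]
    by (simp add: elt_def)
qed

lemma act_eq_elt: "r \<in> carrier R \<Longrightarrow> act r = elt B (b \<triangleleft>\<^bsub>B\<^esub> r)"
  by (simp add: act_def elt_def b_ract_closed)

lemma elt_ract:
  assumes M: "M \<in> Ob Mod" and x: "x \<in> carrier M" and r: "r \<in> carrier R"
  shows "elt M (x \<triangleleft>\<^bsub>M\<^esub> r) = elt M x \<circ>\<^sub>A act r"
  using elt_natural[OF hat_Hom[OF M x] b_ract_closed[OF r]] x
  by (simp add: act_eq_elt[OF r] hat_ract[OF r]) (simp add: elt_def)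

text \<open>The sum of the maps picking out \<open>x\<close> and \<open>y\<close> picks out \<open>x + y\<close>, and \<open>T\<close> is additive.\<close>

lemma elt_add:
  assumes M: "M \<in> Ob Mod" and x: "x \<in> carrier M" and y: "y \<in> carrier M"
  shows "elt M (x \<oplus>\<^bsub>M\<^esub> y) = elt M x \<oplus>\<^bsub>HomMod A (FOb T B) (FOb T M)\<^esub> elt M y"
proof -
  have M_mod: "right_module R M" using M by simp
  interpret M: right_module R M by fact
  let ?s = "\<lambda>z\<in>carrier B. hat M x z \<oplus>\<^bsub>M\<^esub> hat M y z"
  have "?s \<in> lin_maps R B M"
    by (rule right_module_lin_maps_ops(2)[OF B_Mod(1) M_mod hat_lin[OF M_mod x] hat_lin[OF M_mod y]])
  from hat_unique[OF this] have "hat M (x \<oplus>\<^bsub>M\<^esub> y) = ?s"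
    using b_closed hat_b[OF M_mod] x y by simp
  then show ?thesis
    using T_add[OF hat_Hom[OF M x] hat_Hom[OF M y]] x y by (simp add: elt_def)
qed

lemma elt_b: "elt B b = Id A (FOb T B)"
proof -
  have "(\<lambda>y\<in>carrier B. y) \<in> lin_maps R B B" using right_module.lin_maps_id[OF B_Mod(1)] .
  from hat_unique[OF this] have "hat B b = (\<lambda>y\<in>carrier B. y)" using b_closed by simp
  then show ?thesis using T_Id[OF B_Ob] b_closed by (simp add: elt_def)
qed

lemma T_lmod: "T_lmod \<in> lmods"
proof -
  interpret B: right_module R B by (rule B_Mod(1))
  have act_Hom: "act r \<in> Hom A (FOb T B) (FOb T B)" if "r \<in> carrier R" for r
    using elt_Hom[OF B_Ob b_ract_closed[OF that]] act_eq_elt[OF that] by simp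
  have "act \<in> ring_hom R (End_ring A (FOb T B))"
  proof (rule ring_hom_memI)
    show "act r \<in> carrier (End_ring A (FOb T B))" if "r \<in> carrier R" for r
      using act_Hom[OF that] by (simp add: End_ring_def)
    show "act (r \<otimes>\<^bsub>R\<^esub> s) = act r \<otimes>\<^bsub>End_ring A (FOb T B)\<^esub> act s"
      if r: "r \<in> carrier R" and s: "s \<in> carrier R" for r s
      using elt_ract[OF B_Ob b_ract_closed[OF r] s] B.ract_mult[OF b_closed r s]
        act_eq_elt[OF r] act_eq_elt[OF alg.R.m_closed[OF r s]] by (simp add: End_ring_def)
    show "act (r \<oplus>\<^bsub>R\<^esub> s) = act r \<oplus>\<^bsub>End_ring A (FOb T B)\<^esub> act s"
      if r: "r \<in> carrier R" and s: "s \<in> carrier R" for r s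
      using elt_add[OF B_Ob b_ract_closed[OF r] b_ract_closed[OF s]] B.ract_add_right[OF b_closed r s]
        act_eq_elt[OF r] act_eq_elt[OF s] act_eq_elt[OF alg.R.a_closed[OF r s]]
      by (simp add: End_ring_def)
    show "act \<one>\<^bsub>R\<^esub> = \<one>\<^bsub>End_ring A (FOb T B)\<^esub>"
      using act_eq_elt[OF alg.R.one_closed] B.ract_one[OF b_closed] elt_b by (simp add: End_ring_def)
  qed
  moreover have "act (\<gamma> a) = a \<odot>\<^bsub>HomMod A (FOb T B) (FOb T B)\<^esub> Id A (FOb T B)"
    if a: "a \<in> carrier k" for a
  proof -
    note ga = \<gamma>_closed[OF a]
    \<comment> \<open>Left and right multiplication by the central element \<open>\<gamma> a\<close> agree.\<close>
    have "hat B (b \<triangleleft>\<^bsub>B\<^esub> \<gamma> a) = (\<lambda>y\<in>carrier B. (\<lambda>y\<in>carrier B. y) y \<triangleleft>\<^bsub>B\<^esub> \<gamma> a)"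
    proof (rule extensionalityI[of _ "carrier B"])
      fix y assume y: "y \<in> carrier B"
      then obtain r where r: "r \<in> carrier R" "y = b \<triangleleft>\<^bsub>B\<^esub> r" by (rule B_cases)
      show "hat B (b \<triangleleft>\<^bsub>B\<^esub> \<gamma> a) y = (\<lambda>y\<in>carrier B. (\<lambda>y\<in>carrier B. y) y \<triangleleft>\<^bsub>B\<^esub> \<gamma> a) y"
        using y r B.ract_mult[OF b_closed ga r(1)] B.ract_mult[OF b_closed r(1) ga]
          alg.structure_map_central[OF a r(1)] by (simp add: hat_ract)
    qed (simp_all add: hat_def)
    moreover have "Id Mod B \<in> Hom Mod B B" using category.Id_Hom[OF category_Mod B_Ob] .
    then have "FArr T (a \<odot>\<^bsub>HomMod Mod B B\<^esub> Id Mod B) = a \<odot>\<^bsub>HomMod A (FOb T B) (FOb T B)\<^esub> FArr T (Id Mod B)"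
      using linear a unfolding linear_functor_def by blast
    ultimately show ?thesis
      using T_Id[OF B_Ob] ga by (simp add: act_def)
  qed
  ultimately show ?thesis
    using T_Ob[OF B_Ob] unfolding lmods_in_def T_lmod_def by (simp add: act_def)
qed

lemma elt_lin:
  assumes M: "M \<in> Ob Mod"
  shows "elt M \<in> lin_maps R M (Hom_rmodule A T_lmod (FOb T M))"
proof (rule lin_mapsI)
  show "elt M \<in> extensional (carrier M)" by (simp add: elt_def)
qed (use elt_Hom[OF M] elt_add[OF M] elt_ract[OF M] in \<open>simp_all add: snd_T_lmod\<close>)

subsection \<open>The arrows \<open>elt M x\<close> are jointly epi\<close>

text \<open>This is the uniqueness part of universality.  It comes first, for all modules at once, because
  the existence part for a quotient uses it for the kernel.\<close>

definition jointly_epi :: "('u, 'r) rmodule \<Rightarrow> bool" where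
  "jointly_epi M \<longleftrightarrow> (\<forall>N. \<forall>h\<in>Hom A (FOb T M) N. \<forall>h'\<in>Hom A (FOb T M) N.
     (\<forall>x\<in>carrier M. h \<circ>\<^sub>A elt M x = h' \<circ>\<^sub>A elt M x) \<longrightarrow> h = h')"

lemma jointly_epiD:
  assumes "jointly_epi M" "h \<in> Hom A (FOb T M) N" "h' \<in> Hom A (FOb T M) N"
    and "\<And>x. x \<in> carrier M \<Longrightarrow> h \<circ>\<^sub>A elt M x = h' \<circ>\<^sub>A elt M x"
  shows "h = h'"
  using assms unfolding jointly_epi_def by blast

lemma comp_T_elt:
  assumes f: "(M, f, N) \<in> Hom Mod M N" and x: "x \<in> carrier M" and h: "h \<in> Hom A (FOb T N) Y"
  shows "(h \<circ>\<^sub>A FArr T (M, f, N)) \<circ>\<^sub>A elt M x = h \<circ>\<^sub>A elt N (f x)"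
proof -
  have M: "M \<in> Ob Mod" using f by simp
  show ?thesis using A.Comp_assoc[OF elt_Hom[OF M x] T_Hom[OF f] h] elt_natural[OF f x] by simp
qed

lemma jointly_epi_B: "jointly_epi B"
  unfolding jointly_epi_def
proof (intro allI ballI impI)
  fix N h h' assume h: "h \<in> Hom A (FOb T B) N" and h': "h' \<in> Hom A (FOb T B) N"
    and eq: "\<forall>x\<in>carrier B. h \<circ>\<^sub>A elt B x = h' \<circ>\<^sub>A elt B x"
  then have "h \<circ>\<^sub>A Id A (FOb T B) = h' \<circ>\<^sub>A Id A (FOb T B)"
    using bspec[OF eq b_closed] by (simp only: elt_b)
  then show "h = h'" using A.Comp_Id_right[OF h] A.Comp_Id_right[OF h'] by simp
qed

text \<open>Additive functors preserve the decomposition of the identity of a biproduct.\<close>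

lemma T_product_decompose:
  assumes i1: "(M, i1, P) \<in> Hom Mod M P" and i2: "(N, i2, P) \<in> Hom Mod N P"
    and p1: "(P, p1, M) \<in> Hom Mod P M" and p2: "(P, p2, N) \<in> Hom Mod P N"
    and dec: "\<forall>z\<in>carrier P. i1 (p1 z) \<oplus>\<^bsub>P\<^esub> i2 (p2 z) = z"
    and w: "w \<in> Hom A (FOb T P) Y"
  shows "w = ((w \<circ>\<^sub>A FArr T (M, i1, P)) \<circ>\<^sub>A FArr T (P, p1, M))
    \<oplus>\<^bsub>HomMod A (FOb T P) Y\<^esub> ((w \<circ>\<^sub>A FArr T (N, i2, P)) \<circ>\<^sub>A FArr T (P, p2, N))"
proof -
  have P: "P \<in> Ob Mod" using i1 by simp
  have c1: "(P, compose (carrier P) i1 p1, P) \<in> Hom Mod P P"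
    and c2: "(P, compose (carrier P) i2 p2, P) \<in> Hom Mod P P"
    using category.Comp_Hom[OF category_Mod p1 i1] category.Comp_Hom[OF category_Mod p2 i2]
    by simp_all
  have "Id Mod P = (P, compose (carrier P) i1 p1, P) \<oplus>\<^bsub>HomMod Mod P P\<^esub> (P, compose (carrier P) i2 p2, P)"
    using dec by (simp cong: restrict_cong)
  then have "Id A (FOb T P) = FArr T (P, compose (carrier P) i1 p1, P)
      \<oplus>\<^bsub>HomMod A (FOb T P) (FOb T P)\<^esub> FArr T (P, compose (carrier P) i2 p2, P)"
    using T_Id[OF P] T_add[OF c1 c2] by simp
  moreover have "FArr T (P, compose (carrier P) i1 p1, P) = FArr T (M, i1, P) \<circ>\<^sub>A FArr T (P, p1, M)"
    "FArr T (P, compose (carrier P) i2 p2, P) = FArr T (N, i2, P) \<circ>\<^sub>A FArr T (P, p2, N)"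
    using T_Comp[OF p1 i1] T_Comp[OF p2 i2] by simp_all
  ultimately have id: "Id A (FOb T P) = (FArr T (M, i1, P) \<circ>\<^sub>A FArr T (P, p1, M))
      \<oplus>\<^bsub>HomMod A (FOb T P) (FOb T P)\<^esub> (FArr T (N, i2, P) \<circ>\<^sub>A FArr T (P, p2, N))" by simp
  have "w = w \<circ>\<^sub>A Id A (FOb T P)" using A.Comp_Id_right[OF w] by simp
  also have "\<dots> = (w \<circ>\<^sub>A (FArr T (M, i1, P) \<circ>\<^sub>A FArr T (P, p1, M)))
      \<oplus>\<^bsub>HomMod A (FOb T P) Y\<^esub> (w \<circ>\<^sub>A (FArr T (N, i2, P) \<circ>\<^sub>A FArr T (P, p2, N)))"
    unfolding id
    by (rule A.Comp_add_right[OF A.Comp_Hom[OF T_Hom[OF p1] T_Hom[OF i1]]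
          A.Comp_Hom[OF T_Hom[OF p2] T_Hom[OF i2]] w])
  also have "\<dots> = ((w \<circ>\<^sub>A FArr T (M, i1, P)) \<circ>\<^sub>A FArr T (P, p1, M))
    \<oplus>\<^bsub>HomMod A (FOb T P) Y\<^esub> ((w \<circ>\<^sub>A FArr T (N, i2, P)) \<circ>\<^sub>A FArr T (P, p2, N))"
    using A.Comp_assoc[OF T_Hom[OF p1] T_Hom[OF i1] w] A.Comp_assoc[OF T_Hom[OF p2] T_Hom[OF i2] w]
    by simp
  finally show ?thesis .
qed

lemma jointly_epi_product:
  assumes i1: "(M, i1, P) \<in> Hom Mod M P" and i2: "(N, i2, P) \<in> Hom Mod N P"
    and p1: "(P, p1, M) \<in> Hom Mod P M" and p2: "(P, p2, N) \<in> Hom Mod P N"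
    and dec: "\<forall>z\<in>carrier P. i1 (p1 z) \<oplus>\<^bsub>P\<^esub> i2 (p2 z) = z"
    and M: "jointly_epi M" and N: "jointly_epi N"
  shows "jointly_epi P"
  unfolding jointly_epi_def
proof (intro allI ballI impI)
  fix Y h h' assume h: "h \<in> Hom A (FOb T P) Y" and h': "h' \<in> Hom A (FOb T P) Y"
    and eq: "\<forall>x\<in>carrier P. h \<circ>\<^sub>A elt P x = h' \<circ>\<^sub>A elt P x"
  have "h \<circ>\<^sub>A FArr T (M, i1, P) = h' \<circ>\<^sub>A FArr T (M, i1, P)"
  proof (rule jointly_epiD[OF M A.Comp_Hom[OF T_Hom[OF i1] h] A.Comp_Hom[OF T_Hom[OF i1] h']])
    fix x assume x: "x \<in> carrier M"
    have "i1 x \<in> carrier P" using i1 lin_mapsD(2)[of i1 R M P, OF _ x] by simp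
    from bspec[OF eq this]
    show "(h \<circ>\<^sub>A FArr T (M, i1, P)) \<circ>\<^sub>A elt M x = (h' \<circ>\<^sub>A FArr T (M, i1, P)) \<circ>\<^sub>A elt M x"
      unfolding comp_T_elt[OF i1 x h] comp_T_elt[OF i1 x h'] .
  qed
  moreover have "h \<circ>\<^sub>A FArr T (N, i2, P) = h' \<circ>\<^sub>A FArr T (N, i2, P)"
  proof (rule jointly_epiD[OF N A.Comp_Hom[OF T_Hom[OF i2] h] A.Comp_Hom[OF T_Hom[OF i2] h']])
    fix x assume x: "x \<in> carrier N"
    have "i2 x \<in> carrier P" using i2 lin_mapsD(2)[of i2 R N P, OF _ x] by simp
    from bspec[OF eq this]
    show "(h \<circ>\<^sub>A FArr T (N, i2, P)) \<circ>\<^sub>A elt N x = (h' \<circ>\<^sub>A FArr T (N, i2, P)) \<circ>\<^sub>A elt N x"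
      unfolding comp_T_elt[OF i2 x h] comp_T_elt[OF i2 x h'] .
  qed
  ultimately show "h = h'"
    using T_product_decompose[OF i1 i2 p1 p2 dec h] T_product_decompose[OF i1 i2 p1 p2 dec h'] by simp
qed

lemma T_cokernel:
  assumes s: "(P, s, M) \<in> Hom Mod P M" and surj: "s ` carrier P = carrier M"
    and K_def: "K = {z \<in> carrier P. s z = \<zero>\<^bsub>M\<^esub>}"
  shows "is_cokernel A (FArr T (P\<lparr>carrier := K\<rparr>, \<lambda>z\<in>K. z, P)) (FArr T (P, s, M))"
    and "(P\<lparr>carrier := K\<rparr>, \<lambda>z\<in>K. z, P) \<in> Hom Mod (P\<lparr>carrier := K\<rparr>) P"
proof -
  have P: "right_module R P" "small (carrier P)" and M: "right_module R M" "small (carrier M)"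
    and s_lin: "s \<in> lin_maps R P M" using s by simp_all
  have "right_exact_seq Mod (P\<lparr>carrier := K\<rparr>, \<lambda>z\<in>K. z, P) (P, s, M)"
    by (rule Mod_right_exact_seq_kernel[OF P M s_lin surj K_def])
  then show "is_cokernel A (FArr T (P\<lparr>carrier := K\<rparr>, \<lambda>z\<in>K. z, P)) (FArr T (P, s, M))"
    using right_exact A.right_exact_seq_iff_is_cokernel unfolding right_exact_functor_def by blast
  have K: "is_submodule R P K" unfolding K_def by (rule is_submodule_kernel[OF P(1) M(1) s_lin])
  have "small K" using small_subset[OF P(2)] K_def by auto
  then show "(P\<lparr>carrier := K\<rparr>, \<lambda>z\<in>K. z, P) \<in> Hom Mod (P\<lparr>carrier := K\<rparr>) P"
    using right_module_submodule[OF P(1) K] lin_maps_inclusion[OF K] P by simp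
qed

lemma jointly_epi_quotient:
  assumes s: "(P, s, M) \<in> Hom Mod P M" and surj: "s ` carrier P = carrier M" and P: "jointly_epi P"
  shows "jointly_epi M"
  unfolding jointly_epi_def
proof (intro allI ballI impI)
  fix Y h h' assume h: "h \<in> Hom A (FOb T M) Y" and h': "h' \<in> Hom A (FOb T M) Y"
    and eq: "\<forall>x\<in>carrier M. h \<circ>\<^sub>A elt M x = h' \<circ>\<^sub>A elt M x"
  note Ts = A.HomD[OF T_Hom[OF s]]
  have "h \<circ>\<^sub>A FArr T (P, s, M) = h' \<circ>\<^sub>A FArr T (P, s, M)"
  proof (rule jointly_epiD[OF P A.Comp_Hom[OF T_Hom[OF s] h] A.Comp_Hom[OF T_Hom[OF s] h']])
    fix z assume z: "z \<in> carrier P"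
    then have "s z \<in> carrier M" using surj by blast
    from bspec[OF eq this]
    show "(h \<circ>\<^sub>A FArr T (P, s, M)) \<circ>\<^sub>A elt P z = (h' \<circ>\<^sub>A FArr T (P, s, M)) \<circ>\<^sub>A elt P z"
      unfolding comp_T_elt[OF s z h] comp_T_elt[OF s z h'] .
  qed
  then show "h = h'"
    using A.is_cokernel_cancel[OF T_cokernel(1)[OF s surj refl]] h h' Ts by simp
qed

lemma T_zero_module:
  assumes M: "M \<in> Ob Mod" and zero: "carrier M = {\<zero>\<^bsub>M\<^esub>}" and h: "h \<in> Hom A (FOb T M) Y"
  shows "h = zero_arr A (FOb T M) Y"
proof -
  have M_mod: "right_module R M" using M by simp
  interpret M: right_module R M by fact
  have id: "Id Mod M \<in> Hom Mod M M" using category.Id_Hom[OF category_Mod M] .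
  have "Id Mod M \<oplus>\<^bsub>HomMod Mod M M\<^esub> Id Mod M = Id Mod M"
    using zero by (auto simp: fun_eq_iff)
  then have "Id A (FOb T M) \<oplus>\<^bsub>HomMod A (FOb T M) (FOb T M)\<^esub> Id A (FOb T M) = Id A (FOb T M)"
    using T_add[OF id id] T_Id[OF M] by simp
  then have "Id A (FOb T M) = zero_arr A (FOb T M) (FOb T M)"
    by (rule A.double_eq_zero_arr[OF A.Id_Hom[OF T_Ob[OF M]]])
  then have "h = h \<circ>\<^sub>A zero_arr A (FOb T M) (FOb T M)" using A.Comp_Id_right[OF h] by simp
  then show ?thesis using A.comp_zero_arr[OF h T_Ob[OF M]] by simp
qed

text \<open>The submodule generated by \<open>U\<close> and \<open>x\<close> is a quotient of the product of \<open>U\<close> and \<open>B\<close>.\<close>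

lemma ex_adjoin_generator:
  fixes U x
  assumes M: "M \<in> Ob Mod" and U: "is_submodule R M U" and x: "x \<in> carrier M"
  defines "MU \<equiv> M\<lparr>carrier := U\<rparr>"
    and "MV \<equiv> M\<lparr>carrier := {u \<oplus>\<^bsub>M\<^esub> x \<triangleleft>\<^bsub>M\<^esub> r | u r. u \<in> U \<and> r \<in> carrier R}\<rparr>"
  shows "\<exists>P i1 i2 p1 p2. (MU, i1, P) \<in> Hom Mod MU P \<and> (B, i2, P) \<in> Hom Mod B P \<and>
    (P, p1, MU) \<in> Hom Mod P MU \<and> (P, p2, B) \<in> Hom Mod P B \<and>
    (\<forall>z\<in>carrier P. i1 (p1 z) \<oplus>\<^bsub>P\<^esub> i2 (p2 z) = z) \<and>
    (P, \<lambda>z\<in>carrier P. p1 z \<oplus>\<^bsub>M\<^esub> hat M x (p2 z), MV) \<in> Hom Mod P MV \<and>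
    (\<lambda>z\<in>carrier P. p1 z \<oplus>\<^bsub>M\<^esub> hat M x (p2 z)) ` carrier P = carrier MV"
proof -
  let ?V = "{u \<oplus>\<^bsub>M\<^esub> x \<triangleleft>\<^bsub>M\<^esub> r | u r. u \<in> U \<and> r \<in> carrier R}"
  have M_mod: "right_module R M" "small (carrier M)" using M by simp_all
  interpret M: right_module R M by fact
  have V: "is_submodule R M ?V" by (rule is_submodule_insert(1)[OF M_mod(1) U x])
  have MU: "right_module R MU" "small (carrier MU)"
    unfolding MU_def using right_module_submodule[OF M_mod(1) U] small_subset[OF M_mod(2) is_submoduleD(1)[OF U]]
    by simp_all
  have MV: "right_module R MV" "small (carrier MV)"
    unfolding MV_def using right_module_submodule[OF M_mod(1) V] small_subset[OF M_mod(2) is_submoduleD(1)[OF V]]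
    by simp_all
  from ex_product[OF infinite_universe regular_universe MU B_Mod]
  obtain P :: "('u, 'r) rmodule" and i1 i2 p1 p2 where
    *: "right_module R P \<and> small (carrier P) \<and>
      i1 \<in> lin_maps R MU P \<and> i2 \<in> lin_maps R B P \<and> p1 \<in> lin_maps R P MU \<and> p2 \<in> lin_maps R P B \<and>
      (\<forall>z\<in>carrier P. i1 (p1 z) \<oplus>\<^bsub>P\<^esub> i2 (p2 z) = z) \<and>
      (\<forall>x\<in>carrier MU. \<forall>y\<in>carrier B. \<exists>z\<in>carrier P. p1 z = x \<and> p2 z = y)"
    by (elim exE)
  then have P: "right_module R P" "small (carrier P)"
    and lin: "i1 \<in> lin_maps R MU P" "i2 \<in> lin_maps R B P" "p1 \<in> lin_maps R P MU" "p2 \<in> lin_maps R P B"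
    and dec: "\<forall>z\<in>carrier P. i1 (p1 z) \<oplus>\<^bsub>P\<^esub> i2 (p2 z) = z"
    and pair: "\<forall>x\<in>carrier MU. \<forall>y\<in>carrier B. \<exists>z\<in>carrier P. p1 z = x \<and> p2 z = y"
    by blast+
  let ?s = "\<lambda>z\<in>carrier P. p1 z \<oplus>\<^bsub>M\<^esub> hat M x (p2 z)"
  have p1_M: "p1 \<in> lin_maps R P M"
    using lin_mapsD[OF lin(3)] is_submoduleD(2)[OF U] by (intro lin_mapsI) (simp_all add: MU_def)
  have "(\<lambda>z\<in>carrier P. p1 z \<oplus>\<^bsub>M\<^esub> compose (carrier P) (hat M x) p2 z) \<in> lin_maps R P M"
    by (rule right_module_lin_maps_ops(2)[OF P(1) M_mod(1) p1_M
          lin_maps_compose[OF P(1) lin(4) hat_lin[OF M_mod(1) x]]])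
  then have s_M: "?s \<in> lin_maps R P M" by (simp cong: restrict_cong)
  have s_V: "?s z \<in> ?V" if z: "z \<in> carrier P" for z
  proof -
    obtain r where "r \<in> carrier R" "p2 z = b \<triangleleft>\<^bsub>B\<^esub> r" using lin_mapsD(2)[OF lin(4) z] by (rule B_cases)
    moreover have "p1 z \<in> U" using lin_mapsD(2)[OF lin(3) z] by (simp add: MU_def)
    ultimately show ?thesis using z by (auto simp: hat_ract)
  qed
  have s_lin: "?s \<in> lin_maps R P MV" unfolding MV_def by (rule lin_maps_corestrict[OF s_M s_V])
  have "?V \<subseteq> ?s ` carrier P"
  proof
    fix v assume "v \<in> ?V"
    then obtain u r where u: "u \<in> U" and r: "r \<in> carrier R" and v: "v = u \<oplus>\<^bsub>M\<^esub> x \<triangleleft>\<^bsub>M\<^esub> r" by blast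
    have "u \<in> carrier MU" using u by (simp add: MU_def)
    then obtain z where "z \<in> carrier P" "p1 z = u" "p2 z = b \<triangleleft>\<^bsub>B\<^esub> r"
      using pair b_ract_closed[OF r] by blast
    then show "v \<in> ?s ` carrier P" using v r by (intro image_eqI[of _ _ z]) (simp_all add: hat_ract)
  qed
  then have "?s ` carrier P = carrier MV" using s_V unfolding MV_def by auto
  then show ?thesis
    using P MU MV B_Mod lin dec s_lin
    by (intro exI[of _ P] exI[of _ i1] exI[of _ i2] exI[of _ p1] exI[of _ p2] conjI) simp_all
qed

lemma submodule_Ob:
  assumes "M \<in> Ob Mod" "is_submodule R M U"
  shows "M\<lparr>carrier := U\<rparr> \<in> Ob Mod"
  using assms right_module_submodule[of R M U] small_subset[OF _ is_submoduleD(1)[OF assms(2)]] by simp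

lemma inclusion_Hom:
  assumes "M \<in> Ob Mod" "is_submodule R M U" "is_submodule R M V" "U \<subseteq> V"
  shows "(M\<lparr>carrier := U\<rparr>, \<lambda>z\<in>U. z, M\<lparr>carrier := V\<rparr>) \<in> Hom Mod (M\<lparr>carrier := U\<rparr>) (M\<lparr>carrier := V\<rparr>)"
  using submodule_Ob[OF assms(1,2)] submodule_Ob[OF assms(1,3)] assms(4)
    lin_maps_corestrict[OF lin_maps_inclusion[OF assms(2)], of V] by auto

text \<open>For a submodule that is the union of a chain, preservation of direct limits says that arrows out
  of its image under \<open>T\<close> are compatible families of arrows out of the images of the members.\<close>

lemma T_directed_union:
  assumes M: "M \<in> Ob Mod" and U: "is_submodule R M U"
    and W: "\<And>x. x \<in> U \<Longrightarrow> is_submodule R M (W x)" "\<And>x. x \<in> U \<Longrightarrow> x \<in> W x \<and> W x \<subseteq> U"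
    and chain: "\<And>x y. \<lbrakk>x \<in> U; y \<in> U\<rbrakk> \<Longrightarrow> W x \<subseteq> W y \<or> W y \<subseteq> W x"
    and Y: "Y \<in> Ob A" and \<nu>: "\<And>x. x \<in> U \<Longrightarrow> \<nu> x \<in> Hom A (FOb T (M\<lparr>carrier := W x\<rparr>)) Y"
    and compat: "\<And>x y. \<lbrakk>x \<in> U; y \<in> U; W x \<subseteq> W y\<rbrakk>
      \<Longrightarrow> \<nu> y \<circ>\<^sub>A FArr T (M\<lparr>carrier := W x\<rparr>, \<lambda>z\<in>W x. z, M\<lparr>carrier := W y\<rparr>) = \<nu> x"
  shows "\<exists>!h. h \<in> Hom A (FOb T (M\<lparr>carrier := U\<rparr>)) Y \<and>
    (\<forall>x\<in>U. h \<circ>\<^sub>A FArr T (M\<lparr>carrier := W x\<rparr>, \<lambda>z\<in>W x. z, M\<lparr>carrier := U\<rparr>) = \<nu> x)"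
proof -
  have M_mod: "right_module R M" "small (carrier M)" using M by simp_all
  have U_small: "small U" using small_subset[OF M_mod(2) is_submoduleD(1)[OF U]] .
  interpret Mod_direct_limit R \<gamma> U "{(x, y). x \<in> U \<and> y \<in> U \<and> W x \<subseteq> W y}"
    "\<lambda>x. M\<lparr>carrier := W x\<rparr>" "\<lambda>x y. (M\<lparr>carrier := W x\<rparr>, \<lambda>z\<in>W x. z, M\<lparr>carrier := W y\<rparr>)"
    "M\<lparr>carrier := U\<rparr>" "\<lambda>x. (M\<lparr>carrier := W x\<rparr>, \<lambda>z\<in>W x. z, M\<lparr>carrier := U\<rparr>)"
    by (rule Mod_direct_limit_union[OF M_mod U W chain])
  from direct_limits[unfolded commutes_with_direct_limits_def, rule_format, OF conjI[OF U_small conjI[OF system limit]]]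
  have "\<forall>Y \<nu>. is_cocone A U {(x, y). x \<in> U \<and> y \<in> U \<and> W x \<subseteq> W y}
      (FOb T \<circ> (\<lambda>x. M\<lparr>carrier := W x\<rparr>))
      (\<lambda>i j. FArr T (M\<lparr>carrier := W i\<rparr>, \<lambda>z\<in>W i. z, M\<lparr>carrier := W j\<rparr>)) Y \<nu> \<longrightarrow>
      (\<exists>!h. h \<in> Hom A (FOb T (M\<lparr>carrier := U\<rparr>)) Y \<and>
        (\<forall>i\<in>U. h \<circ>\<^sub>A (FArr T \<circ> (\<lambda>x. (M\<lparr>carrier := W x\<rparr>, \<lambda>z\<in>W x. z, M\<lparr>carrier := U\<rparr>))) i = \<nu> i))"
    unfolding is_direct_limit_def by (rule conjunct2)
  from this[THEN spec, THEN spec, of Y \<nu>]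
  show ?thesis
    unfolding is_cocone_def comp_apply using Y \<nu> compat by simp
qed

lemma jointly_epi_all:
  assumes M: "M \<in> Ob Mod"
  shows "jointly_epi M"
proof -
  have M_mod: "right_module R M" using M by simp
  have "jointly_epi (M\<lparr>carrier := carrier M\<rparr>)"
  proof (rule submodule_induct[OF M_mod, where Q = "\<lambda>U. jointly_epi (M\<lparr>carrier := U\<rparr>)"])
    interpret M: right_module R M by fact
    have "is_submodule R M {\<zero>\<^bsub>M\<^esub>}" by (auto simp: is_submodule_def M.zero_ract)
    note zero = T_zero_module[OF submodule_Ob[OF M this]]
    show "jointly_epi (M\<lparr>carrier := {\<zero>\<^bsub>M\<^esub>}\<rparr>)"
      unfolding jointly_epi_def
    proof (intro allI ballI impI)
      fix Y h h' assume "h \<in> Hom A (FOb T (M\<lparr>carrier := {\<zero>\<^bsub>M\<^esub>}\<rparr>)) Y"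
        and "h' \<in> Hom A (FOb T (M\<lparr>carrier := {\<zero>\<^bsub>M\<^esub>}\<rparr>)) Y"
      from zero[OF _ this(1)] zero[OF _ this(2)] show "h = h'" by simp
    qed
  next
    fix U x assume U: "is_submodule R M U" "jointly_epi (M\<lparr>carrier := U\<rparr>)" and x: "x \<in> carrier M"
    from ex_adjoin_generator[OF M U(1) x]
    show "jointly_epi (M\<lparr>carrier := {u \<oplus>\<^bsub>M\<^esub> x \<triangleleft>\<^bsub>M\<^esub> r |u r. u \<in> U \<and> r \<in> carrier R}\<rparr>)"
      by (elim exE conjE) (rule jointly_epi_quotient, assumption, assumption,
        rule jointly_epi_product, assumption, assumption, assumption, assumption, assumption,
        rule U(2), rule jointly_epi_B)
  next
    fix U W assume U: "is_submodule R M U" and W: "\<And>x. x \<in> U \<Longrightarrow> is_submodule R M (W x)"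
      and Q: "\<And>x. x \<in> U \<Longrightarrow> jointly_epi (M\<lparr>carrier := W x\<rparr>)"
      and mem: "\<And>x. x \<in> U \<Longrightarrow> x \<in> W x \<and> W x \<subseteq> U"
      and chain: "\<And>x y. \<lbrakk>x \<in> U; y \<in> U\<rbrakk> \<Longrightarrow> W x \<subseteq> W y \<or> W y \<subseteq> W x"
    let ?i = "\<lambda>x. (M\<lparr>carrier := W x\<rparr>, \<lambda>z\<in>W x. z, M\<lparr>carrier := U\<rparr>)"
    let ?j = "\<lambda>x y. (M\<lparr>carrier := W x\<rparr>, \<lambda>z\<in>W x. z, M\<lparr>carrier := W y\<rparr>)"
    have i: "?i x \<in> Hom Mod (M\<lparr>carrier := W x\<rparr>) (M\<lparr>carrier := U\<rparr>)" if "x \<in> U" for x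
      using inclusion_Hom[OF M W[OF that] U] mem[OF that] by blast
    show "jointly_epi (M\<lparr>carrier := U\<rparr>)"
      unfolding jointly_epi_def
    proof (intro allI ballI impI)
      fix Y h h' assume h: "h \<in> Hom A (FOb T (M\<lparr>carrier := U\<rparr>)) Y"
        and h': "h' \<in> Hom A (FOb T (M\<lparr>carrier := U\<rparr>)) Y"
        and eq: "\<forall>x\<in>carrier (M\<lparr>carrier := U\<rparr>). h \<circ>\<^sub>A elt (M\<lparr>carrier := U\<rparr>) x = h' \<circ>\<^sub>A elt (M\<lparr>carrier := U\<rparr>) x"
      have agree: "h \<circ>\<^sub>A FArr T (?i x) = h' \<circ>\<^sub>A FArr T (?i x)" if x: "x \<in> U" for x
      proof (rule jointly_epiD[OF Q[OF x] A.Comp_Hom[OF T_Hom[OF i[OF x]] h] A.Comp_Hom[OF T_Hom[OF i[OF x]] h']])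
        fix z assume z: "z \<in> carrier (M\<lparr>carrier := W x\<rparr>)"
        have "z \<in> W x" "z \<in> carrier (M\<lparr>carrier := U\<rparr>)" using z mem[OF x] by auto
        then show "(h \<circ>\<^sub>A FArr T (?i x)) \<circ>\<^sub>A elt (M\<lparr>carrier := W x\<rparr>) z =
            (h' \<circ>\<^sub>A FArr T (?i x)) \<circ>\<^sub>A elt (M\<lparr>carrier := W x\<rparr>) z"
          unfolding comp_T_elt[OF i[OF x] z h] comp_T_elt[OF i[OF x] z h'] using eq by simp
      qed
      have compat: "(h \<circ>\<^sub>A FArr T (?i y)) \<circ>\<^sub>A FArr T (?j x y) = h \<circ>\<^sub>A FArr T (?i x)"
        if xy: "x \<in> U" "y \<in> U" "W x \<subseteq> W y" for x y
      proof -
        note j = inclusion_Hom[OF M W[OF xy(1)] W[OF xy(2)] xy(3)]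
        have "?i y \<cdot>\<^bsub>Mod\<^esub> ?j x y = ?i x" using xy(3) by (auto simp: compose_def fun_eq_iff)
        then show ?thesis
          using A.Comp_assoc[OF T_Hom[OF j] T_Hom[OF i[OF xy(2)]] h] T_Comp[OF j i[OF xy(2)]] by simp
      qed
      have "\<exists>!g. g \<in> Hom A (FOb T (M\<lparr>carrier := U\<rparr>)) Y \<and> (\<forall>x\<in>U. g \<circ>\<^sub>A FArr T (?i x) = h \<circ>\<^sub>A FArr T (?i x))"
        by (rule T_directed_union[OF M U W mem chain A.HomD(5)[OF h] A.Comp_Hom[OF T_Hom[OF i] h] compat])
      then show "h = h'" by (rule Ex1_eqI) (use h h' agree in auto)
    qed
  qed
  then show ?thesis by simp
qed

subsection \<open>Linear maps extend\<close>

definition extends :: "('u, 'r) rmodule \<Rightarrow> bool" where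
  "extends M \<longleftrightarrow> (\<forall>N\<in>Ob A. \<forall>g\<in>lin_maps R M (Hom_rmodule A T_lmod N).
     \<exists>h\<in>Hom A (FOb T M) N. \<forall>x\<in>carrier M. h \<circ>\<^sub>A elt M x = g x)"

lemma extendsE:
  assumes "extends M" "N \<in> Ob A" "g \<in> lin_maps R M (Hom_rmodule A T_lmod N)"
  obtains h where "h \<in> Hom A (FOb T M) N" "\<forall>x\<in>carrier M. h \<circ>\<^sub>A elt M x = g x"
  using assms unfolding extends_def by blast

lemma extends_B: "extends B"
  unfolding extends_def
proof (intro ballI)
  fix N g assume N: "N \<in> Ob A" and g: "g \<in> lin_maps R B (Hom_rmodule A T_lmod N)"
  note g_simps = Hom_valued_lin_mapsD[OF g]
  show "\<exists>h\<in>Hom A (FOb T B) N. \<forall>x\<in>carrier B. h \<circ>\<^sub>A elt B x = g x"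
  proof (rule bexI[of _ "g b"], rule ballI)
    show "g b \<in> Hom A (FOb T B) N" using g_simps(2)[OF b_closed] by simp
    fix x assume "x \<in> carrier B"
    then obtain r where r: "r \<in> carrier R" "x = b \<triangleleft>\<^bsub>B\<^esub> r" by (rule B_cases)
    then show "g b \<circ>\<^sub>A elt B x = g x" using g_simps(4)[OF b_closed r(1)] by (simp add: act_eq_elt snd_T_lmod)
  qed
qed

lemma extends_product:
  assumes i1: "(M, i1, P) \<in> Hom Mod M P" and i2: "(N, i2, P) \<in> Hom Mod N P"
    and p1: "(P, p1, M) \<in> Hom Mod P M" and p2: "(P, p2, N) \<in> Hom Mod P N"
    and dec: "\<forall>z\<in>carrier P. i1 (p1 z) \<oplus>\<^bsub>P\<^esub> i2 (p2 z) = z"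
    and M: "extends M" and N: "extends N"
  shows "extends P"
  unfolding extends_def
proof (intro ballI)
  fix Y g assume Y: "Y \<in> Ob A" and g: "g \<in> lin_maps R P (Hom_rmodule A T_lmod Y)"
  have mods: "right_module R M" "right_module R N" "P \<in> Ob Mod"
    and lin: "i1 \<in> lin_maps R M P" "i2 \<in> lin_maps R N P" "p1 \<in> lin_maps R P M" "p2 \<in> lin_maps R P N"
    using i1 i2 p1 p2 by simp_all
  obtain h1 where h1: "h1 \<in> Hom A (FOb T M) Y"
    and h1_eq: "\<forall>x\<in>carrier M. h1 \<circ>\<^sub>A elt M x = compose (carrier M) g i1 x"
    by (rule extendsE[OF M Y lin_maps_compose[OF mods(1) lin(1) g]])
  obtain h2 where h2: "h2 \<in> Hom A (FOb T N) Y"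
    and h2_eq: "\<forall>x\<in>carrier N. h2 \<circ>\<^sub>A elt N x = compose (carrier N) g i2 x"
    by (rule extendsE[OF N Y lin_maps_compose[OF mods(2) lin(2) g]])
  let ?h1 = "h1 \<circ>\<^sub>A FArr T (P, p1, M)" and ?h2 = "h2 \<circ>\<^sub>A FArr T (P, p2, N)"
  have h1p: "?h1 \<in> Hom A (FOb T P) Y" and h2p: "?h2 \<in> Hom A (FOb T P) Y"
    using A.Comp_Hom[OF T_Hom[OF p1] h1] A.Comp_Hom[OF T_Hom[OF p2] h2] .
  show "\<exists>h\<in>Hom A (FOb T P) Y. \<forall>z\<in>carrier P. h \<circ>\<^sub>A elt P z = g z"
  proof (rule bexI[OF _ A.add_Hom[OF h1p h2p]], rule ballI)
    fix z assume z: "z \<in> carrier P"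
    note p1z = lin_mapsD(2)[OF lin(3) z] and p2z = lin_mapsD(2)[OF lin(4) z]
    have "(?h1 \<oplus>\<^bsub>HomMod A (FOb T P) Y\<^esub> ?h2) \<circ>\<^sub>A elt P z =
        (?h1 \<circ>\<^sub>A elt P z) \<oplus>\<^bsub>HomMod A (FOb T B) Y\<^esub> (?h2 \<circ>\<^sub>A elt P z)"
      by (rule A.Comp_add_left[OF elt_Hom[OF mods(3) z] h1p h2p])
    also have "\<dots> = g (i1 (p1 z)) \<oplus>\<^bsub>HomMod A (FOb T B) Y\<^esub> g (i2 (p2 z))"
      unfolding comp_T_elt[OF p1 z h1] comp_T_elt[OF p2 z h2]
      using bspec[OF h1_eq p1z] bspec[OF h2_eq p2z] p1z p2z by simp
    also have "\<dots> = g (i1 (p1 z) \<oplus>\<^bsub>P\<^esub> i2 (p2 z))"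
      using Hom_valued_lin_mapsD(3)[OF g lin_mapsD(2)[OF lin(1) p1z] lin_mapsD(2)[OF lin(2) p2z]] by simp
    also have "\<dots> = g z" using dec z by simp
    finally show "(?h1 \<oplus>\<^bsub>HomMod A (FOb T P) Y\<^esub> ?h2) \<circ>\<^sub>A elt P z = g z" .
  qed
qed

text \<open>The extension \<open>h\<close> on \<open>T P\<close> of the linear map \<open>g \<circ> s\<close> vanishes on the image of the kernel \<open>K\<close> of
  \<open>s\<close>: its composite with \<open>elt K z\<close> is \<open>g (s z) = 0\<close>, and these arrows are jointly epi.  So \<open>h\<close>
  descends to the cokernel \<open>T M\<close>.\<close>

lemma extends_quotient:
  assumes s: "(P, s, M) \<in> Hom Mod P M" and surj: "s ` carrier P = carrier M" and P: "extends P"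
  shows "extends M"
  unfolding extends_def
proof (intro ballI)
  fix Y g assume Y: "Y \<in> Ob A" and g: "g \<in> lin_maps R M (Hom_rmodule A T_lmod Y)"
  have P_mod: "right_module R P" and M_mod: "right_module R M" and s_lin: "s \<in> lin_maps R P M"
    using s by simp_all
  let ?K = "{z \<in> carrier P. s z = \<zero>\<^bsub>M\<^esub>}"
  let ?PK = "P\<lparr>carrier := ?K\<rparr>" and ?k = "\<lambda>z\<in>?K. z"
  note coker = T_cokernel(1)[OF s surj refl] and k = T_cokernel(2)[OF s surj refl]
  note Ts = A.HomD[OF T_Hom[OF s]] and Tk = A.HomD[OF T_Hom[OF k]]
  have PK: "?PK \<in> Ob Mod" using k by simp
  obtain h where h: "h \<in> Hom A (FOb T P) Y"
    and h_eq: "\<forall>z\<in>carrier P. h \<circ>\<^sub>A elt P z = compose (carrier P) g s z"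
    by (rule extendsE[OF P Y lin_maps_compose[OF P_mod s_lin g]])
  have "h \<circ>\<^sub>A FArr T (?PK, ?k, P) = zero_arr A (FOb T ?PK) Y"
  proof (rule jointly_epiD[OF jointly_epi_all[OF PK] A.Comp_Hom[OF T_Hom[OF k] h] A.zero_Hom[OF T_Ob[OF PK] Y]])
    fix z assume z: "z \<in> carrier ?PK"
    then have zP: "z \<in> carrier P" "s z = \<zero>\<^bsub>M\<^esub>" by simp_all
    have "(h \<circ>\<^sub>A FArr T (?PK, ?k, P)) \<circ>\<^sub>A elt ?PK z = g (s z)"
      unfolding comp_T_elt[OF k z h] using bspec[OF h_eq zP(1)] zP by simp
    also have "\<dots> = zero_arr A (FOb T B) Y"
      using Hom_valued_zero[OF T_lmod M_mod Y g] zP(2) by simp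
    also have "\<dots> = zero_arr A (FOb T ?PK) Y \<circ>\<^sub>A elt ?PK z"
      using A.zero_arr_comp[OF elt_Hom[OF PK z] Y] by simp
    finally show "(h \<circ>\<^sub>A FArr T (?PK, ?k, P)) \<circ>\<^sub>A elt ?PK z = zero_arr A (FOb T ?PK) Y \<circ>\<^sub>A elt ?PK z" .
  qed
  then have "\<exists>!u. u \<in> Hom A (FOb T M) Y \<and> u \<circ>\<^sub>A FArr T (P, s, M) = h"
    using is_cokernel_factor[OF coker, of h Y] h Tk Ts by simp
  then obtain u where u: "u \<in> Hom A (FOb T M) Y" "u \<circ>\<^sub>A FArr T (P, s, M) = h" by (elim ex1E conjE)
  show "\<exists>h\<in>Hom A (FOb T M) Y. \<forall>x\<in>carrier M. h \<circ>\<^sub>A elt M x = g x"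
  proof (rule bexI[OF _ u(1)], rule ballI)
    fix x assume "x \<in> carrier M"
    then obtain z where z: "z \<in> carrier P" "x = s z" using surj by blast
    show "u \<circ>\<^sub>A elt M x = g x"
      using comp_T_elt[OF s z(1) u(1)] bspec[OF h_eq z(1)] u(2) z by simp
  qed
qed

lemma extends_all:
  assumes M: "M \<in> Ob Mod"
  shows "extends M"
proof -
  have M_mod: "right_module R M" using M by simp
  have "extends (M\<lparr>carrier := carrier M\<rparr>)"
  proof (rule submodule_induct[OF M_mod, where Q = "\<lambda>U. extends (M\<lparr>carrier := U\<rparr>)"])
    interpret M: right_module R M by fact
    let ?Z = "M\<lparr>carrier := {\<zero>\<^bsub>M\<^esub>}\<rparr>"
    have "is_submodule R M {\<zero>\<^bsub>M\<^esub>}" by (auto simp: is_submodule_def M.zero_ract)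
    note Z = submodule_Ob[OF M this]
    have Z_mod: "right_module R ?Z" using Z by simp
    show "extends ?Z"
      unfolding extends_def
    proof (intro ballI)
      fix Y g assume Y: "Y \<in> Ob A" and g: "g \<in> lin_maps R ?Z (Hom_rmodule A T_lmod Y)"
      show "\<exists>h\<in>Hom A (FOb T ?Z) Y. \<forall>x\<in>carrier ?Z. h \<circ>\<^sub>A elt ?Z x = g x"
      proof (rule bexI[OF _ A.zero_Hom[OF T_Ob[OF Z] Y]], rule ballI)
        fix x assume x: "x \<in> carrier ?Z"
        then show "zero_arr A (FOb T ?Z) Y \<circ>\<^sub>A elt ?Z x = g x"
          using A.zero_arr_comp[OF elt_Hom[OF Z x] Y] Hom_valued_zero[OF T_lmod Z_mod Y g] by simp
      qed
    qed
  next
    fix U x assume U: "is_submodule R M U" "extends (M\<lparr>carrier := U\<rparr>)" and x: "x \<in> carrier M"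
    from ex_adjoin_generator[OF M U(1) x]
    show "extends (M\<lparr>carrier := {u \<oplus>\<^bsub>M\<^esub> x \<triangleleft>\<^bsub>M\<^esub> r |u r. u \<in> U \<and> r \<in> carrier R}\<rparr>)"
      by (elim exE conjE) (rule extends_quotient, assumption, assumption,
        rule extends_product, assumption, assumption, assumption, assumption, assumption,
        rule U(2), rule extends_B)
  next
    fix U W assume U: "is_submodule R M U" and W: "\<And>x. x \<in> U \<Longrightarrow> is_submodule R M (W x)"
      and Q: "\<And>x. x \<in> U \<Longrightarrow> extends (M\<lparr>carrier := W x\<rparr>)"
      and mem: "\<And>x. x \<in> U \<Longrightarrow> x \<in> W x \<and> W x \<subseteq> U"
      and chain: "\<And>x y. \<lbrakk>x \<in> U; y \<in> U\<rbrakk> \<Longrightarrow> W x \<subseteq> W y \<or> W y \<subseteq> W x"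
    let ?U = "M\<lparr>carrier := U\<rparr>" and ?W = "\<lambda>x. M\<lparr>carrier := W x\<rparr>"
    let ?i = "\<lambda>x. (?W x, \<lambda>z\<in>W x. z, ?U)"
    let ?j = "\<lambda>x y. (?W x, \<lambda>z\<in>W x. z, ?W y)"
    have i: "?i x \<in> Hom Mod (?W x) ?U" if "x \<in> U" for x
      using inclusion_Hom[OF M W[OF that] U] mem[OF that] by blast
    have W_Ob: "?W x \<in> Ob Mod" if "x \<in> U" for x by (rule submodule_Ob[OF M W[OF that]])
    show "extends ?U"
      unfolding extends_def
    proof (intro ballI)
      fix Y g assume Y: "Y \<in> Ob A" and g: "g \<in> lin_maps R ?U (Hom_rmodule A T_lmod Y)"
      have g_W: "restrict g (W x) \<in> lin_maps R (?W x) (Hom_rmodule A T_lmod Y)" if x: "x \<in> U" for x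
        using lin_maps_restrict[OF is_submodule_trans[OF U W[OF x]] g] mem[OF x] by simp
      have "\<forall>x\<in>U. \<exists>h. h \<in> Hom A (FOb T (?W x)) Y \<and> (\<forall>z\<in>W x. h \<circ>\<^sub>A elt (?W x) z = g z)"
      proof
        fix x assume x: "x \<in> U"
        obtain h where "h \<in> Hom A (FOb T (?W x)) Y" "\<forall>z\<in>carrier (?W x). h \<circ>\<^sub>A elt (?W x) z = restrict g (W x) z"
          by (rule extendsE[OF Q[OF x] Y g_W[OF x]])
        then show "\<exists>h. h \<in> Hom A (FOb T (?W x)) Y \<and> (\<forall>z\<in>W x. h \<circ>\<^sub>A elt (?W x) z = g z)"
          by (intro exI[of _ h]) simp
      qed
      then obtain \<nu> where \<nu>: "\<forall>x\<in>U. \<nu> x \<in> Hom A (FOb T (?W x)) Y \<and> (\<forall>z\<in>W x. \<nu> x \<circ>\<^sub>A elt (?W x) z = g z)"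
        by (rule bchoice[THEN exE])
      have \<nu>_Hom: "\<nu> x \<in> Hom A (FOb T (?W x)) Y" if "x \<in> U" for x
        using \<nu> that by blast
      have \<nu>_elt: "\<nu> x \<circ>\<^sub>A elt (?W x) z = g z" if "x \<in> U" "z \<in> W x" for x z
        using \<nu> that by blast
      have compat: "\<nu> y \<circ>\<^sub>A FArr T (?j x y) = \<nu> x" if xy: "x \<in> U" "y \<in> U" "W x \<subseteq> W y" for x y
      proof -
        note j = inclusion_Hom[OF M W[OF xy(1)] W[OF xy(2)] xy(3)]
        show ?thesis
        proof (rule jointly_epiD[OF jointly_epi_all[OF W_Ob[OF xy(1)]]
              A.Comp_Hom[OF T_Hom[OF j] \<nu>_Hom[OF xy(2)]] \<nu>_Hom[OF xy(1)]])
          fix z assume z: "z \<in> carrier (?W x)"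
          then show "(\<nu> y \<circ>\<^sub>A FArr T (?j x y)) \<circ>\<^sub>A elt (?W x) z = \<nu> x \<circ>\<^sub>A elt (?W x) z"
            unfolding comp_T_elt[OF j z \<nu>_Hom[OF xy(2)]]
            using \<nu>_elt[OF xy(1), of z] \<nu>_elt[OF xy(2), of z] xy(3) by auto
        qed
      qed
      have "\<exists>!h. h \<in> Hom A (FOb T ?U) Y \<and> (\<forall>x\<in>U. h \<circ>\<^sub>A FArr T (?i x) = \<nu> x)"
        by (rule T_directed_union[OF M U W mem chain Y \<nu>_Hom compat])
      then obtain h where h: "h \<in> Hom A (FOb T ?U) Y" "\<forall>x\<in>U. h \<circ>\<^sub>A FArr T (?i x) = \<nu> x"
        by (elim ex1E conjE)
      show "\<exists>h\<in>Hom A (FOb T ?U) Y. \<forall>x\<in>carrier ?U. h \<circ>\<^sub>A elt ?U x = g x"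
      proof (rule bexI[OF _ h(1)], rule ballI)
        fix x assume "x \<in> carrier ?U"
        then have x: "x \<in> U" by simp
        then have xW: "x \<in> W x" "x \<in> carrier (?W x)" using mem[OF x] by simp_all
        show "h \<circ>\<^sub>A elt ?U x = g x"
          using comp_T_elt[OF i[OF x] xW(2) h(1)] bspec[OF h(2) x] \<nu>_elt[OF x xW(1)] xW(1) by simp
      qed
    qed
  qed
  then show ?thesis by simp
qed

theorem universal: "tensor_universal T_lmod T elt"
  unfolding tensor_universal_def
proof (intro conjI ballI allI impI)
  show "FArr T (M, f, N) \<circ>\<^sub>A elt M x = elt N (f x)" if "(M, f, N) \<in> Arr Mod" "x \<in> carrier M" for M N f x
    using elt_natural[of M f N x] that by simp
  fix M N g assume M: "M \<in> Ob Mod" and N: "N \<in> Ob A" and g: "g \<in> lin_maps R M (Hom_rmodule A T_lmod N)"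
  obtain h where h: "h \<in> Hom A (FOb T M) N" "\<forall>x\<in>carrier M. h \<circ>\<^sub>A elt M x = g x"
    by (rule extendsE[OF extends_all[OF M] N g])
  show "\<exists>!h. h \<in> Hom A (FOb T M) N \<and> (\<forall>x\<in>carrier M. h \<circ>\<^sub>A elt M x = g x)"
  proof (rule ex1I)
    show "h \<in> Hom A (FOb T M) N \<and> (\<forall>x\<in>carrier M. h \<circ>\<^sub>A elt M x = g x)" using h by blast
    fix v assume v: "v \<in> Hom A (FOb T M) N \<and> (\<forall>x\<in>carrier M. v \<circ>\<^sub>A elt M x = g x)"
    show "v = h"
      by (rule jointly_epiD[OF jointly_epi_all[OF M] conjunct1[OF v] h(1)]) (use v h(2) in simp)
  qed
qed (use is_functor elt_lin in auto)

end

section \<open>The equivalence\<close>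

context tensor_setting
begin

abbreviation tensor :: "('o, 'a, 'r) lmod \<Rightarrow> (('u, 'r) rmodule, ('u, 'r) rmod_arr, 'o, 'a) cfunctor" where
  "tensor F \<equiv> tensor_functor R \<gamma> A F"

abbreviation transpose :: "('o, 'a, 'r) lmod \<Rightarrow> ('u, 'r) rmodule \<Rightarrow> 'o \<Rightarrow> 'a \<Rightarrow> 'u \<Rightarrow> 'a" where
  "transpose F \<equiv> tensor_transpose R \<gamma> A F"

text \<open>The arrow \<open>x \<otimes> - : F \<rightarrow> M \<otimes> F\<close>, the unit of the adjunction at \<open>x\<close>.\<close>

definition tensor_elt :: "('o, 'a, 'r) lmod \<Rightarrow> ('u, 'r) rmodule \<Rightarrow> 'u \<Rightarrow> 'a" where
  "tensor_elt F M = transpose F M (FOb (tensor F) M) (Id A (FOb (tensor F) M))"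

lemma tensor_is_adjunction:
  assumes F: "F \<in> lmods"
  shows "is_tensor_adjunction R \<gamma> A F (tensor F) (transpose F)"
proof -
  obtain L e where "tensor_universal F L e" using ex_tensor_universal[OF F] by (elim exE)
  from universal_imp_tensor_adjunction[OF F this]
  have "\<exists>p :: (('u, 'r) rmodule, ('u, 'r) rmod_arr, 'o, 'a) cfunctor \<times> _.
      case p of (L, \<theta>) \<Rightarrow> is_tensor_adjunction R \<gamma> A F L \<theta>"
    by (intro exI[of _ "(L, \<lambda>M N h. \<lambda>x\<in>carrier M. h \<circ>\<^sub>A e M x)"]) simp
  from someI_ex[OF this] show ?thesis
    unfolding tensor_functor_def tensor_transpose_def tensor_adjunction_def
    by (simp add: case_prod_unfold)
qed

lemma tensor_universal: "F \<in> lmods \<Longrightarrow> tensor_universal F (tensor F) (tensor_elt F)"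
  using tensor_adjunction_imp_universal(1)[OF tensor_is_adjunction] unfolding tensor_elt_def .

lemma transpose_eq:
  "\<lbrakk>F \<in> lmods; M \<in> Ob Mod; h \<in> Hom A (FOb (tensor F) M) N\<rbrakk>
    \<Longrightarrow> transpose F M N h = (\<lambda>x\<in>carrier M. h \<circ>\<^sub>A tensor_elt F M x)"
  using tensor_adjunction_imp_universal(2)[OF tensor_is_adjunction] unfolding tensor_elt_def .

text \<open>By the Yoneda lemma, the arrow \<open>M \<otimes> \<phi>\<close> is determined by its composites with the universal
  arrows.\<close>

lemma tensor_arr:
  assumes F: "F \<in> lmods" and G: "G \<in> lmods" and \<phi>: "is_lmod_hom F \<phi> G" and M: "M \<in> Ob Mod"
  shows "tensor_arr R \<gamma> A F \<phi> G M \<in> Hom A (FOb (tensor F) M) (FOb (tensor G) M)"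
    and "x \<in> carrier M \<Longrightarrow> tensor_arr R \<gamma> A F \<phi> G M \<circ>\<^sub>A tensor_elt F M x = tensor_elt G M x \<circ>\<^sub>A \<phi>"
proof -
  note L = tensor_universal[OF F] and L' = tensor_universal[OF G]
  note L_simps = tensor_universalD[OF L] and L'_simps = tensor_universalD[OF L']
  have \<phi>_Hom: "\<phi> \<in> Hom A (fst F) (fst G)" using \<phi> by (simp add: is_lmod_hom_def)
  let ?P = "\<lambda>u. u \<in> Hom A (FOb (tensor F) M) (FOb (tensor G) M) \<and>
    (\<forall>x\<in>carrier M. u \<circ>\<^sub>A tensor_elt F M x = tensor_elt G M x \<circ>\<^sub>A \<phi>)"
  have "(\<forall>N\<in>Ob A. \<forall>h\<in>Hom A (FOb (tensor G) M) N.
      transpose F M N (h \<circ>\<^sub>A u) = (\<lambda>x\<in>carrier M. transpose G M N h x \<circ>\<^sub>A \<phi>)) \<longleftrightarrow>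
    (\<forall>x\<in>carrier M. u \<circ>\<^sub>A tensor_elt F M x = tensor_elt G M x \<circ>\<^sub>A \<phi>)" (is "?lhs \<longleftrightarrow> ?rhs")
    if u: "u \<in> Hom A (FOb (tensor F) M) (FOb (tensor G) M)" for u
  proof -
    have iff: "transpose F M N (h \<circ>\<^sub>A u) = (\<lambda>x\<in>carrier M. transpose G M N h x \<circ>\<^sub>A \<phi>) \<longleftrightarrow>
        (\<forall>x\<in>carrier M. h \<circ>\<^sub>A (u \<circ>\<^sub>A tensor_elt F M x) = h \<circ>\<^sub>A (tensor_elt G M x \<circ>\<^sub>A \<phi>))"
      if h: "h \<in> Hom A (FOb (tensor G) M) N" for N h
    proof -
      have "transpose F M N (h \<circ>\<^sub>A u) = (\<lambda>x\<in>carrier M. h \<circ>\<^sub>A (u \<circ>\<^sub>A tensor_elt F M x))"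
        unfolding transpose_eq[OF F M A.Comp_Hom[OF u h]]
        using A.Comp_assoc[OF L_simps(6)[OF M] u h] by (rule restrict_ext)
      moreover have "(\<lambda>x\<in>carrier M. transpose G M N h x \<circ>\<^sub>A \<phi>) =
          (\<lambda>x\<in>carrier M. h \<circ>\<^sub>A (tensor_elt G M x \<circ>\<^sub>A \<phi>))"
        unfolding transpose_eq[OF G M h]
        using A.Comp_assoc[OF \<phi>_Hom L'_simps(6)[OF M] h] by (intro restrict_ext) simp
      ultimately show ?thesis by (auto simp: fun_eq_iff)
    qed
    show ?thesis
    proof
      assume ?lhs
      with A.Id_Hom[OF L'_simps(5)[OF M]] iff L'_simps(5)[OF M]
      have "\<forall>x\<in>carrier M. Id A (FOb (tensor G) M) \<circ>\<^sub>A (u \<circ>\<^sub>A tensor_elt F M x) =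
          Id A (FOb (tensor G) M) \<circ>\<^sub>A (tensor_elt G M x \<circ>\<^sub>A \<phi>)" by blast
      then show ?rhs
        using A.Comp_Id_left[OF A.Comp_Hom[OF L_simps(6)[OF M] u]]
          A.Comp_Id_left[OF A.Comp_Hom[OF \<phi>_Hom L'_simps(6)[OF M]]] by simp
    next
      assume ?rhs
      then show ?lhs using iff by simp
    qed
  qed
  then have eq: "tensor_arr R \<gamma> A F \<phi> G M = (THE u. ?P u)"
    unfolding tensor_arr_def by (intro arg_cong[where f = The] ext) blast
  have "?P (tensor_arr R \<gamma> A F \<phi> G M)"
    unfolding eq by (rule theI'[OF ex1_comparison[OF F G \<phi> L L' M]])
  then show "tensor_arr R \<gamma> A F \<phi> G M \<in> Hom A (FOb (tensor F) M) (FOb (tensor G) M)"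
    and "x \<in> carrier M \<Longrightarrow> tensor_arr R \<gamma> A F \<phi> G M \<circ>\<^sub>A tensor_elt F M x = tensor_elt G M x \<circ>\<^sub>A \<phi>"
    by blast+
qed

subsection \<open>The categories of left modules and of functors\<close>

abbreviation LMod where "LMod \<equiv> lmod_cat k R \<gamma> A"

abbreviation Funct :: "((('u, 'r) rmodule, ('u, 'r) rmod_arr, 'o, 'a) cfunctor,
    (('u, 'r) rmodule, ('u, 'r) rmod_arr, 'o, 'a) cfunctor \<times> (('u, 'r) rmodule \<Rightarrow> 'a) \<times>
    (('u, 'r) rmodule, ('u, 'r) rmod_arr, 'o, 'a) cfunctor) category" where
  "Funct \<equiv> B_cat k R \<gamma> A"

lemma Ob_LMod [simp]: "Ob LMod = lmods"
  by (simp add: lmod_cat_def)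

lemma Hom_LMod [simp]: "(F', \<phi>, G') \<in> Hom LMod F G \<longleftrightarrow>
    F' = F \<and> G' = G \<and> F \<in> lmods \<and> G \<in> lmods \<and> is_lmod_hom F \<phi> G"
  by (auto simp: lmod_cat_def Hom_def is_lmod_hom_def)

lemma HomE_LMod:
  assumes "a \<in> Hom LMod F G"
  obtains \<phi> where "a = (F, \<phi>, G)" "F \<in> lmods" "G \<in> lmods" "is_lmod_hom F \<phi> G"
  using assms by (cases a) auto

lemma Comp_LMod [simp]: "(G', \<psi>, H) \<cdot>\<^bsub>LMod\<^esub> (F, \<phi>, G) = (F, \<psi> \<circ>\<^sub>A \<phi>, H)"
  and Id_LMod [simp]: "Id LMod F = (F, Id A (fst F), F)"
  by (simp_all add: lmod_cat_def)

lemma is_lmod_hom_Id: "F \<in> lmods \<Longrightarrow> is_lmod_hom F (Id A (fst F)) F"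
  unfolding is_lmod_hom_def using A.Id_Hom lmodsD(1) A.Comp_Id_left A.Comp_Id_right lmodsD(3) by metis

lemma is_lmod_hom_Comp:
  assumes F: "F \<in> lmods" and G: "G \<in> lmods" and H: "H \<in> lmods"
    and \<phi>: "is_lmod_hom F \<phi> G" and \<psi>: "is_lmod_hom G \<psi> H"
  shows "is_lmod_hom F (\<psi> \<circ>\<^sub>A \<phi>) H"
proof -
  have \<phi>_Hom: "\<phi> \<in> Hom A (fst F) (fst G)" and \<psi>_Hom: "\<psi> \<in> Hom A (fst G) (fst H)"
    using \<phi> \<psi> by (simp_all add: is_lmod_hom_def)
  have "snd H r \<circ>\<^sub>A (\<psi> \<circ>\<^sub>A \<phi>) = (\<psi> \<circ>\<^sub>A \<phi>) \<circ>\<^sub>A snd F r" if r: "r \<in> carrier R" for r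
  proof -
    have "snd H r \<circ>\<^sub>A (\<psi> \<circ>\<^sub>A \<phi>) = (snd H r \<circ>\<^sub>A \<psi>) \<circ>\<^sub>A \<phi>"
      using A.Comp_assoc[OF \<phi>_Hom \<psi>_Hom lmodsD(3)[OF H r]] by simp
    also have "\<dots> = (\<psi> \<circ>\<^sub>A snd G r) \<circ>\<^sub>A \<phi>" using \<psi> r by (simp add: is_lmod_hom_def)
    also have "\<dots> = \<psi> \<circ>\<^sub>A (snd G r \<circ>\<^sub>A \<phi>)" by (rule A.Comp_assoc[OF \<phi>_Hom lmodsD(3)[OF G r] \<psi>_Hom])
    also have "\<dots> = \<psi> \<circ>\<^sub>A (\<phi> \<circ>\<^sub>A snd F r)" using \<phi> r by (simp add: is_lmod_hom_def)
    also have "\<dots> = (\<psi> \<circ>\<^sub>A \<phi>) \<circ>\<^sub>A snd F r"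
      using A.Comp_assoc[OF lmodsD(3)[OF F r] \<phi>_Hom \<psi>_Hom] by simp
    finally show ?thesis .
  qed
  then show ?thesis using A.Comp_Hom[OF \<phi>_Hom \<psi>_Hom] by (simp add: is_lmod_hom_def)
qed

lemma category_LMod: "category LMod"
proof
  fix a assume "a \<in> Arr LMod"
  then show "Dom LMod a \<in> Ob LMod \<and> Cod LMod a \<in> Ob LMod" by (auto simp: lmod_cat_def)
next
  fix F assume "F \<in> Ob LMod"
  then show "Id LMod F \<in> Hom LMod F F" using is_lmod_hom_Id by simp
next
  fix a c F G H assume "a \<in> Hom LMod F G" "c \<in> Hom LMod G H"
  then show "c \<cdot>\<^bsub>LMod\<^esub> a \<in> Hom LMod F H"
    by (elim HomE_LMod) (simp add: is_lmod_hom_Comp)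
next
  fix a F G assume "a \<in> Hom LMod F G"
  then show "a \<cdot>\<^bsub>LMod\<^esub> Id LMod F = a" "Id LMod G \<cdot>\<^bsub>LMod\<^esub> a = a"
    by (auto elim!: HomE_LMod simp: is_lmod_hom_def A.Comp_Id_left A.Comp_Id_right)
next
  fix a c d E F G H assume "a \<in> Hom LMod E F" "c \<in> Hom LMod F G" "d \<in> Hom LMod G H"
  then obtain \<phi> \<psi> \<chi> where "a = (E, \<phi>, F)" "c = (F, \<psi>, G)" "d = (G, \<chi>, H)"
    and "is_lmod_hom E \<phi> F" "is_lmod_hom F \<psi> G" "is_lmod_hom G \<chi> H"
    by (elim HomE_LMod)
  moreover from this(4-6) have "(\<chi> \<circ>\<^sub>A \<psi>) \<circ>\<^sub>A \<phi> = \<chi> \<circ>\<^sub>A (\<psi> \<circ>\<^sub>A \<phi>)"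
    unfolding is_lmod_hom_def by (intro A.Comp_assoc) (elim conjE, assumption)+
  ultimately show "(d \<cdot>\<^bsub>LMod\<^esub> c) \<cdot>\<^bsub>LMod\<^esub> a = d \<cdot>\<^bsub>LMod\<^esub> (c \<cdot>\<^bsub>LMod\<^esub> a)"
    by simp
qed

lemma Ob_Funct: "T \<in> Ob Funct \<longleftrightarrow> is_functor Mod A T \<and> linear_functor k Mod A T \<and>
    right_exact_functor Mod A T \<and> commutes_with_direct_limits TYPE('u) Mod A T"
  by (simp add: B_cat_def full_subcategory_def functor_category_def)

lemma Hom_Funct: "(T', \<eta>, S') \<in> Hom Funct T S \<longleftrightarrow>
    T' = T \<and> S' = S \<and> T \<in> Ob Funct \<and> S \<in> Ob Funct \<and> nat_transf Mod A T S \<eta>"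
  by (auto simp: B_cat_def full_subcategory_def functor_category_def Hom_def)

lemma HomE_Funct:
  assumes "a \<in> Hom Funct T S"
  obtains \<eta> where "a = (T, \<eta>, S)" "T \<in> Ob Funct" "S \<in> Ob Funct" "nat_transf Mod A T S \<eta>"
proof (cases a)
  case (fields T' \<eta> S')
  then show ?thesis using assms that[of \<eta>] Hom_Funct[of T' \<eta> S' T S] by simp
qed

lemma Comp_Funct: "(S', \<theta>, Q) \<cdot>\<^bsub>Funct\<^esub> (T, \<eta>, S) = (T, (\<lambda>M\<in>Ob Mod. \<theta> M \<circ>\<^sub>A \<eta> M), Q)"
  and Id_Funct: "Id Funct T = (T, (\<lambda>M\<in>Ob Mod. Id A (FOb T M)), T)"
  by (simp_all add: B_cat_def full_subcategory_def functor_category_def)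

lemma category_Funct: "category Funct"
  unfolding B_cat_def
  by (rule category_full_subcategory[OF category_functor_category[OF category_Mod A.category_axioms]])

lemma tensor_Ob: "F \<in> lmods \<Longrightarrow> tensor F \<in> Ob Funct"
  unfolding Ob_Funct
  using tensor_universalD(1)[OF tensor_universal] tensor_universal_linear[OF _ tensor_universal]
    tensor_universal_right_exact[OF _ tensor_universal]
    tensor_universal_direct_limits[OF _ tensor_universal] by blast

lemma nat_transfD:
  assumes "nat_transf Mod A T S \<eta>"
  shows "\<eta> \<in> extensional (Ob Mod)" "M \<in> Ob Mod \<Longrightarrow> \<eta> M \<in> Hom A (FOb T M) (FOb S M)"
    "f \<in> Hom Mod M N \<Longrightarrow> \<eta> N \<circ>\<^sub>A FArr T f = FArr S f \<circ>\<^sub>A \<eta> M"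
  using assms unfolding nat_transf_def by blast+

lemma comparison_unique:
  assumes F: "F \<in> lmods" and L: "tensor_universal F L e"
    and u: "u \<in> extensional (Ob Mod)" "\<And>M. M \<in> Ob Mod \<Longrightarrow> u M \<in> Hom A (FOb L M) (FOb S M)"
    and v: "v \<in> extensional (Ob Mod)" "\<And>M. M \<in> Ob Mod \<Longrightarrow> v M \<in> Hom A (FOb L M) (FOb S M)"
    and eq: "\<And>M x. \<lbrakk>M \<in> Ob Mod; x \<in> carrier M\<rbrakk> \<Longrightarrow> u M \<circ>\<^sub>A e M x = v M \<circ>\<^sub>A e M x"
  shows "u = v"
proof (rule extensionalityI[OF u(1) v(1)])
  fix M assume M: "M \<in> Ob Mod"
  show "u M = v M" by (rule tensor_universal_cancel[OF F L M u(2)[OF M] v(2)[OF M] eq[OF M]])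
qed

lemma ex_comparison:
  assumes F: "F \<in> lmods" and G: "G \<in> lmods" and \<phi>: "is_lmod_hom F \<phi> G"
    and L: "tensor_universal F L e" and L': "tensor_universal G L' e'"
  shows "\<exists>u. nat_transf Mod A L L' u \<and> (\<forall>M\<in>Ob Mod. \<forall>x\<in>carrier M. u M \<circ>\<^sub>A e M x = e' M x \<circ>\<^sub>A \<phi>)"
proof -
  let ?P = "\<lambda>M u. u \<in> Hom A (FOb L M) (FOb L' M) \<and> (\<forall>x\<in>carrier M. u \<circ>\<^sub>A e M x = e' M x \<circ>\<^sub>A \<phi>)"
  define u where "u = (\<lambda>M\<in>Ob Mod. THE u. ?P M u)"
  have P: "?P M (u M)" if M: "M \<in> Ob Mod" for M
    using theI'[OF ex1_comparison[OF F G \<phi> L L' M]] M by (simp add: u_def del: Ob_Mod)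
  have "nat_transf Mod A L L' u"
    by (rule comparison_natural[OF F G \<phi> L L']) (use P in \<open>simp_all add: u_def del: Ob_Mod\<close>)
  then show ?thesis using P by blast
qed

definition tensor_nat :: "('o, 'a, 'r) lmod \<Rightarrow> 'a \<Rightarrow> ('o, 'a, 'r) lmod \<Rightarrow> ('u, 'r) rmodule \<Rightarrow> 'a" where
  "tensor_nat F \<phi> G = (\<lambda>M\<in>Ob Mod. tensor_arr R \<gamma> A F \<phi> G M)"

lemma tensor_nat:
  assumes F: "F \<in> lmods" and G: "G \<in> lmods" and \<phi>: "is_lmod_hom F \<phi> G"
  shows "nat_transf Mod A (tensor F) (tensor G) (tensor_nat F \<phi> G)"
    and "\<lbrakk>M \<in> Ob Mod; x \<in> carrier M\<rbrakk>
      \<Longrightarrow> tensor_nat F \<phi> G M \<circ>\<^sub>A tensor_elt F M x = tensor_elt G M x \<circ>\<^sub>A \<phi>"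
proof -
  have Hom: "tensor_nat F \<phi> G M \<in> Hom A (FOb (tensor F) M) (FOb (tensor G) M)" if "M \<in> Ob Mod" for M
    using tensor_arr(1)[OF F G \<phi> that] that by (simp add: tensor_nat_def del: Ob_Mod)
  show eq: "tensor_nat F \<phi> G M \<circ>\<^sub>A tensor_elt F M x = tensor_elt G M x \<circ>\<^sub>A \<phi>"
    if "M \<in> Ob Mod" "x \<in> carrier M" for M x
    using tensor_arr(2)[OF F G \<phi> that] that by (simp add: tensor_nat_def del: Ob_Mod)
  show "nat_transf Mod A (tensor F) (tensor G) (tensor_nat F \<phi> G)"
    by (rule comparison_natural[OF F G \<phi> tensor_universal[OF F] tensor_universal[OF G] Hom eq])
      (simp_all only: tensor_nat_def restrict_extensional)
qed

lemma tensor_nat_eqI: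
  assumes F: "F \<in> lmods" and G: "G \<in> lmods" and \<phi>: "is_lmod_hom F \<phi> G"
    and u: "u \<in> extensional (Ob Mod)" "\<And>M. M \<in> Ob Mod \<Longrightarrow> u M \<in> Hom A (FOb (tensor F) M) (FOb (tensor G) M)"
    and eq: "\<And>M x. \<lbrakk>M \<in> Ob Mod; x \<in> carrier M\<rbrakk> \<Longrightarrow> u M \<circ>\<^sub>A tensor_elt F M x = tensor_elt G M x \<circ>\<^sub>A \<phi>"
  shows "tensor_nat F \<phi> G = u"
proof (rule comparison_unique[OF F tensor_universal[OF F] _ _ u])
  note n = tensor_nat[OF F G \<phi>]
  show "tensor_nat F \<phi> G \<in> extensional (Ob Mod)"
    "\<And>M. M \<in> Ob Mod \<Longrightarrow> tensor_nat F \<phi> G M \<in> Hom A (FOb (tensor F) M) (FOb (tensor G) M)"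
    using nat_transfD[OF n(1)] by blast+
  fix M x assume M: "M \<in> Ob Mod" and x: "x \<in> carrier M"
  show "tensor_nat F \<phi> G M \<circ>\<^sub>A tensor_elt F M x = u M \<circ>\<^sub>A tensor_elt F M x"
    using n(2)[OF M x] eq[OF M x] by simp
qed

abbreviation \<Psi> where "\<Psi> \<equiv> (Psi R \<gamma> A :: (('o, 'a, 'r) lmod, ('o, 'a, 'r) lmod \<times> 'a \<times> ('o, 'a, 'r) lmod,
    (('u, 'r) rmodule, ('u, 'r) rmod_arr, 'o, 'a) cfunctor,
    (('u, 'r) rmodule, ('u, 'r) rmod_arr, 'o, 'a) cfunctor \<times> (('u, 'r) rmodule \<Rightarrow> 'a) \<times>
    (('u, 'r) rmodule, ('u, 'r) rmod_arr, 'o, 'a) cfunctor) cfunctor)"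

lemma FOb_Psi: "FOb \<Psi> F = tensor F"
  and FArr_Psi: "FArr \<Psi> (F, \<phi>, G) = (tensor F, tensor_nat F \<phi> G, tensor G)"
  by (simp_all add: Psi_def tensor_nat_def)

lemma is_functor_Psi: "is_functor LMod Funct \<Psi>"
  unfolding is_functor_def
proof (intro conjI ballI allI)
  show "FOb \<Psi> F \<in> Ob Funct" if "F \<in> Ob LMod" for F
    using tensor_Ob that by (simp add: FOb_Psi)
  show "FArr \<Psi> a \<in> Hom Funct (FOb \<Psi> F) (FOb \<Psi> G)" if a: "a \<in> Hom LMod F G" for F G a
  proof -
    obtain \<phi> where \<phi>: "a = (F, \<phi>, G)" "F \<in> lmods" "G \<in> lmods" "is_lmod_hom F \<phi> G"
      using a by (rule HomE_LMod)
    then show ?thesis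
      unfolding \<phi>(1) FArr_Psi FOb_Psi Hom_Funct using tensor_Ob tensor_nat(1) by blast
  qed
  show "FArr \<Psi> (Id LMod F) = Id Funct (FOb \<Psi> F)" if "F \<in> Ob LMod" for F
  proof -
    have F: "F \<in> lmods" using that by simp
    note L_simps = tensor_universalD[OF tensor_universal[OF F]]
    have "tensor_nat F (Id A (fst F)) F = (\<lambda>M\<in>Ob Mod. Id A (FOb (tensor F) M))"
    proof (rule tensor_nat_eqI[OF F F is_lmod_hom_Id[OF F]])
      fix M assume M: "M \<in> Ob Mod"
      show "(\<lambda>M\<in>Ob Mod. Id A (FOb (tensor F) M)) M \<in> Hom A (FOb (tensor F) M) (FOb (tensor F) M)"
        using A.Id_Hom[OF L_simps(5)[OF M]] M by (simp del: Ob_Mod)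
      fix x assume x: "x \<in> carrier M"
      show "(\<lambda>M\<in>Ob Mod. Id A (FOb (tensor F) M)) M \<circ>\<^sub>A tensor_elt F M x = tensor_elt F M x \<circ>\<^sub>A Id A (fst F)"
        using A.Comp_Id_left[OF L_simps(6)[OF M x]] A.Comp_Id_right[OF L_simps(6)[OF M x]] M
        by (simp del: Ob_Mod)
    qed (simp del: Ob_Mod)
    then show ?thesis by (simp only: Id_LMod FArr_Psi FOb_Psi Id_Funct)
  qed
  show "FArr \<Psi> (c \<cdot>\<^bsub>LMod\<^esub> a) = FArr \<Psi> c \<cdot>\<^bsub>Funct\<^esub> FArr \<Psi> a"
    if a: "a \<in> Hom LMod F G" and c: "c \<in> Hom LMod G H" for F G H a c
  proof -
    obtain \<phi> where \<phi>: "a = (F, \<phi>, G)" "F \<in> lmods" "G \<in> lmods" "is_lmod_hom F \<phi> G"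
      using a by (rule HomE_LMod)
    obtain \<psi> where \<psi>: "c = (G, \<psi>, H)" "H \<in> lmods" "is_lmod_hom G \<psi> H"
      using c by (rule HomE_LMod)
    have \<phi>_Hom: "\<phi> \<in> Hom A (fst F) (fst G)" and \<psi>_Hom: "\<psi> \<in> Hom A (fst G) (fst H)"
      using \<phi> \<psi> by (simp_all add: is_lmod_hom_def)
    note F_simps = tensor_universalD[OF tensor_universal[OF \<phi>(2)]]
      and G_simps = tensor_universalD[OF tensor_universal[OF \<phi>(3)]]
      and H_simps = tensor_universalD[OF tensor_universal[OF \<psi>(2)]]
    note n = tensor_nat[OF \<phi>(2-4)] and m = tensor_nat[OF \<phi>(3) \<psi>(2,3)]
    note n_Hom = nat_transfD(2)[OF n(1)] and m_Hom = nat_transfD(2)[OF m(1)]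
    let ?c = "\<lambda>M\<in>Ob Mod. tensor_nat G \<psi> H M \<circ>\<^sub>A tensor_nat F \<phi> G M"
    have "tensor_nat F (\<psi> \<circ>\<^sub>A \<phi>) H = ?c"
    proof (rule tensor_nat_eqI[OF \<phi>(2) \<psi>(2) is_lmod_hom_Comp[OF \<phi>(2,3) \<psi>(2) \<phi>(4) \<psi>(3)]])
      fix M assume M: "M \<in> Ob Mod"
      show "?c M \<in> Hom A (FOb (tensor F) M) (FOb (tensor H) M)"
        using A.Comp_Hom[OF n_Hom[OF M] m_Hom[OF M]] M by (simp del: Ob_Mod)
      fix x assume x: "x \<in> carrier M"
      have "(tensor_nat G \<psi> H M \<circ>\<^sub>A tensor_nat F \<phi> G M) \<circ>\<^sub>A tensor_elt F M x =
          tensor_nat G \<psi> H M \<circ>\<^sub>A (tensor_elt G M x \<circ>\<^sub>A \<phi>)"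
        using A.Comp_assoc[OF F_simps(6)[OF M x] n_Hom[OF M] m_Hom[OF M]] n(2)[OF M x] by simp
      also have "\<dots> = (tensor_elt H M x \<circ>\<^sub>A \<psi>) \<circ>\<^sub>A \<phi>"
        using A.Comp_assoc[OF \<phi>_Hom G_simps(6)[OF M x] m_Hom[OF M]] m(2)[OF M x] by simp
      also have "\<dots> = tensor_elt H M x \<circ>\<^sub>A (\<psi> \<circ>\<^sub>A \<phi>)"
        by (rule A.Comp_assoc[OF \<phi>_Hom \<psi>_Hom H_simps(6)[OF M x]])
      finally show "?c M \<circ>\<^sub>A tensor_elt F M x = tensor_elt H M x \<circ>\<^sub>A (\<psi> \<circ>\<^sub>A \<phi>)"
        using M by (simp del: Ob_Mod)
    qed (simp del: Ob_Mod)
    then show ?thesis by (simp only: \<phi>(1) \<psi>(1) Comp_LMod FArr_Psi Comp_Funct)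
  qed
qed

subsection \<open>Full faithfulness\<close>

text \<open>The universal arrow \<open>b \<otimes> - : F \<rightarrow> B \<otimes> F\<close> of the free module on one generator is invertible.\<close>

lemma generator_iso:
  assumes F: "F \<in> lmods" and L: "tensor_universal F L e"
  obtains t where "t \<in> Hom A (FOb L B) (fst F)" "t \<circ>\<^sub>A e B b = Id A (fst F)" "e B b \<circ>\<^sub>A t = Id A (FOb L B)"
proof -
  note L_simps = tensor_universalD[OF L]
  let ?H = "Hom_rmodule A F (fst F)" and ?id = "Id A (fst F)"
  have H: "right_module R ?H" by (rule right_module_Hom[OF F lmodsD(1)[OF F]])
  have id: "?id \<in> carrier ?H" using A.Id_Hom[OF lmodsD(1)[OF F]] by simp
  have "\<exists>!t. t \<in> Hom A (FOb L B) (fst F) \<and> (\<forall>y\<in>carrier B. t \<circ>\<^sub>A e B y = hat ?H ?id y)"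
    by (rule L_simps(4)[OF B_Ob lmodsD(1)[OF F] hat_lin[OF H id]])
  then obtain t where t: "t \<in> Hom A (FOb L B) (fst F)" "\<forall>y\<in>carrier B. t \<circ>\<^sub>A e B y = hat ?H ?id y"
    by (elim ex1E conjE)
  note eb = L_simps(6)[OF B_Ob b_closed]
  have "t \<circ>\<^sub>A e B b = ?id" using bspec[OF t(2) b_closed] hat_b[OF H id] by simp
  moreover have "e B b \<circ>\<^sub>A t = Id A (FOb L B)"
  proof (rule tensor_universal_cancel[OF F L B_Ob A.Comp_Hom[OF t(1) eb] A.Id_Hom[OF L_simps(5)[OF B_Ob]]])
    fix y assume y: "y \<in> carrier B"
    then obtain r where r: "r \<in> carrier R" "y = b \<triangleleft>\<^bsub>B\<^esub> r" by (rule B_cases)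
    have "(e B b \<circ>\<^sub>A t) \<circ>\<^sub>A e B y = e B b \<circ>\<^sub>A (?id \<circ>\<^sub>A snd F r)"
      using A.Comp_assoc[OF L_simps(6)[OF B_Ob y] t(1) eb] bspec[OF t(2) y] r by (simp add: hat_ract)
    also have "\<dots> = e B y"
      using A.Comp_Id_left[OF lmodsD(3)[OF F r(1)]] Hom_valued_lin_mapsD(4)[OF L_simps(2)[OF B_Ob] b_closed r(1)] r(2)
      by simp
    finally show "(e B b \<circ>\<^sub>A t) \<circ>\<^sub>A e B y = Id A (FOb L B) \<circ>\<^sub>A e B y"
      using A.Comp_Id_left[OF L_simps(6)[OF B_Ob y]] by simp
  qed
  ultimately show ?thesis using that[OF t(1)] by blast
qed

text \<open>The component at \<open>B\<close> of the transformation induced by \<open>\<phi>\<close> is conjugate to \<open>\<phi>\<close>.\<close>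

lemma Psi_faithful:
  assumes F: "F \<in> lmods" and G: "G \<in> lmods" and \<phi>: "is_lmod_hom F \<phi> G" and \<psi>: "is_lmod_hom F \<psi> G"
    and eq: "tensor_nat F \<phi> G = tensor_nat F \<psi> G"
  shows "\<phi> = \<psi>"
proof -
  note G_simps = tensor_universalD[OF tensor_universal[OF G]]
  obtain t where t: "t \<in> Hom A (FOb (tensor G) B) (fst G)" "t \<circ>\<^sub>A tensor_elt G B b = Id A (fst G)"
    by (rule generator_iso[OF G tensor_universal[OF G]])
  have recover: "\<chi> = t \<circ>\<^sub>A (tensor_nat F \<chi> G B \<circ>\<^sub>A tensor_elt F B b)" if \<chi>: "is_lmod_hom F \<chi> G" for \<chi>
  proof -
    have \<chi>_Hom: "\<chi> \<in> Hom A (fst F) (fst G)" using \<chi> by (simp add: is_lmod_hom_def)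
    have "t \<circ>\<^sub>A (tensor_nat F \<chi> G B \<circ>\<^sub>A tensor_elt F B b) = (t \<circ>\<^sub>A tensor_elt G B b) \<circ>\<^sub>A \<chi>"
      using A.Comp_assoc[OF \<chi>_Hom G_simps(6)[OF B_Ob b_closed] t(1)]
        tensor_nat(2)[OF F G \<chi> B_Ob b_closed] by simp
    then show ?thesis using t(2) A.Comp_Id_left[OF \<chi>_Hom] by simp
  qed
  show ?thesis using recover[OF \<phi>] recover[OF \<psi>] eq by simp
qed

text \<open>A natural transformation is determined by its component at \<open>B\<close>, because every element \<open>x\<close>
  of \<open>M\<close> is the image of \<open>b\<close> under an arrow \<open>B \<rightarrow> M\<close>; naturality at the endomorphisms of \<open>B\<close>
  makes that component \<open>R\<close>-linear.\<close>

lemma Psi_full: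
  assumes F: "F \<in> lmods" and G: "G \<in> lmods" and \<eta>: "nat_transf Mod A (tensor F) (tensor G) \<eta>"
  shows "\<exists>\<phi>. is_lmod_hom F \<phi> G \<and> tensor_nat F \<phi> G = \<eta>"
proof -
  note F_simps = tensor_universalD[OF tensor_universal[OF F]]
    and G_simps = tensor_universalD[OF tensor_universal[OF G]]
  note \<eta>_Hom = nat_transfD(2)[OF \<eta>] and \<eta>_nat = nat_transfD(3)[OF \<eta>]
  obtain t where t: "t \<in> Hom A (FOb (tensor G) B) (fst G)"
    and te: "t \<circ>\<^sub>A tensor_elt G B b = Id A (fst G)" and et: "tensor_elt G B b \<circ>\<^sub>A t = Id A (FOb (tensor G) B)"
    by (rule generator_iso[OF G tensor_universal[OF G]])
  note Fb = F_simps(6)[OF B_Ob b_closed] and Gb = G_simps(6)[OF B_Ob b_closed]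
  define \<phi> where "\<phi> = t \<circ>\<^sub>A (\<eta> B \<circ>\<^sub>A tensor_elt F B b)"
  have \<eta>b: "\<eta> B \<circ>\<^sub>A tensor_elt F B b \<in> Hom A (fst F) (FOb (tensor G) B)"
    by (rule A.Comp_Hom[OF Fb \<eta>_Hom[OF B_Ob]])
  have \<phi>_Hom: "\<phi> \<in> Hom A (fst F) (fst G)" unfolding \<phi>_def by (rule A.Comp_Hom[OF \<eta>b t])
  have Gb_\<phi>: "tensor_elt G B b \<circ>\<^sub>A \<phi> = \<eta> B \<circ>\<^sub>A tensor_elt F B b"
    unfolding \<phi>_def using A.Comp_assoc[OF \<eta>b t Gb] et A.Comp_Id_left[OF \<eta>b] by simp
  have \<eta>_elt: "\<eta> M \<circ>\<^sub>A tensor_elt F M x = tensor_elt G M x \<circ>\<^sub>A \<phi>" if M: "M \<in> Ob Mod" and x: "x \<in> carrier M" for M x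
  proof -
    have M_mod: "right_module R M" using M by simp
    let ?x = "(B, hat M x, M)"
    have x_Hom: "?x \<in> Hom Mod B M" by (rule hat_Hom[OF M x])
    then have x_Arr: "?x \<in> Arr Mod" by simp
    note Fx = is_functorD(2)[OF F_simps(1) x_Hom] and Gx = is_functorD(2)[OF G_simps(1) x_Hom]
    have "\<eta> M \<circ>\<^sub>A tensor_elt F M x = \<eta> M \<circ>\<^sub>A (FArr (tensor F) ?x \<circ>\<^sub>A tensor_elt F B b)"
      using F_simps(3)[OF x_Arr b_closed] hat_b[OF M_mod x] by simp
    also have "\<dots> = (FArr (tensor G) ?x \<circ>\<^sub>A \<eta> B) \<circ>\<^sub>A tensor_elt F B b"
      using A.Comp_assoc[OF Fb Fx \<eta>_Hom[OF M]] \<eta>_nat[OF x_Hom] by simp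
    also have "\<dots> = FArr (tensor G) ?x \<circ>\<^sub>A (tensor_elt G B b \<circ>\<^sub>A \<phi>)"
      using A.Comp_assoc[OF Fb \<eta>_Hom[OF B_Ob] Gx] Gb_\<phi> by simp
    also have "\<dots> = tensor_elt G M x \<circ>\<^sub>A \<phi>"
      using A.Comp_assoc[OF \<phi>_Hom Gb Gx] G_simps(3)[OF x_Arr b_closed] hat_b[OF M_mod x] by simp
    finally show ?thesis .
  qed
  have "snd G r \<circ>\<^sub>A \<phi> = \<phi> \<circ>\<^sub>A snd F r" if r: "r \<in> carrier R" for r
  proof -
    note \<rho>F = lmodsD(3)[OF F r] and \<rho>G = lmodsD(3)[OF G r]
    have Fr: "tensor_elt F B (b \<triangleleft>\<^bsub>B\<^esub> r) = tensor_elt F B b \<circ>\<^sub>A snd F r"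
      by (rule Hom_valued_lin_mapsD(4)[OF F_simps(2)[OF B_Ob] b_closed r])
    have Gr: "tensor_elt G B (b \<triangleleft>\<^bsub>B\<^esub> r) = tensor_elt G B b \<circ>\<^sub>A snd G r"
      by (rule Hom_valued_lin_mapsD(4)[OF G_simps(2)[OF B_Ob] b_closed r])
    have "tensor_elt G B b \<circ>\<^sub>A (snd G r \<circ>\<^sub>A \<phi>) = \<eta> B \<circ>\<^sub>A (tensor_elt F B b \<circ>\<^sub>A snd F r)"
      using A.Comp_assoc[OF \<phi>_Hom \<rho>G Gb] \<eta>_elt[OF B_Ob b_ract_closed[OF r]] Fr Gr by simp
    also have "\<dots> = tensor_elt G B b \<circ>\<^sub>A (\<phi> \<circ>\<^sub>A snd F r)"
      using A.Comp_assoc[OF \<rho>F Fb \<eta>_Hom[OF B_Ob]] A.Comp_assoc[OF \<rho>F \<phi>_Hom Gb] Gb_\<phi> by simp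
    finally have eq: "tensor_elt G B b \<circ>\<^sub>A (snd G r \<circ>\<^sub>A \<phi>) = tensor_elt G B b \<circ>\<^sub>A (\<phi> \<circ>\<^sub>A snd F r)" .
    have cancel: "t \<circ>\<^sub>A (tensor_elt G B b \<circ>\<^sub>A \<chi>) = \<chi>" if "\<chi> \<in> Hom A (fst F) (fst G)" for \<chi>
      using A.Comp_assoc[OF that Gb t] te A.Comp_Id_left[OF that] by simp
    from cancel[OF A.Comp_Hom[OF \<phi>_Hom \<rho>G]] cancel[OF A.Comp_Hom[OF \<rho>F \<phi>_Hom]]
    show ?thesis unfolding eq by (rule trans[OF sym])
  qed
  then have \<phi>: "is_lmod_hom F \<phi> G" using \<phi>_Hom by (simp add: is_lmod_hom_def)
  have "tensor_nat F \<phi> G = \<eta>"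
    by (rule tensor_nat_eqI[OF F G \<phi> nat_transfD(1)[OF \<eta>] \<eta>_Hom \<eta>_elt])
  then show ?thesis using \<phi> by blast
qed

lemma Psi_fully_faithful:
  assumes F: "F \<in> lmods" and G: "G \<in> lmods"
  shows "bij_betw (FArr \<Psi>) (Hom LMod F G) (Hom Funct (FOb \<Psi> F) (FOb \<Psi> G))"
  unfolding bij_betw_def
proof
  show "inj_on (FArr \<Psi>) (Hom LMod F G)"
  proof (rule inj_onI)
    fix a c assume a: "a \<in> Hom LMod F G" and c: "c \<in> Hom LMod F G" and eq: "FArr \<Psi> a = FArr \<Psi> c"
    obtain \<phi> where \<phi>: "a = (F, \<phi>, G)" "is_lmod_hom F \<phi> G" using a by (rule HomE_LMod)
    obtain \<psi> where \<psi>: "c = (F, \<psi>, G)" "is_lmod_hom F \<psi> G" using c by (rule HomE_LMod)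
    have "tensor_nat F \<phi> G = tensor_nat F \<psi> G" using eq unfolding \<phi>(1) \<psi>(1) FArr_Psi by simp
    then show "a = c" using Psi_faithful[OF F G \<phi>(2) \<psi>(2)] \<phi>(1) \<psi>(1) by simp
  qed
  show "FArr \<Psi> ` Hom LMod F G = Hom Funct (FOb \<Psi> F) (FOb \<Psi> G)"
  proof (intro equalityI subsetI)
    fix y assume "y \<in> FArr \<Psi> ` Hom LMod F G"
    then show "y \<in> Hom Funct (FOb \<Psi> F) (FOb \<Psi> G)"
      using is_functorD(2)[OF is_functor_Psi] by blast
  next
    fix y assume y: "y \<in> Hom Funct (FOb \<Psi> F) (FOb \<Psi> G)"
    obtain \<eta> where \<eta>: "y = (tensor F, \<eta>, tensor G)" "nat_transf Mod A (tensor F) (tensor G) \<eta>"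
      using y unfolding FOb_Psi by (rule HomE_Funct)
    obtain \<phi> where "is_lmod_hom F \<phi> G" "tensor_nat F \<phi> G = \<eta>"
      using Psi_full[OF F G \<eta>(2)] by (elim exE conjE)
    then have "(F, \<phi>, G) \<in> Hom LMod F G" "y = FArr \<Psi> (F, \<phi>, G)"
      using F G \<eta>(1) unfolding FArr_Psi by simp_all
    then show "y \<in> FArr \<Psi> ` Hom LMod F G" by blast
  qed
qed

subsection \<open>Essential surjectivity\<close>

text \<open>Both \<open>T\<close> and the tensor functor of \<open>T B\<close> are universal for the left module \<open>T B\<close>, and universal
  arrows are unique up to a unique isomorphism.\<close>

lemma Psi_essentially_surjective:
  assumes T: "T \<in> Ob Funct"
  shows "\<exists>F\<in>Ob LMod. \<exists>a\<in>Hom Funct (FOb \<Psi> F) T. is_iso Funct a"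
proof -
  interpret T: right_exact_continuous_functor k R \<gamma> A B b T
    by (intro right_exact_continuous_functor.intro right_exact_continuous_functor_axioms.intro
        tensor_setting_axioms) (use T in \<open>simp_all add: Ob_Funct\<close>)
  interpret Funct: category Funct by (rule category_Funct)
  let ?F = "T.T_lmod"
  have F: "?F \<in> lmods" by (rule T.T_lmod)
  note L = tensor_universal[OF F] and id = is_lmod_hom_Id[OF F]
  have inverse_comparison: "(\<lambda>M\<in>Ob Mod. v M \<circ>\<^sub>A u M) = (\<lambda>M\<in>Ob Mod. Id A (FOb L M))"
    if L: "tensor_universal ?F L e" and L': "tensor_universal ?F L' e'"
      and u: "nat_transf Mod A L L' u" and v: "nat_transf Mod A L' L v"
      and ue: "\<forall>M\<in>Ob Mod. \<forall>x\<in>carrier M. u M \<circ>\<^sub>A e M x = e' M x \<circ>\<^sub>A Id A (fst ?F)"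
      and ve: "\<forall>M\<in>Ob Mod. \<forall>x\<in>carrier M. v M \<circ>\<^sub>A e' M x = e M x \<circ>\<^sub>A Id A (fst ?F)"
    for L L' e e' u v
  proof (rule comparison_unique[OF F L])
    note L_simps = tensor_universalD[OF L] and L'_simps = tensor_universalD[OF L']
    fix M assume M: "M \<in> Ob Mod"
    note uM = nat_transfD(2)[OF u M] and vM = nat_transfD(2)[OF v M]
    show "(\<lambda>M\<in>Ob Mod. v M \<circ>\<^sub>A u M) M \<in> Hom A (FOb L M) (FOb L M)"
      using A.Comp_Hom[OF uM vM] M by (simp del: Ob_Mod)
    show "(\<lambda>M\<in>Ob Mod. Id A (FOb L M)) M \<in> Hom A (FOb L M) (FOb L M)"
      using A.Id_Hom[OF L_simps(5)[OF M]] M by (simp del: Ob_Mod)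
    fix x assume x: "x \<in> carrier M"
    note e = L_simps(6)[OF M x] and e' = L'_simps(6)[OF M x]
    have "(v M \<circ>\<^sub>A u M) \<circ>\<^sub>A e M x = v M \<circ>\<^sub>A (u M \<circ>\<^sub>A e M x)" by (rule A.Comp_assoc[OF e uM vM])
    also have "\<dots> = v M \<circ>\<^sub>A e' M x" using ue M x A.Comp_Id_right[OF e'] by (simp del: Ob_Mod)
    also have "\<dots> = e M x" using ve M x A.Comp_Id_right[OF e] by (simp del: Ob_Mod)
    finally show "(\<lambda>M\<in>Ob Mod. v M \<circ>\<^sub>A u M) M \<circ>\<^sub>A e M x = (\<lambda>M\<in>Ob Mod. Id A (FOb L M)) M \<circ>\<^sub>A e M x"
      using A.Comp_Id_left[OF e] M by (simp del: Ob_Mod)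
  qed (simp_all del: Ob_Mod)
  obtain u where u: "nat_transf Mod A (tensor ?F) T u"
    and ue: "\<forall>M\<in>Ob Mod. \<forall>x\<in>carrier M. u M \<circ>\<^sub>A tensor_elt ?F M x = T.elt M x \<circ>\<^sub>A Id A (fst ?F)"
    using ex_comparison[OF F F id L T.universal] by (elim exE conjE)
  obtain v where v: "nat_transf Mod A T (tensor ?F) v"
    and ve: "\<forall>M\<in>Ob Mod. \<forall>x\<in>carrier M. v M \<circ>\<^sub>A T.elt M x = tensor_elt ?F M x \<circ>\<^sub>A Id A (fst ?F)"
    using ex_comparison[OF F F id T.universal L] by (elim exE conjE)
  have u_Hom: "(tensor ?F, u, T) \<in> Hom Funct (tensor ?F) T" and v_Hom: "(T, v, tensor ?F) \<in> Hom Funct T (tensor ?F)"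
    using u v T tensor_Ob[OF F] by (simp_all add: Hom_Funct)
  have "is_iso Funct (tensor ?F, u, T)"
  proof (rule Funct.isoI[OF u_Hom v_Hom])
    show "(T, v, tensor ?F) \<cdot>\<^bsub>Funct\<^esub> (tensor ?F, u, T) = Id Funct (tensor ?F)"
      unfolding Comp_Funct Id_Funct inverse_comparison[OF L T.universal u v ue ve] ..
    show "(tensor ?F, u, T) \<cdot>\<^bsub>Funct\<^esub> (T, v, tensor ?F) = Id Funct T"
      unfolding Comp_Funct Id_Funct inverse_comparison[OF T.universal L v u ve ue] ..
  qed
  then show ?thesis using u_Hom F by (intro bexI[of _ ?F] bexI[of _ "(tensor ?F, u, T)"]) (simp_all add: FOb_Psi)
qed

theorem Psi_equivalence: "equivalence_of_categories LMod Funct \<Psi>"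
proof (rule equivalence_if_fully_faithful_and_essentially_surjective
    [OF category_LMod category_Funct is_functor_Psi])
  show "bij_betw (FArr \<Psi>) (Hom LMod F G) (Hom Funct (FOb \<Psi> F) (FOb \<Psi> G))"
    if "F \<in> Ob LMod" "G \<in> Ob LMod" for F G
    using that unfolding Ob_LMod by (rule Psi_fully_faithful)
  show "\<exists>F\<in>Ob LMod. \<exists>a\<in>Hom Funct (FOb \<Psi> F) T. is_iso Funct a" if "T \<in> Ob Funct" for T
    using that by (rule Psi_essentially_surjective)
qed

end

text \<open>It remains to find the free module \<open>B\<close> on one generator in the universe: \<open>R\<close> is small, so it has a
  copy there, generated by the image of \<open>1\<close>.\<close>

theorem theorem3p1:
  fixes k :: "'k ring" and R :: "'r ring" and \<gamma> :: "'k \<Rightarrow> 'r"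
    and A :: "('o, 'a, 'k) lcategory"
  assumes "infinite (UNIV :: 'u set)" and "regularCard |UNIV :: 'u set|"
    and "assoc_algebra k R \<gamma>" and "|carrier R| <o |UNIV :: 'u set|"
    and "abelian_category k A" and "cocomplete TYPE('u) A"
  shows "equivalence_of_categories (lmod_cat k R \<gamma> A) (B_cat k R \<gamma> A)
    (Psi R \<gamma> A :: (_, _, (('u, 'r) rmodule, _, _, _) cfunctor, _) cfunctor)"
proof -
  interpret alg: assoc_algebra k R \<gamma> by fact
  let ?R = "\<lparr>carrier = carrier R, mult = undefined, one = undefined, zero = \<zero>\<^bsub>R\<^esub>, add = add R,
    ract = mult R\<rparr> :: ('r, 'r) rmodule"
  have R_mod: "right_module R ?R"
  proof (rule right_moduleI)
    show "ring R" by (rule alg.R.ring_axioms)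
    show "abelian_group ?R"
      by (rule abelian_groupI)
        (auto simp: alg.R.a_ac intro!: bexI[of _ "\<ominus>\<^bsub>R\<^esub> x" for x] alg.R.l_neg)
  qed (auto simp: alg.R.l_distr alg.R.r_distr alg.R.m_assoc)
  have "|carrier ?R| <o |UNIV :: 'u set|" using assms(4) by simp
  from ex_small_copy[OF R_mod this] obtain B :: "('u, 'r) rmodule" and p q where
    *: "right_module R B \<and> small (carrier B) \<and> p \<in> lin_maps R ?R B \<and> q \<in> lin_maps R B ?R \<and>
      (\<forall>x\<in>carrier ?R. q (p x) = x) \<and> (\<forall>y\<in>carrier B. p (q y) = y)"
    by (elim exE)
  then have B: "right_module R B" "small (carrier B)" and p: "p \<in> lin_maps R ?R B" and q: "q \<in> lin_maps R B ?R"
    and qp: "\<And>x. x \<in> carrier R \<Longrightarrow> q (p x) = x" and pq: "\<And>y. y \<in> carrier B \<Longrightarrow> p (q y) = y"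
    by simp_all
  have p_r: "p \<one>\<^bsub>R\<^esub> \<triangleleft>\<^bsub>B\<^esub> r = p r" if "r \<in> carrier R" for r
    using lin_mapsD(4)[OF p, of "\<one>\<^bsub>R\<^esub>" r] that by simp
  have "bij_betw p (carrier R) (carrier B)"
    by (rule bij_betw_byWitness[where f' = q])
      (use qp pq lin_mapsD(2)[OF p] lin_mapsD(2)[OF q] in auto)
  then have free: "bij_betw (\<lambda>r. p \<one>\<^bsub>R\<^esub> \<triangleleft>\<^bsub>B\<^esub> r) (carrier R) (carrier B)"
    using bij_betw_cong[of "carrier R" "\<lambda>r. p \<one>\<^bsub>R\<^esub> \<triangleleft>\<^bsub>B\<^esub> r" p] p_r by blast
  have "p \<one>\<^bsub>R\<^esub> \<in> carrier B" using lin_mapsD(2)[OF p] by simp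
  then interpret tensor_setting k R \<gamma> A B "p \<one>\<^bsub>R\<^esub>"
    using assms B free by (intro tensor_setting.intro tensor_setting_axioms.intro)
  show ?thesis by (rule Psi_equivalence)
qed

end
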